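(* Let $\theta=\frac{\sqrt5-1}{2}$, let $\lambda\ge8$, and let $H$ be the Fibonacci Hamiltonian, i.e. the operator on $\ell^2(\mathbb{Z})$ given by $[H\psi](n)=\psi(n+1)+\psi(n-1)+V(n)\psi(n)$ with $V(n)=\lambda\chi_{[1-\theta,1)}(n\theta \bmod 1)$. Let $$\xi(\lambda)=\frac{\lambda-4+\sqrt{(\lambda-4)^2-12}}{2},\qquad \alpha(\lambda)=\frac{2\log\frac{\sqrt5+1}{2}}{\log\xi(\lambda)}.$$ Then $\alpha_u^+\le\alpha(\lambda)$, and hence $\beta^+_{\delta_1}(p)\le\alpha(\lambda)$ for every $p>0$.
   Context: Let $(\delta_n)$ be the canonical basis of $\ell^2(\mathbb{Z})$. For $T>0$ let $a(n,T)=\frac{2}{T}\int_0^\infty e^{-2t/T}|\langle e^{-itH}\delta_1,\delta_n\rangle|^2\,dt$. For $p>0$ let $\langle|X|^p_{\delta_1}\rangle(T)=\sum_n|n|^pa(n,T)$ and $\beta^+_{\delta_1}(p)=\limsup_{T\to\infty}\frac{\log\langle|X|^p_{\delta_1}\rangle(T)}{p\log T}$. For real $N$ let $P(N,T)=\sum_{|n|>N}a(n,T)$. For $\alpha\in[0,+\infty]$ let $S^+(\alpha)=-\limsup_{T\to\infty}\frac{\log P(T^\alpha-2,T)}{\log T}\in[0,\infty]$, and $\alpha_u^+=\sup\{\alpha\ge0: S^+(\alpha)<\infty\}$. $\chi_A$ is the indicator function of $A$. *)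

theory Defs
  imports "HOL-Analysis.Analysis"
begin

typedef ell2 = "{f :: int \<Rightarrow> complex. (\<lambda>n. (cmod (f n))\<^sup>2) summable_on UNIV}"
  morphisms ell2_coeff Abs_ell2
  by (rule exI[of _ "\<lambda>_. 0"]) simp

setup_lifting type_definition_ell2

lemma ell2_coeff_square_summable:
  "(\<lambda>n. (cmod (ell2_coeff x n))\<^sup>2) summable_on UNIV"
  using ell2_coeff[of x] by simp

lemma ell2_eqI: "(\<And>n. ell2_coeff x n = ell2_coeff y n) \<Longrightarrow> x = y"
  by (simp add: ell2_coeff_inject[symmetric] ext)

lemma square_summable_mult:
  assumes "(\<lambda>n. (cmod (f n))\<^sup>2) summable_on UNIV" and "\<And>n. cmod (g n) \<le> B"
  shows "(\<lambda>n. (cmod (g n * f n))\<^sup>2) summable_on UNIV"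
proof (rule summable_on_comparison_test)
  show "(\<lambda>n. B\<^sup>2 * (cmod (f n))\<^sup>2) summable_on UNIV"
    by (intro summable_on_cmult_right assms)
  show "(cmod (g n * f n))\<^sup>2 \<le> B\<^sup>2 * (cmod (f n))\<^sup>2" for n
    unfolding norm_mult power_mult_distrib
    by (intro mult_right_mono power_mono assms) auto
qed auto

lemma square_norm_add_le:
  "(norm (a + b :: 'a :: real_normed_vector))\<^sup>2 \<le> 2 * (norm a)\<^sup>2 + 2 * (norm b)\<^sup>2"
proof -
  have "(norm (a + b))\<^sup>2 \<le> (norm a + norm b)\<^sup>2"
    by (intro power_mono norm_triangle_ineq) auto
  also have "\<dots> \<le> 2 * (norm a)\<^sup>2 + 2 * (norm b)\<^sup>2"
    using sum_squares_ge_zero[of "norm a - norm b" 0]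
    by (simp add: power2_eq_square algebra_simps)
  finally show ?thesis .
qed

lemma square_summable_add:
  assumes "(\<lambda>n. (cmod (f n))\<^sup>2) summable_on UNIV" "(\<lambda>n. (cmod (g n))\<^sup>2) summable_on UNIV"
  shows "(\<lambda>n. (cmod (f n + g n))\<^sup>2) summable_on UNIV"
proof (rule summable_on_comparison_test)
  show "(\<lambda>n. 2 * (cmod (f n))\<^sup>2 + 2 * (cmod (g n))\<^sup>2) summable_on UNIV"
    by (intro summable_on_add summable_on_cmult_right assms)
qed (auto simp: square_norm_add_le)

lemma square_summable_shift:
  assumes "(\<lambda>n. (cmod (f n))\<^sup>2) summable_on UNIV"
  shows "(\<lambda>n. (cmod (f (n + k :: int)))\<^sup>2) summable_on UNIV"
    and "(\<Sum>\<^sub>\<infinity>n. (cmod (f (n + k)))\<^sup>2) = (\<Sum>\<^sub>\<infinity>n. (cmod (f n))\<^sup>2)"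
proof -
  have bij: "bij_betw (\<lambda>n::int. n + k) UNIV UNIV"
    by (rule bij_betwI[where g = "\<lambda>n. n - k"]) auto
  show "(\<lambda>n. (cmod (f (n + k)))\<^sup>2) summable_on UNIV"
    using summable_on_reindex_bij_betw[OF bij, of "\<lambda>n. (cmod (f n))\<^sup>2"] assms by simp
  show "(\<Sum>\<^sub>\<infinity>n. (cmod (f (n + k)))\<^sup>2) = (\<Sum>\<^sub>\<infinity>n. (cmod (f n))\<^sup>2)"
    by (rule infsum_reindex_bij_betw[OF bij])
qed

lemma ell2_inner_abs_summable:
  "(\<lambda>n. cmod (ell2_coeff x n * cnj (ell2_coeff y n))) summable_on UNIV"
proof (rule summable_on_comparison_test)
  show "(\<lambda>n. (cmod (ell2_coeff x n))\<^sup>2 + (cmod (ell2_coeff y n))\<^sup>2) summable_on UNIV"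
    by (intro summable_on_add ell2_coeff_square_summable)
  show "cmod (ell2_coeff x n * cnj (ell2_coeff y n))
      \<le> (cmod (ell2_coeff x n))\<^sup>2 + (cmod (ell2_coeff y n))\<^sup>2" for n
    using sum_squares_bound[of "cmod (ell2_coeff x n)" "cmod (ell2_coeff y n)"]
      mult_nonneg_nonneg[OF norm_ge_zero[of "ell2_coeff x n"] norm_ge_zero[of "ell2_coeff y n"]]
    unfolding norm_mult complex_mod_cnj by linarith
qed auto

lemma ell2_inner_summable:
  "(\<lambda>n. ell2_coeff x n * cnj (ell2_coeff y n)) summable_on UNIV"
  using ell2_inner_abs_summable by (rule abs_summable_summable)

definition ell2_cinner :: "ell2 \<Rightarrow> ell2 \<Rightarrow> complex" where
  "ell2_cinner x y = (\<Sum>\<^sub>\<infinity>n. ell2_coeff x n * cnj (ell2_coeff y n))"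

instantiation ell2 :: real_vector
begin

lift_definition zero_ell2 :: ell2 is "\<lambda>_. 0" by simp

lift_definition plus_ell2 :: "ell2 \<Rightarrow> ell2 \<Rightarrow> ell2" is "\<lambda>f g n. f n + g n"
  by (rule square_summable_add)

lift_definition uminus_ell2 :: "ell2 \<Rightarrow> ell2" is "\<lambda>f n. - f n" by simp

lift_definition minus_ell2 :: "ell2 \<Rightarrow> ell2 \<Rightarrow> ell2" is "\<lambda>f g n. f n - g n"
proof -
  fix f g :: "int \<Rightarrow> complex"
  assume "(\<lambda>n. (cmod (f n))\<^sup>2) summable_on UNIV" "(\<lambda>n. (cmod (g n))\<^sup>2) summable_on UNIV"
  then show "(\<lambda>n. (cmod (f n - g n))\<^sup>2) summable_on UNIV"
    using square_summable_add[of f "\<lambda>n. - g n"] by simp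
qed

lift_definition scaleR_ell2 :: "real \<Rightarrow> ell2 \<Rightarrow> ell2" is "\<lambda>r f n. complex_of_real r * f n"
  by (rule square_summable_mult) auto

instance
  by standard (transfer; simp add: algebra_simps fun_eq_iff)+

end

lemma ell2_cinner_add_left: "ell2_cinner (x + y) z = ell2_cinner x z + ell2_cinner y z"
  unfolding ell2_cinner_def plus_ell2.rep_eq
  by (simp add: ring_distribs infsum_add ell2_inner_summable)

lemma ell2_cinner_scaleR_left: "ell2_cinner (r *\<^sub>R x) y = complex_of_real r * ell2_cinner x y"
  unfolding ell2_cinner_def scaleR_ell2.rep_eq
  by (simp add: mult.assoc infsum_cmult_right')

lemma ell2_cinner_commute: "ell2_cinner y x = cnj (ell2_cinner x y)"
  unfolding ell2_cinner_def by (simp flip: infsum_cnj add: mult.commute)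

lemma ell2_cinner_self:
  "ell2_cinner x x = complex_of_real (\<Sum>\<^sub>\<infinity>n. (cmod (ell2_coeff x n))\<^sup>2)"
proof -
  have "ell2_cinner x x = (\<Sum>\<^sub>\<infinity>n. complex_of_real ((cmod (ell2_coeff x n))\<^sup>2))"
    unfolding ell2_cinner_def by (intro infsum_cong complex_norm_square[symmetric])
  also have "\<dots> = complex_of_real (\<Sum>\<^sub>\<infinity>n. (cmod (ell2_coeff x n))\<^sup>2)"
    by (intro infsumI has_sum_of_real has_sum_infsum ell2_coeff_square_summable)
  finally show ?thesis .
qed

text \<open>The library has no class of complex inner product spaces; the class instance uses the real
  part of the complex inner product, which induces the same norm.\<close>

instantiation ell2 :: real_inner
begin

definition inner_ell2 :: "ell2 \<Rightarrow> ell2 \<Rightarrow> real" where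
  "inner_ell2 x y = Re (ell2_cinner x y)"

definition norm_ell2 :: "ell2 \<Rightarrow> real" where
  "norm_ell2 x = sqrt (inner x x)"

definition dist_ell2 :: "ell2 \<Rightarrow> ell2 \<Rightarrow> real" where
  "dist_ell2 x y = norm (x - y)"

definition sgn_ell2 :: "ell2 \<Rightarrow> ell2" where
  "sgn_ell2 x = x /\<^sub>R norm x"

definition uniformity_ell2 :: "(ell2 \<times> ell2) filter" where
  "uniformity_ell2 = (INF e\<in>{0<..}. principal {(x, y). dist x y < e})"

definition open_ell2 :: "ell2 set \<Rightarrow> bool" where
  "open_ell2 U = (\<forall>x\<in>U. \<forall>\<^sub>F (x', y) in uniformity. x' = x \<longrightarrow> y \<in> U)"

instance
proof
  fix x y z :: ell2 and r :: real
  show "inner x y = inner y x"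
    unfolding inner_ell2_def by (subst ell2_cinner_commute) simp
  show "inner (x + y) z = inner x z + inner y z"
    by (simp add: inner_ell2_def ell2_cinner_add_left)
  show "inner (r *\<^sub>R x) y = r * inner x y"
    by (simp add: inner_ell2_def ell2_cinner_scaleR_left)
  show "0 \<le> inner x x"
    by (simp add: inner_ell2_def ell2_cinner_self infsum_nonneg)
  show "inner x x = 0 \<longleftrightarrow> x = 0"
  proof
    assume "inner x x = 0"
    then have "(\<Sum>\<^sub>\<infinity>n. (cmod (ell2_coeff x n))\<^sup>2) = 0"
      by (simp add: inner_ell2_def ell2_cinner_self)
    then have "(cmod (ell2_coeff x n))\<^sup>2 = 0" for n
      by (intro nonneg_infsum_le_0D[where A = UNIV])
        (auto simp: ell2_coeff_square_summable)
    then show "x = 0"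
      by (intro ell2_eqI) (simp add: zero_ell2.rep_eq)
  next
    assume "x = 0"
    then show "inner x x = 0"
      by (simp add: inner_ell2_def ell2_cinner_def zero_ell2.rep_eq)
  qed
  show "norm x = sqrt (inner x x)" by (rule norm_ell2_def)
  show "dist x y = norm (x - y)" by (rule dist_ell2_def)
  show "sgn x = x /\<^sub>R norm x" by (rule sgn_ell2_def)
  show "uniformity = (INF e\<in>{0<..}. principal {(x :: ell2, y). dist x y < e})"
    by (rule uniformity_ell2_def)
  show "open U = (\<forall>x\<in>U. \<forall>\<^sub>F (x', y) in uniformity. x' = x \<longrightarrow> y \<in> U)" for U :: "ell2 set"
    by (rule open_ell2_def)
qed

end

lemma ell2_norm_square: "(norm x)\<^sup>2 = (\<Sum>\<^sub>\<infinity>n. (cmod (ell2_coeff x n))\<^sup>2)"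
  by (simp add: power2_norm_eq_inner inner_ell2_def ell2_cinner_self)

lemma ell2_sum_le_norm:
  assumes "finite F"
  shows "(\<Sum>n\<in>F. (cmod (ell2_coeff x n))\<^sup>2) \<le> (norm x)\<^sup>2"
  unfolding ell2_norm_square
  by (rule finite_sum_le_infsum) (auto simp: assms ell2_coeff_square_summable)

lemma ell2_coeff_le_norm: "cmod (ell2_coeff x n) \<le> norm x"
  by (rule power2_le_imp_le) (use ell2_sum_le_norm[of "{n}" x] in simp_all)

lemma ell2_norm_leI:
  assumes "\<And>F. finite F \<Longrightarrow> (\<Sum>n\<in>F. (cmod (ell2_coeff x n))\<^sup>2) \<le> B\<^sup>2" and "0 \<le> B"
  shows "norm x \<le> B"
proof (rule power2_le_imp_le)
  show "(norm x)\<^sup>2 \<le> B\<^sup>2"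
    unfolding ell2_norm_square
    by (rule infsum_le_finite_sums) (auto simp: assms ell2_coeff_square_summable)
qed (rule assms)

instance ell2 :: complete_space
proof
  fix X :: "nat \<Rightarrow> ell2"
  assume X: "Cauchy X"
  have "Cauchy (\<lambda>k. ell2_coeff (X k) n)" for n
  proof (rule metric_CauchyI)
    fix e :: real assume "0 < e"
    then obtain M where M: "\<And>i j. i \<ge> M \<Longrightarrow> j \<ge> M \<Longrightarrow> dist (X i) (X j) < e"
      using metric_CauchyD[OF X] by blast
    have "dist (ell2_coeff (X i) n) (ell2_coeff (X j) n) \<le> dist (X i) (X j)" for i j
      using ell2_coeff_le_norm[of "X i - X j" n] by (simp add: dist_norm minus_ell2.rep_eq)
    then show "\<exists>M. \<forall>i\<ge>M. \<forall>j\<ge>M. dist (ell2_coeff (X i) n) (ell2_coeff (X j) n) < e"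
      using M le_less_trans by blast
  qed
  then have "\<exists>l. (\<lambda>k. ell2_coeff (X k) n) \<longlonglongrightarrow> l" for n
    using Cauchy_convergent convergent_def by blast
  then obtain f where f: "\<And>n. (\<lambda>k. ell2_coeff (X k) n) \<longlonglongrightarrow> f n"
    by metis
  have bound: "\<exists>M. \<forall>i\<ge>M. \<forall>F. finite F \<longrightarrow> (\<Sum>n\<in>F. (cmod (ell2_coeff (X i) n - f n))\<^sup>2) \<le> e\<^sup>2"
    if e: "0 < e" for e :: real
  proof -
    obtain M where M: "\<And>i j. i \<ge> M \<Longrightarrow> j \<ge> M \<Longrightarrow> dist (X i) (X j) < e"
      using metric_CauchyD[OF X e] by blast
    have "(\<Sum>n\<in>F. (cmod (ell2_coeff (X i) n - f n))\<^sup>2) \<le> e\<^sup>2" if "i \<ge> M" "finite F" for i F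
    proof (rule LIMSEQ_le_const2)
      show "(\<lambda>j. \<Sum>n\<in>F. (cmod (ell2_coeff (X i) n - ell2_coeff (X j) n))\<^sup>2)
          \<longlonglongrightarrow> (\<Sum>n\<in>F. (cmod (ell2_coeff (X i) n - f n))\<^sup>2)"
        by (intro tendsto_intros f)
      show "\<exists>N. \<forall>j\<ge>N. (\<Sum>n\<in>F. (cmod (ell2_coeff (X i) n - ell2_coeff (X j) n))\<^sup>2) \<le> e\<^sup>2"
      proof (intro exI allI impI)
        fix j assume "M \<le> j"
        have "(\<Sum>n\<in>F. (cmod (ell2_coeff (X i) n - ell2_coeff (X j) n))\<^sup>2) \<le> (norm (X i - X j))\<^sup>2"
          using ell2_sum_le_norm[OF \<open>finite F\<close>, of "X i - X j"] by (simp add: minus_ell2.rep_eq)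
        also have "\<dots> \<le> e\<^sup>2"
          using M[OF \<open>i \<ge> M\<close> \<open>M \<le> j\<close>] by (intro power_mono) (auto simp: dist_norm)
        finally show "(\<Sum>n\<in>F. (cmod (ell2_coeff (X i) n - ell2_coeff (X j) n))\<^sup>2) \<le> e\<^sup>2" .
      qed
    qed
    then show ?thesis by blast
  qed
  obtain M where M: "\<And>F. finite F \<Longrightarrow> (\<Sum>n\<in>F. (cmod (ell2_coeff (X M) n - f n))\<^sup>2) \<le> 1\<^sup>2"
    using bound[of 1] by auto
  have "(\<lambda>n. (cmod (ell2_coeff (X M) n - f n))\<^sup>2) summable_on UNIV"
    by (rule nonneg_bdd_above_summable_on) (auto intro!: bdd_aboveI[where M = "1\<^sup>2"] M)
  then have "(\<lambda>n. (cmod (ell2_coeff (X M) n + - 1 * (ell2_coeff (X M) n - f n)))\<^sup>2) summable_on UNIV"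
    by (intro square_summable_add square_summable_mult[where B = 1] ell2_coeff_square_summable) auto
  then have "(\<lambda>n. (cmod (f n))\<^sup>2) summable_on UNIV"
    by simp
  then obtain x where x: "ell2_coeff x = f"
    using Abs_ell2_inverse[of f] by auto
  have "X \<longlonglongrightarrow> x"
  proof (rule metric_LIMSEQ_I)
    fix e :: real assume "0 < e"
    then obtain N where N: "\<And>i F. i \<ge> N \<Longrightarrow> finite F
        \<Longrightarrow> (\<Sum>n\<in>F. (cmod (ell2_coeff (X i) n - f n))\<^sup>2) \<le> (e / 2)\<^sup>2"
      using bound[of "e / 2"] by auto
    have "dist (X i) x < e" if "i \<ge> N" for i
    proof -
      have "norm (X i - x) \<le> e / 2"
        using N[OF that] \<open>0 < e\<close> by (intro ell2_norm_leI) (auto simp: minus_ell2.rep_eq x)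
      then show ?thesis using \<open>0 < e\<close> by (simp add: dist_norm)
    qed
    then show "\<exists>N. \<forall>i\<ge>N. dist (X i) x < e" by blast
  qed
  then show "convergent X" by (rule convergentI)
qed

instance ell2 :: banach ..

lift_definition ell2_delta :: "int \<Rightarrow> ell2" is "\<lambda>m n. if n = m then 1 else 0"
proof -
  fix m :: int
  have "(\<lambda>n. (cmod (if n = m then 1 else 0))\<^sup>2) summable_on UNIV
      \<longleftrightarrow> (\<lambda>n. (cmod (if n = m then 1 else 0))\<^sup>2) summable_on {m}"
    by (rule summable_on_cong_neutral) auto
  then show "(\<lambda>n. (cmod (if n = m then 1 else 0))\<^sup>2) summable_on UNIV" by simp
qed

lift_definition ell2_scaleC :: "complex \<Rightarrow> ell2 \<Rightarrow> ell2" is "\<lambda>c f n. c * f n"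
  by (rule square_summable_mult) auto

lift_definition scaleC_blinfun :: "complex \<Rightarrow> ell2 \<Rightarrow>\<^sub>L ell2" is ell2_scaleC
proof (rule bounded_linear_intro)
  fix c :: complex and x y :: ell2 and r :: real
  show "ell2_scaleC c (x + y) = ell2_scaleC c x + ell2_scaleC c y"
    by transfer (simp add: algebra_simps)
  show "ell2_scaleC c (r *\<^sub>R x) = r *\<^sub>R ell2_scaleC c x"
    by transfer (simp add: algebra_simps)
  show "norm (ell2_scaleC c x) \<le> norm x * cmod c"
  proof (rule power2_le_imp_le)
    show "(norm (ell2_scaleC c x))\<^sup>2 \<le> (norm x * cmod c)\<^sup>2"
      unfolding ell2_norm_square power_mult_distrib ell2_scaleC.rep_eq
      by (simp add: norm_mult power_mult_distrib infsum_cmult_right' mult.commute)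
  qed auto
qed

definition golden_theta :: real where
  "golden_theta = (sqrt 5 - 1) / 2"

definition fib_potential :: "real \<Rightarrow> int \<Rightarrow> real" where
  "fib_potential lam n =
     lam * indicator {1 - golden_theta ..< 1} (frac (of_int n * golden_theta))"

lemma fib_potential_le: "\<bar>fib_potential lam n\<bar> \<le> \<bar>lam\<bar>"
  by (simp add: fib_potential_def indicator_def)

lift_definition fib_hamiltonian_fun :: "real \<Rightarrow> ell2 \<Rightarrow> ell2" is
  "\<lambda>lam \<psi> n. \<psi> (n + 1) + \<psi> (n - 1) + complex_of_real (fib_potential lam n) * \<psi> n"
proof -
  fix lam :: real and \<psi> :: "int \<Rightarrow> complex"
  assume \<psi>: "(\<lambda>n. (cmod (\<psi> n))\<^sup>2) summable_on UNIV"
  show "(\<lambda>n. (cmod (\<psi> (n + 1) + \<psi> (n - 1) + complex_of_real (fib_potential lam n) * \<psi> n))\<^sup>2)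
      summable_on UNIV"
    using square_summable_shift(1)[OF \<psi>, of 1] square_summable_shift(1)[OF \<psi>, of "-1"]
    by (intro square_summable_add square_summable_mult[OF \<psi>, where B = "\<bar>lam\<bar>"])
      (auto simp: fib_potential_le)
qed

lift_definition fib_hamiltonian :: "real \<Rightarrow> ell2 \<Rightarrow>\<^sub>L ell2" is fib_hamiltonian_fun
proof (rule bounded_linear_intro)
  fix lam r :: real and x y :: ell2
  show "fib_hamiltonian_fun lam (x + y) = fib_hamiltonian_fun lam x + fib_hamiltonian_fun lam y"
    by transfer (simp add: algebra_simps)
  show "fib_hamiltonian_fun lam (r *\<^sub>R x) = r *\<^sub>R fib_hamiltonian_fun lam x"
    by transfer (simp add: algebra_simps)
  define \<psi> where "\<psi> = ell2_coeff x"
  note \<psi> = ell2_coeff_square_summable[of x, folded \<psi>_def]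
  note shift = square_summable_shift[OF \<psi>, of 1] square_summable_shift[OF \<psi>, of "-1", simplified]
  let ?b = "\<lambda>n. 4 * (cmod (\<psi> (n + 1)))\<^sup>2 + 4 * (cmod (\<psi> (n - 1)))\<^sup>2 + 2 * lam\<^sup>2 * (cmod (\<psi> n))\<^sup>2"
  have le: "(cmod (ell2_coeff (fib_hamiltonian_fun lam x) n))\<^sup>2 \<le> ?b n" for n
  proof -
    have "(cmod (complex_of_real (fib_potential lam n) * \<psi> n))\<^sup>2 \<le> lam\<^sup>2 * (cmod (\<psi> n))\<^sup>2"
      unfolding norm_mult power_mult_distrib norm_of_real real_norm_def power2_abs
      using fib_potential_le[of lam n] by (intro mult_right_mono) (auto simp: abs_le_square_iff)
    then show ?thesis
      using square_norm_add_le[of "\<psi> (n + 1) + \<psi> (n - 1)" "complex_of_real (fib_potential lam n) * \<psi> n"]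
        square_norm_add_le[of "\<psi> (n + 1)" "\<psi> (n - 1)"]
      by (simp add: fib_hamiltonian_fun.rep_eq \<psi>_def)
  qed
  have "(norm (fib_hamiltonian_fun lam x))\<^sup>2 \<le> (\<Sum>\<^sub>\<infinity>n. ?b n)"
    unfolding ell2_norm_square
    by (intro infsum_mono le ell2_coeff_square_summable summable_on_add summable_on_cmult_right shift \<psi>)
  also have "\<dots> = 4 * (norm x)\<^sup>2 + 4 * (norm x)\<^sup>2 + 2 * lam\<^sup>2 * (norm x)\<^sup>2"
    by (subst infsum_add, intro summable_on_add summable_on_cmult_right shift,
        intro summable_on_cmult_right \<psi>, subst infsum_add, (intro summable_on_cmult_right shift)+)
      (simp only: infsum_cmult_right' shift ell2_norm_square \<psi>_def[symmetric])
  also have "\<dots> = (norm x * sqrt (8 + 2 * lam\<^sup>2))\<^sup>2"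
    by (simp add: power_mult_distrib distrib_left mult.commute)
  finally show "norm (fib_hamiltonian_fun lam x) \<le> norm x * sqrt (8 + 2 * lam\<^sup>2)"
    by (rule power2_le_imp_le) simp
qed

lemma fib_hamiltonian_coeff:
  "ell2_coeff (fib_hamiltonian lam \<psi>) n =
     ell2_coeff \<psi> (n + 1) + ell2_coeff \<psi> (n - 1)
       + complex_of_real (fib_potential lam n) * ell2_coeff \<psi> n"
  by (simp add: fib_hamiltonian.rep_eq fib_hamiltonian_fun.rep_eq)

text \<open>The exponential series, convergent in operator norm. (Bounded linear functions carry no
  algebra structure in the library, so \<^const>\<open>exp\<close> is not available for them.)\<close>

definition blinfun_exp :: "('a :: banach \<Rightarrow>\<^sub>L 'a) \<Rightarrow> ('a \<Rightarrow>\<^sub>L 'a)" where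
  "blinfun_exp A = (\<Sum>k. (1 / fact k) *\<^sub>R ((\<lambda>B. A o\<^sub>L B) ^^ k) id_blinfun)"

lemma summable_blinfun_exp:
  fixes A :: "'a :: banach \<Rightarrow>\<^sub>L 'a"
  shows "summable (\<lambda>k. (1 / fact k) *\<^sub>R ((\<lambda>B. A o\<^sub>L B) ^^ k) id_blinfun)"
proof (rule summable_comparison_test')
  have pow: "norm (((\<lambda>B. A o\<^sub>L B) ^^ k) (id_blinfun :: 'a \<Rightarrow>\<^sub>L 'a)) \<le> norm A ^ k" for k
  proof (induction k)
    case 0
    show ?case by (simp add: norm_blinfun_id_le)
  next
    case (Suc k)
    have "norm (A o\<^sub>L ((\<lambda>B. A o\<^sub>L B) ^^ k) id_blinfun)
        \<le> norm A * norm (((\<lambda>B. A o\<^sub>L B) ^^ k) (id_blinfun :: 'a \<Rightarrow>\<^sub>L 'a))"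
      by (rule norm_blinfun_compose)
    also have "\<dots> \<le> norm A * norm A ^ k" by (intro mult_left_mono Suc) auto
    finally show ?case by simp
  qed
  show "norm ((1 / fact k) *\<^sub>R ((\<lambda>B. A o\<^sub>L B) ^^ k) (id_blinfun :: 'a \<Rightarrow>\<^sub>L 'a))
      \<le> inverse (fact k) * norm A ^ k" if "0 \<le> k" for k
    using mult_left_mono[OF pow[of k], of "inverse (fact k)"] by (simp add: divide_inverse)
  show "summable (\<lambda>k. inverse (fact k) * norm A ^ k)"
    by (rule summable_exp)
qed

definition evolution :: "(ell2 \<Rightarrow>\<^sub>L ell2) \<Rightarrow> real \<Rightarrow> (ell2 \<Rightarrow>\<^sub>L ell2)" where
  "evolution H t = blinfun_exp (scaleC_blinfun (- \<i> * complex_of_real t) o\<^sub>L H)"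

text \<open>All nonnegative integrals and sums are taken in \<^typ>\<open>ennreal\<close> and all limits in
  \<^typ>\<open>ereal\<close>, so that no convergence has to be presupposed.\<close>

definition log_ennreal :: "ennreal \<Rightarrow> ereal" where
  "log_ennreal x =
     (if x = 0 then - \<infinity> else if x = \<infinity> then \<infinity> else ereal (ln (enn2real x)))"

definition avg_prob :: "(ell2 \<Rightarrow>\<^sub>L ell2) \<Rightarrow> int \<Rightarrow> real \<Rightarrow> ennreal" where
  "avg_prob H n T = ennreal (2 / T) *
     (\<integral>\<^sup>+t\<in>{0..}. ennreal (exp (- 2 * t / T) *
        (cmod (ell2_cinner (evolution H t (ell2_delta 1)) (ell2_delta n)))\<^sup>2) \<partial>lborel)"

definition moment :: "(ell2 \<Rightarrow>\<^sub>L ell2) \<Rightarrow> real \<Rightarrow> real \<Rightarrow> ennreal" where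
  "moment H p T = (\<Sum>\<^sub>\<infinity>n. ennreal (\<bar>real_of_int n\<bar> powr p) * avg_prob H n T)"

definition beta_plus :: "(ell2 \<Rightarrow>\<^sub>L ell2) \<Rightarrow> real \<Rightarrow> ereal" where
  "beta_plus H p = Limsup at_top (\<lambda>T. log_ennreal (moment H p T) / ereal (p * ln T))"

text \<open>The threshold is extended real to admit \<^term>\<open>T\<close> to the power \<^term>\<open>\<infinity> :: ereal\<close>,
  for which the tail sum is empty.\<close>

definition outside_prob :: "(ell2 \<Rightarrow>\<^sub>L ell2) \<Rightarrow> ereal \<Rightarrow> real \<Rightarrow> ennreal" where
  "outside_prob H N T = (\<Sum>\<^sub>\<infinity>n\<in>{n. ereal \<bar>real_of_int n\<bar> > N}. avg_prob H n T)"

text \<open>Only used for \<^term>\<open>\<alpha> \<ge> (0 :: ereal)\<close> and, in the limit, for \<^term>\<open>T > (1 :: real)\<close>.\<close>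

definition powr_ereal :: "real \<Rightarrow> ereal \<Rightarrow> ereal" where
  "powr_ereal T \<alpha> = (if \<alpha> = \<infinity> then \<infinity> else ereal (T powr real_of_ereal \<alpha>))"

definition S_plus :: "(ell2 \<Rightarrow>\<^sub>L ell2) \<Rightarrow> ereal \<Rightarrow> ereal" where
  "S_plus H \<alpha> =
     - Limsup at_top (\<lambda>T. log_ennreal (outside_prob H (powr_ereal T \<alpha> - 2) T) / ereal (ln T))"

definition alpha_u_plus :: "(ell2 \<Rightarrow>\<^sub>L ell2) \<Rightarrow> ereal" where
  "alpha_u_plus H = Sup {\<alpha>. 0 \<le> \<alpha> \<and> S_plus H \<alpha> < \<infinity>}"

definition xi :: "real \<Rightarrow> real" where
  "xi lam = (lam - 4 + sqrt ((lam - 4)\<^sup>2 - 12)) / 2"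

definition alpha_bound :: "real \<Rightarrow> real" where
  "alpha_bound lam = 2 * ln ((sqrt 5 + 1) / 2) / ln (xi lam)"

end

theory Submission
  imports Defs
    "HOL-Number_Theory.Fib"
    "HOL-Computational_Algebra.Computational_Algebra"
    "HOL-Complex_Analysis.Complex_Analysis"
    "HOL-Real_Asymp.Real_Asymp"
begin

text \<open>
  Let \<open>x\<^sub>k(z)\<close> be half the trace of the transfer matrix over \<open>fib k\<close> sites. At a real energy with
  \<open>\<bar>x\<^sub>k\<bar> \<le> 1 + \<delta>\<close> the trace map forces \<open>\<bar>x\<^sub>k'\<bar>\<close> to be at least of order \<open>S\<close> to the power \<open>k / 2\<close>, for
  any \<open>S < xi lam\<close>. Since \<open>x\<^sub>k - c\<close> has only real zeros for \<open>\<bar>c\<bar> \<le> 1\<close>, this derivative bound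
  alone gives \<open>\<bar>x\<^sub>k(z)\<bar> > 1 + \<delta>\<close> as soon as \<open>\<bar>Im z\<bar>\<close> exceeds a multiple of \<open>S\<close> to the power \<open>- k / 2\<close>.
  Hence at \<open>\<bar>Im z\<bar>\<close> of order \<open>1 / T\<close> the traces escape superexponentially from some
  \<open>k \<approx> 2 ln T / ln S\<close> on, where \<open>fib k\<close> is at most of order \<open>T\<close> to the power
  \<open>2 ln ((sqrt 5 + 1) / 2) / ln S\<close>. The potential repeats its first \<open>fib k\<close> values, so Gordon's
  three-block identity bounds the Green function at distance \<open>fib k\<close> by
  \<open>O(T\<^sup>2) / \<bar>x\<^sub>k(z)\<bar>\<close>, uniformly in the real part of \<open>z\<close>. Writing the evolution as a contour
  integral of the resolvent along a thin ellipse turns this into pointwise decay of the averaged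
  probabilities beyond the scale \<open>T\<close> to the power \<open>\<alpha>\<close>, for every \<open>\<alpha> > alpha_bound lam\<close>.
\<close>

text \<open>The 2 in \<open>alpha_bound\<close> comes from a mismatch of rates: descending from one
  small half-trace to an earlier one may skip an index, so a factor \<open>S\<close> is guaranteed
  only for every two levels, whereas \<open>fib k\<close> gains the golden ratio at each level.
  Escape starts only strictly above 1, so the derivative bound must hold up to a larger threshold;
  this slack keeps \<open>S\<close> strictly below \<open>xi lam\<close>, and the exponent
  \<open>alpha_bound lam\<close> is reached only as a limit. Complex energies are controlled through
  real ones alone: after one real root near \<open>E\<close> is divided out, the quotient at
  \<open>E\<close> is a derivative or a chord slope, and moving off the axis cannot decrease it. The
  contour passes over all real energies, hence the uniformity in the real part. Its height of order
  \<open>1 / T\<close> lets \<open>exp (t * Im z)\<close> grow more slowly than the averaging weight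
  decays; far from the spectrum the finite range of \<open>H\<close> replaces the trace
  estimates.\<close>

section \<open>Dynamics of the trace map\<close>

text \<open>For \<open>k \<ge> 2\<close> the term with index \<open>k\<close> is the half-trace over \<open>fib k\<close> sites; the first two terms
  only start the recursion.\<close>

fun trace_seq :: "'a::field \<Rightarrow> 'a \<Rightarrow> nat \<Rightarrow> 'a" where
  "trace_seq l z 0 = 1"
| "trace_seq l z (Suc 0) = z / 2"
| "trace_seq l z (Suc (Suc 0)) = (z - l) / 2"
| "trace_seq l z (Suc (Suc (Suc k))) =
     2 * trace_seq l z (Suc (Suc k)) * trace_seq l z (Suc k) - trace_seq l z k"

fun trace_deriv :: "'a::field \<Rightarrow> 'a \<Rightarrow> nat \<Rightarrow> 'a" where
  "trace_deriv l z 0 = 0"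
| "trace_deriv l z (Suc 0) = 1 / 2"
| "trace_deriv l z (Suc (Suc 0)) = 1 / 2"
| "trace_deriv l z (Suc (Suc (Suc k))) =
     2 * (trace_deriv l z (Suc (Suc k)) * trace_seq l z (Suc k)
        + trace_seq l z (Suc (Suc k)) * trace_deriv l z (Suc k)) - trace_deriv l z k"

text \<open>The Fricke-Vogt invariant. \<open>x k\<close> and \<open>x (k + 3)\<close> add up to
  \<open>2 * x (k + 1) * x (k + 2)\<close>, so they are the two roots of one quadratic. The starting
  triple gives \<open>1 + (z / 2 - (z - l) / 2)^2\<close>, which is free of the energy.\<close>

lemma trace_seq_invariant:
  fixes l z :: "'a::field_char_0"
  defines "x \<equiv> trace_seq l z"
  shows "(x k)\<^sup>2 + (x (Suc k))\<^sup>2 + (x (Suc (Suc k)))\<^sup>2 - 2 * x k * x (Suc k) * x (Suc (Suc k))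
    = 1 + l\<^sup>2 / 4"
proof (induction k)
  case 0
  show ?case by (simp add: x_def power2_eq_square field_simps)
next
  case (Suc k)
  have "x (Suc (Suc (Suc k))) = 2 * x (Suc (Suc k)) * x (Suc k) - x k"
    by (simp add: x_def)
  then show ?case using Suc.IH by algebra
qed

text \<open>Half the energy derivative of the invariant. It expresses the derivative of the large
  member of a triple by those of the small ones.\<close>

lemma trace_deriv_invariant:
  fixes l z :: "'a::field_char_0"
  defines "x \<equiv> trace_seq l z" and "d \<equiv> trace_deriv l z"
  shows "(x k - x (Suc k) * x (Suc (Suc k))) * d k + (x (Suc k) - x k * x (Suc (Suc k))) * d (Suc k)
     + (x (Suc (Suc k)) - x k * x (Suc k)) * d (Suc (Suc k)) = 0"
proof (induction k)
  case 0
  show ?case by (simp add: x_def d_def field_simps)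
next
  case (Suc k)
  have "x (Suc (Suc (Suc k))) = 2 * x (Suc (Suc k)) * x (Suc k) - x k"
    "d (Suc (Suc (Suc k))) = 2 * (d (Suc (Suc k)) * x (Suc k) + x (Suc (Suc k)) * d (Suc k)) - d k"
    by (simp_all add: x_def d_def)
  then show ?case using Suc.IH by algebra
qed

lemma trace_seq_has_derivative:
  "((\<lambda>z. trace_seq l z k) has_field_derivative trace_deriv l z k) (at z)"
  for z :: "'a::real_normed_field"
  by (induction l z k rule: trace_deriv.induct) (auto intro!: derivative_eq_intros)

lemma trace_seq_of_real:
  "trace_seq (of_real l) (of_real z) k = (of_real (trace_seq l z k) :: 'a::{real_field, field_char_0})"
  by (induction l z k rule: trace_deriv.induct) auto

lemma trace_deriv_of_real:
  "trace_deriv (of_real l) (of_real z) k = (of_real (trace_deriv l z k) :: 'a::{real_field, field_char_0})"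
  by (induction l z k rule: trace_deriv.induct) (auto simp: trace_seq_of_real)

text \<open>Once two consecutive terms exceed the threshold, the subtracted term in the recursion is
  dominated by the product, and the sequence escapes superexponentially.\<close>

lemma trace_seq_step:
  fixes l z :: "'a::real_normed_field"
  assumes a: "a > 1" and "norm (trace_seq l z k) > a" "norm (trace_seq l z (Suc k)) > a"
  shows "norm (trace_seq l z (Suc k)) * norm (trace_seq l z k) \<le> norm (trace_seq l z (Suc (Suc k)))"
  using assms(2,3)
proof (induction k)
  \<comment> \<open>The start value 1 is not above \<open>a\<close>, so the claim is vacuous. This
    is why escape needs no assumption that some earlier term is small.\<close>
  case 0
  then show ?case using a by simp
next
  case (Suc k)
  define x where "x = (\<lambda>k. norm (trace_seq l z k))"
  have big: "x (Suc k) > a" "x (Suc (Suc k)) > a" using Suc.prems by (auto simp: x_def)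
  have "x k \<le> x (Suc (Suc k)) * x (Suc k)"
  proof (cases "x k > a")
    case True
    then have "x (Suc k) * x k \<le> x (Suc (Suc k))"
      using Suc big by (simp add: x_def)
    moreover have "x k \<le> x (Suc k) * x k" "x (Suc (Suc k)) \<le> x (Suc (Suc k)) * x (Suc k)"
      using big True a by (auto simp: mult_le_cancel_left1 mult_le_cancel_right1)
    ultimately show ?thesis by linarith
  next
    case False
    have "a * 1 \<le> x (Suc (Suc k)) * x (Suc k)" using big a by (intro mult_mono) auto
    then show ?thesis using False by simp
  qed
  moreover have "2 * x (Suc (Suc k)) * x (Suc k) - x k \<le> x (Suc (Suc (Suc k)))"
    using norm_triangle_ineq2[of "2 * trace_seq l z (Suc (Suc k)) * trace_seq l z (Suc k)" "trace_seq l z k"]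
    by (simp add: x_def norm_mult)
  ultimately show ?case by (simp add: x_def)
qed

text \<open>Each term dominates the product of the two before it, so the logarithms grow at least
  like Fibonacci numbers, just as the block lengths do.\<close>

lemma trace_seq_escape:
  fixes l z :: "'a::real_normed_field"
  assumes a: "a > 1" and "norm (trace_seq l z k) > a" "norm (trace_seq l z (Suc k)) > a"
  shows "a ^ fib j \<le> norm (trace_seq l z (k + j))"
proof -
  define x where "x = (\<lambda>k. norm (trace_seq l z k))"
  have big: "x (k + j) > a \<and> x (Suc (k + j)) > a" for j
  proof (induction j)
    case (Suc j)
    have "x (Suc (k + j)) * x (k + j) \<le> x (Suc (Suc (k + j)))"
      unfolding x_def by (rule trace_seq_step[OF a]) (use Suc in \<open>auto simp: x_def\<close>)
    moreover have "x (Suc (k + j)) * 1 \<le> x (Suc (k + j)) * x (k + j)"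
      using Suc a by (intro mult_left_mono) auto
    ultimately show ?case using Suc by auto
  qed (use assms in \<open>auto simp: x_def\<close>)
  have "a ^ fib j \<le> x (k + j)"
  proof (induction j rule: fib.induct)
    case 1
    then show ?case using big[of 0] a by simp
  next
    case 2
    then show ?case using big[of 0] by simp
  next
    case (3 j)
    have "a ^ fib (Suc (Suc j)) = a ^ fib (Suc j) * a ^ fib j" by (simp add: power_add)
    also have "\<dots> \<le> x (Suc (k + j)) * x (k + j)"
      using 3 a by (intro mult_mono) (auto simp: x_def)
    also have "\<dots> \<le> x (Suc (Suc (k + j)))"
      unfolding x_def by (rule trace_seq_step[OF a]) (use big[of j] in \<open>auto simp: x_def\<close>)
    finally show ?case by simp
  qed
  then show ?thesis by (simp add: x_def)
qed

text \<open>Contrapositive of one escape step. The descending inductions over small levels run along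
  it.\<close>

lemma trace_seq_nested:
  fixes l z :: "'a::real_normed_field"
  assumes a: "a > 1" and small: "norm (trace_seq l z (Suc (Suc k))) \<le> a"
  shows "norm (trace_seq l z (Suc k)) \<le> a \<or> norm (trace_seq l z k) \<le> a"
proof (rule ccontr)
  assume "\<not> ?thesis"
  then have big: "norm (trace_seq l z (Suc k)) > a" "norm (trace_seq l z k) > a" by auto
  have "a * 1 < norm (trace_seq l z (Suc k)) * norm (trace_seq l z k)"
    using big a by (intro mult_strict_mono) auto
  then show False using trace_seq_step[OF a big(2,1)] small by linarith
qed

text \<open>\<open>1 + \<eta>\<close> is the square of the threshold \<open>1 + \<delta>\<close>. For \<open>\<eta> = 0\<close> the condition on \<open>S\<close> is the
  quadratic inequality whose larger root is \<open>xi lam\<close>.\<close>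

context
  fixes lam S \<eta> :: real
  assumes lam: "lam \<ge> 8" and \<eta>: "0 < \<eta>" "\<eta> \<le> 1/1000"
    and S: "2 \<le> S" "S + 3 / S + 16 * \<eta> \<le> lam - 4"
begin

text \<open>\<open>x\<close> and \<open>y\<close> are the small members of a consecutive triple,
  \<open>y\<close> the older one; \<open>L\<close> is the large member. Both orders
  \<open>(y, L, x)\<close> and \<open>(y, x, L)\<close> occur below.\<close>

context
  fixes L x y dL dx dy :: real
  assumes inv: "L\<^sup>2 + x\<^sup>2 + y\<^sup>2 - 2 * x * y * L = 1 + lam\<^sup>2 / 4"
    and dinv: "(L - x * y) * dL = (y * L - x) * dx + (x * L - y) * dy"
    and small: "x\<^sup>2 \<le> 1 + \<eta>" "y\<^sup>2 \<le> 1 + \<eta>" and dy: "S * \<bar>dy\<bar> \<le> \<bar>dx\<bar>"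
begin

private lemma abs_small: "\<bar>w\<bar> \<le> 1 + \<eta>" if "w\<^sup>2 \<le> 1 + \<eta>" for w :: real
proof (rule power2_le_imp_le)
  show "\<bar>w\<bar>\<^sup>2 \<le> (1 + \<eta>)\<^sup>2"
    using that \<eta> zero_le_square[of \<eta>] unfolding power2_abs
    by (simp only: power2_eq_square distrib_left distrib_right)
qed (use \<eta> in simp)

private lemma abs_xy: "\<bar>x * y\<bar> \<le> 1 + \<eta>"
proof (rule power2_le_imp_le)
  have "x\<^sup>2 * y\<^sup>2 \<le> (1 + \<eta>) * (1 + \<eta>)" using small \<eta> by (intro mult_mono) auto
  then show "\<bar>x * y\<bar>\<^sup>2 \<le> (1 + \<eta>)\<^sup>2" by (simp add: power2_eq_square mult_ac)
qed (use \<eta> in simp)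

text \<open>Completing the square in the invariant gives
  \<open>(L - x * y)^2 = lam^2 / 4 + (1 - x^2) * (1 - y^2)\<close>, and the slack lets the last
  product drop to at most \<eta> below 0.\<close>

private lemma abs_diff: "\<bar>L - x * y\<bar> \<ge> lam / 2 - \<eta>"
proof (rule power2_le_imp_le)
  define u v where "u = 1 - x\<^sup>2" and "v = 1 - y\<^sup>2"
  have uv: "- \<eta> \<le> u" "u \<le> 1" "- \<eta> \<le> v" "v \<le> 1" using small by (auto simp: u_def v_def)
  have "- \<eta> \<le> u * v"
  proof (cases "u \<ge> 0")
    case True
    have "u * (- \<eta>) \<le> u * v" by (rule mult_left_mono) (use uv True in auto)
    moreover have "u * \<eta> \<le> 1 * \<eta>" by (rule mult_right_mono) (use uv \<eta> in auto)
    ultimately show ?thesis by simp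
  next
    case False
    show ?thesis
    proof (cases "v \<ge> 0")
      case True
      have "(- \<eta>) * v \<le> u * v" by (rule mult_right_mono) (use uv True in auto)
      moreover have "\<eta> * v \<le> \<eta> * 1" by (rule mult_left_mono) (use uv \<eta> in auto)
      ultimately show ?thesis by simp
    next
      case False
      then have "0 \<le> u * v" using \<open>\<not> u \<ge> 0\<close> by (simp add: mult_nonpos_nonpos)
      then show ?thesis using \<eta> by simp
    qed
  qed
  moreover have "(L - x * y)\<^sup>2 = lam\<^sup>2 / 4 + u * v"
    using inv by (simp add: u_def v_def power2_eq_square algebra_simps)
  moreover have "(lam / 2 - \<eta>)\<^sup>2 \<le> lam\<^sup>2 / 4 - \<eta>"
  proof -
    have "\<eta> * 1 \<le> \<eta> * (lam - \<eta>)" using lam \<eta> by (intro mult_left_mono) auto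
    then show ?thesis by (simp add: power2_eq_square algebra_simps)
  qed
  ultimately show "(lam / 2 - \<eta>)\<^sup>2 \<le> \<bar>L - x * y\<bar>\<^sup>2" by simp
qed simp

private lemma large_root_ge: "\<bar>L\<bar> \<ge> lam / 2 - 1 - 2 * \<eta>"
  using abs_diff abs_xy by linarith

text \<open>Implicit differentiation of the invariant; the coefficient of each small derivative is at
  most 1 up to \<open>\<eta>\<close> because \<open>(L - x y)\<^sup>2 - (y L - x)\<^sup>2 = (1 - y\<^sup>2) (L\<^sup>2 - x\<^sup>2)\<close>.\<close>

private lemma large_root_deriv_le: "\<bar>dL\<bar> \<le> (1 + 2 * \<eta>) * (1 + 1 / S) * \<bar>dx\<bar>"
proof -
  define s where "s = L - x * y"
  have s: "\<bar>s\<bar> > 1.1" unfolding s_def using abs_diff lam \<eta> by linarith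
  have L: "\<bar>L\<bar> \<ge> 2.9" using large_root_ge lam \<eta> by linarith
  have "\<bar>L\<bar> \<le> \<bar>s\<bar> + \<bar>x * y\<bar>" unfolding s_def by linarith
  also have "\<bar>x * y\<bar> \<le> \<bar>s\<bar>" using abs_xy s \<eta> by simp
  finally have L': "\<bar>L\<bar> \<le> 2 * \<bar>s\<bar>" by simp
  have coeff: "\<bar>q * L - p\<bar> \<le> (1 + 2 * \<eta>) * \<bar>s\<bar>"
    if pq: "p * q = x * y" "p\<^sup>2 \<le> 1 + \<eta>" "q\<^sup>2 \<le> 1 + \<eta>" for p q :: real
  proof (rule power2_le_imp_le)
    have "2.9\<^sup>2 \<le> \<bar>L\<bar>\<^sup>2" by (rule power_mono) (use L in auto)
    then have L2: "L\<^sup>2 \<ge> 8" by (simp add: power2_eq_square)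
    have "(q\<^sup>2 - 1) * (L\<^sup>2 - p\<^sup>2) \<le> \<eta> * (L\<^sup>2 - p\<^sup>2)"
      by (rule mult_right_mono) (use pq \<eta> L2 in auto)
    also have "\<dots> \<le> \<eta> * (4 * s\<^sup>2)"
    proof (rule mult_left_mono)
      have "\<bar>L\<bar>\<^sup>2 \<le> (2 * \<bar>s\<bar>)\<^sup>2" by (rule power_mono) (use L' in auto)
      then show "L\<^sup>2 - p\<^sup>2 \<le> 4 * s\<^sup>2" by (simp add: power_mult_distrib) (smt (verit) zero_le_power2)
    qed (use \<eta> in simp)
    finally have *: "(q\<^sup>2 - 1) * (L\<^sup>2 - p\<^sup>2) \<le> 4 * \<eta> * s\<^sup>2" by simp
    have "(q * L - p)\<^sup>2 = (L - p * q)\<^sup>2 + (q\<^sup>2 - 1) * (L\<^sup>2 - p\<^sup>2)"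
      by (simp add: power2_eq_square algebra_simps)
    also have "\<dots> = s\<^sup>2 + (q\<^sup>2 - 1) * (L\<^sup>2 - p\<^sup>2)" by (simp add: s_def pq)
    also have "\<dots> \<le> (1 + 4 * \<eta>) * s\<^sup>2" using * by (simp add: algebra_simps)
    also have "\<dots> \<le> (1 + 2 * \<eta>)\<^sup>2 * s\<^sup>2"
      by (rule mult_right_mono) (simp_all add: power2_eq_square algebra_simps)
    finally show "\<bar>q * L - p\<bar>\<^sup>2 \<le> ((1 + 2 * \<eta>) * \<bar>s\<bar>)\<^sup>2" by (simp add: power_mult_distrib)
  qed (use \<eta> in simp)
  have dy': "\<bar>dy\<bar> \<le> \<bar>dx\<bar> / S" using dy S by (simp add: field_simps)
  have "\<bar>s\<bar> * \<bar>dL\<bar> = \<bar>(y * L - x) * dx + (x * L - y) * dy\<bar>"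
    using dinv by (simp add: s_def flip: abs_mult)
  also have "\<dots> \<le> \<bar>y * L - x\<bar> * \<bar>dx\<bar> + \<bar>x * L - y\<bar> * \<bar>dy\<bar>"
    by (metis abs_mult abs_triangle_ineq)
  also have "\<dots> \<le> ((1 + 2 * \<eta>) * \<bar>s\<bar>) * \<bar>dx\<bar> + ((1 + 2 * \<eta>) * \<bar>s\<bar>) * (\<bar>dx\<bar> / S)"
    by (intro add_mono mult_mono coeff dy') (use small \<eta> in \<open>auto simp: mult.commute\<close>)
  also have "\<dots> = \<bar>s\<bar> * ((1 + 2 * \<eta>) * (1 + 1 / S) * \<bar>dx\<bar>)" by (simp add: algebra_simps)
  finally show ?thesis by (rule mult_left_le_imp_le) (use s in linarith)
qed

private lemma inv_S: "0 < 1 / S" "1 / S \<le> 1 / 2" "\<bar>dy\<bar> \<le> 1 / S * \<bar>dx\<bar>"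
  using S dy by (auto simp: field_simps)

text \<open>The growth factor is at least \<open>2 \<bar>L\<bar> - 2 \<bar>L' / x'\<bar> - \<bar>y' / x'\<bar> \<ge> (lam - 2) - 2 (1 + 1 / S) - 1 / S\<close>
  up to \<open>\<eta>\<close>; this is where \<open>lam - 4 - 3 / S\<close> comes from.\<close>

lemma deriv_growth_near: "S * \<bar>dx\<bar> \<le> \<bar>2 * (L * dx + x * dL) - dy\<bar>"
proof -
  define r where "r = 1 / S"
  have r: "0 < r" "r \<le> 1/2" "\<bar>dy\<bar> \<le> r * \<bar>dx\<bar>" and Sr: "S + 3 * r + 16 * \<eta> \<le> lam - 4"
    using inv_S S by (auto simp: r_def)
  have "\<bar>x\<bar> * \<bar>dL\<bar> \<le> (1 + \<eta>) * ((1 + 2 * \<eta>) * (1 + r) * \<bar>dx\<bar>)"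
    using abs_small[OF small(1)] large_root_deriv_le \<eta> by (intro mult_mono) (auto simp: r_def)
  also have "\<dots> = ((1 + \<eta>) * (1 + 2 * \<eta>) * (1 + r)) * \<bar>dx\<bar>" by (simp add: mult_ac)
  also have "\<dots> \<le> (1 + r + 6 * \<eta>) * \<bar>dx\<bar>"
  proof (rule mult_right_mono)
    have "\<eta> * r \<le> \<eta> * (1/2)" "\<eta> * \<eta> \<le> \<eta> * (1/1000)" using \<eta> r by (intro mult_left_mono; simp)+
    moreover have "\<eta> * \<eta> * r \<le> \<eta> * (1/1000) * (1/2)" using \<eta> r by (intro mult_mono) auto
    moreover have "(1 + \<eta>) * (1 + 2 * \<eta>) * (1 + r)
        = 1 + 3 * \<eta> + 2 * (\<eta> * \<eta>) + r + 3 * (\<eta> * r) + 2 * (\<eta> * \<eta> * r)"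
      by (simp add: algebra_simps)
    ultimately show "(1 + \<eta>) * (1 + 2 * \<eta>) * (1 + r) \<le> 1 + r + 6 * \<eta>"
      using \<eta> by linarith
  qed simp
  finally have 1: "\<bar>x\<bar> * \<bar>dL\<bar> \<le> (1 + r + 6 * \<eta>) * \<bar>dx\<bar>" .
  have 2: "(lam / 2 - 1 - 2 * \<eta>) * \<bar>dx\<bar> \<le> \<bar>L\<bar> * \<bar>dx\<bar>"
    by (rule mult_right_mono[OF large_root_ge]) simp
  have "S * \<bar>dx\<bar> \<le> (2 * (lam / 2 - 1 - 2 * \<eta>) - 2 * (1 + r + 6 * \<eta>) - r) * \<bar>dx\<bar>"
    by (rule mult_right_mono) (use Sr in auto)
  also have "\<dots> = 2 * ((lam / 2 - 1 - 2 * \<eta>) * \<bar>dx\<bar>) - 2 * ((1 + r + 6 * \<eta>) * \<bar>dx\<bar>) - r * \<bar>dx\<bar>"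
    by (simp only: left_diff_distrib mult.assoc)
  also have "\<dots> \<le> 2 * (\<bar>L * dx\<bar>) - 2 * \<bar>x * dL\<bar> - \<bar>dy\<bar>"
    unfolding abs_mult using 1 2 r by linarith
  also have "\<dots> \<le> \<bar>2 * (L * dx + x * dL) - dy\<bar>"
    by (simp add: distrib_left)
  finally show ?thesis .
qed

text \<open>After \<open>(y, L, x)\<close> the next half-traces are \<open>2 * x * L - y\<close> and
  \<open>(4 * x^2 - 1) * L - 2 * x * y\<close>; the conclusion concerns the derivative of the
  latter. Being small while \<open>L\<close> is large forces \<open>|x|\<close> close to 1/2, and
  then the term \<open>8 * x * L * dx\<close>, of size about \<open>2 * lam * |dx|\<close>,
  dominates.\<close>

lemma deriv_growth_far:
  assumes w: "((4 * x\<^sup>2 - 1) * L - 2 * x * y)\<^sup>2 \<le> 1 + \<eta>"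
  shows "S * \<bar>dx\<bar> \<le> \<bar>(8 * x * L - 2 * y) * dx + (4 * x\<^sup>2 - 1) * dL - 2 * x * dy\<bar>"
proof -
  define t l where "t = \<bar>x\<bar>" and "l = \<bar>L\<bar>"
  have t: "0 \<le> t" and l: "l \<ge> lam / 2 - 1.002" "l \<ge> 2.998"
    using large_root_ge lam \<eta> by (auto simp: t_def l_def)
  have fact: "\<bar>4 * x\<^sup>2 - 1\<bar> = \<bar>2 * t - 1\<bar> * (2 * t + 1)"
  proof -
    have "4 * x\<^sup>2 - 1 = (2 * t - 1) * (2 * t + 1)"
      by (simp add: t_def power2_eq_square algebra_simps flip: abs_mult)
    then show ?thesis using t by (simp add: abs_mult)
  qed
  \<comment> \<open>The factor \<open>2 * t + 1\<close> of \<open>4 * t^2 - 1\<close> also divides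
    the upper bound; it cancels and leaves a bound for \<open>|2 * t - 1| * l\<close>.\<close>
  have "\<bar>4 * x\<^sup>2 - 1\<bar> * l \<le> \<bar>(4 * x\<^sup>2 - 1) * L - 2 * x * y\<bar> + 2 * (t * \<bar>y\<bar>)"
    unfolding t_def l_def abs_mult[symmetric] by linarith
  also have "\<dots> \<le> (1 + \<eta>) + 2 * (t * (1 + \<eta>))"
    using abs_small[OF w] abs_small[OF small(2)] t by (intro add_mono mult_left_mono) auto
  also have "\<dots> = (1 + \<eta>) * (2 * t + 1)" by (simp add: algebra_simps)
  finally have "(\<bar>2 * t - 1\<bar> * l) * (2 * t + 1) \<le> (1 + \<eta>) * (2 * t + 1)"
    by (simp add: fact mult_ac)
  then have tl: "\<bar>2 * t - 1\<bar> * l \<le> 1 + \<eta>" using t by (simp add: mult_le_cancel_right)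
  have "\<bar>2 * t - 1\<bar> * 2.998 \<le> \<bar>2 * t - 1\<bar> * l" using l by (intro mult_left_mono) auto
  then have q: "\<bar>2 * t - 1\<bar> \<le> 0.334" using tl \<eta> by simp
  then have t': "t \<le> 0.667" using abs_le_D1[of "2 * t - 1" "0.334"] by simp
  have 1: "\<bar>4 * x\<^sup>2 - 1\<bar> \<le> 0.78"
  proof -
    have "\<bar>2 * t - 1\<bar> * (2 * t + 1) \<le> 0.334 * 2.334" using q t t' by (intro mult_mono) auto
    then show ?thesis by (simp add: fact)
  qed
  have 2: "8 * (t * l) \<ge> 4 * l - 4.004"
  proof -
    have "- (\<bar>2 * t - 1\<bar> * l) \<le> (2 * t - 1) * l"
      using l abs_ge_minus_self[of "(2 * t - 1) * l"] by (simp add: abs_mult)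
    then have "(2 * t - 1) * l \<ge> - (1 + \<eta>)" using tl by linarith
    then show ?thesis using \<eta> by (simp add: algebra_simps)
  qed
  have dL: "\<bar>dL\<bar> \<le> 1.503 * \<bar>dx\<bar>"
  proof -
    have "(1 + 2 * \<eta>) * (1 + 1 / S) \<le> 1.002 * (3/2)"
      using \<eta> inv_S by (intro mult_mono) auto
    then have "(1 + 2 * \<eta>) * (1 + 1 / S) * \<bar>dx\<bar> \<le> 1.503 * \<bar>dx\<bar>"
      by (intro mult_right_mono) auto
    then show ?thesis using large_root_deriv_le by linarith
  qed
  have dy: "\<bar>dy\<bar> \<le> 1 / 2 * \<bar>dx\<bar>"
    using inv_S mult_right_mono[OF inv_S(2), of "\<bar>dx\<bar>"] by linarith
  have "\<bar>4 * x\<^sup>2 - 1\<bar> * \<bar>dL\<bar> \<le> 0.78 * (1.503 * \<bar>dx\<bar>)"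
    using 1 dL by (intro mult_mono) auto
  then have A: "\<bar>(4 * x\<^sup>2 - 1) * dL\<bar> \<le> 1.18 * \<bar>dx\<bar>" by (simp add: abs_mult)
  have "t * \<bar>dy\<bar> \<le> 0.667 * (1 / 2 * \<bar>dx\<bar>)" using t' dy t by (intro mult_mono) auto
  then have B: "\<bar>2 * x * dy\<bar> \<le> 0.667 * \<bar>dx\<bar>" by (simp add: abs_mult t_def)
  have C: "\<bar>(8 * x * L - 2 * y) * dx\<bar> \<ge> (2 * lam - 10.02) * \<bar>dx\<bar>"
  proof -
    have "\<bar>8 * x * L - 2 * y\<bar> \<ge> 8 * (t * l) - 2 * \<bar>y\<bar>"
      unfolding t_def l_def abs_mult[symmetric] by linarith
    then have "\<bar>8 * x * L - 2 * y\<bar> \<ge> 2 * lam - 10.02"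
      using 2 l abs_small[OF small(2)] \<eta> by simp
    then show ?thesis unfolding abs_mult by (rule mult_right_mono) simp
  qed
  have "0 < 3 / S" using S by simp
  then have "S \<le> lam - 4" using S(2) \<eta> by linarith
  \<comment> \<open>Here \<open>lam >= 8\<close> enters with little room:
    \<open>2 * lam - 11.867\<close> exceeds \<open>lam - 4\<close> only from
    \<open>lam = 7.867\<close> on.\<close>
  then have "S \<le> 2 * lam - 10.02 - 1.18 - 0.667" using lam by simp
  then have "S * \<bar>dx\<bar> \<le> (2 * lam - 10.02 - 1.18 - 0.667) * \<bar>dx\<bar>"
    by (rule mult_right_mono) simp
  also have "\<dots> = (2 * lam - 10.02) * \<bar>dx\<bar> - 1.18 * \<bar>dx\<bar> - 0.667 * \<bar>dx\<bar>"
    by (simp add: algebra_simps)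
  also have "\<dots> \<le> \<bar>(8 * x * L - 2 * y) * dx + (4 * x\<^sup>2 - 1) * dL - 2 * x * dy\<bar>"
    using A B C by linarith
  finally show ?thesis .
qed

end

text \<open>Three half-traces of modulus about 1 make the invariant at most about 5, while its value
  is at least \<open>1 + 8^2 / 4 = 17\<close>.\<close>

lemma three_not_small:
  assumes "(trace_seq lam E k)\<^sup>2 \<le> 1 + \<eta>" "(trace_seq lam E (Suc k))\<^sup>2 \<le> 1 + \<eta>"
    "(trace_seq lam E (Suc (Suc k)))\<^sup>2 \<le> 1 + \<eta>"
  shows False
proof -
  define x y w where "x = trace_seq lam E k" and "y = trace_seq lam E (Suc k)"
    and "w = trace_seq lam E (Suc (Suc k))"
  have sm: "\<bar>u\<bar> \<le> 2" if "u\<^sup>2 \<le> 1 + \<eta>" for u :: real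
    by (rule power2_le_imp_le) (use that \<eta> in auto)
  have "\<bar>x * y\<bar> * \<bar>w\<bar> \<le> (1 + \<eta>) * (1.1)"
  proof (rule mult_mono)
    show "\<bar>w\<bar> \<le> 1.1" by (rule power2_le_imp_le) (use assms \<eta> in \<open>auto simp: w_def power2_eq_square\<close>)
    have "2 * \<bar>x * y\<bar> \<le> x\<^sup>2 + y\<^sup>2"
      using sum_squares_bound[of "\<bar>x\<bar>" "\<bar>y\<bar>"] by (simp add: abs_mult)
    then show "\<bar>x * y\<bar> \<le> 1 + \<eta>" using assms by (simp add: x_def y_def)
  qed (use \<eta> in auto)
  then have "- 2 * x * y * w \<le> 2.3" using \<eta> by (simp add: abs_mult[symmetric])
  moreover have "x\<^sup>2 + y\<^sup>2 + w\<^sup>2 - 2 * x * y * w = 1 + lam\<^sup>2 / 4"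
    using trace_seq_invariant[of lam E k] by (simp add: x_def y_def w_def)
  moreover have "lam\<^sup>2 \<ge> 8\<^sup>2" using lam by (intro power_mono) auto
  ultimately show False using assms \<eta> by (simp add: x_def y_def w_def)
qed

text \<open>Each claim feeds the other. If \<open>k\<close>, \<open>k + 1\<close> are small levels,
  \<open>k - 1\<close> is not, so by nesting \<open>k - 2\<close> is, and the second claim there
  starts the near estimate. If \<open>k\<close>, \<open>k + 2\<close> are small, either
  \<open>k - 1\<close> is small and the first claim there starts the near estimate, or
  \<open>k - 2\<close> is small with \<open>k - 1\<close> large, which is the far estimate.\<close>

lemma trace_deriv_growth:
  fixes E :: real
  defines "x \<equiv> trace_seq lam E" and "d \<equiv> trace_deriv lam E"
  shows "((x k)\<^sup>2 \<le> 1 + \<eta> \<and> (x (Suc k))\<^sup>2 \<le> 1 + \<eta> \<longrightarrow> S * \<bar>d k\<bar> \<le> \<bar>d (Suc k)\<bar>) \<and>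
    ((x k)\<^sup>2 \<le> 1 + \<eta> \<and> (x (Suc (Suc k)))\<^sup>2 \<le> 1 + \<eta> \<longrightarrow> S * \<bar>d k\<bar> \<le> \<bar>d (Suc (Suc k))\<bar>)"
proof (induction k rule: less_induct)
  case (less k)
  have rec: "x (Suc (Suc (Suc j))) = 2 * x (Suc (Suc j)) * x (Suc j) - x j"
    "d (Suc (Suc (Suc j))) = 2 * (d (Suc (Suc j)) * x (Suc j) + x (Suc (Suc j)) * d (Suc j)) - d j" for j
    by (simp_all add: x_def d_def)
  have inv: "(x j)\<^sup>2 + (x (Suc j))\<^sup>2 + (x (Suc (Suc j)))\<^sup>2 - 2 * x j * x (Suc j) * x (Suc (Suc j))
    = 1 + lam\<^sup>2 / 4" for j
    unfolding x_def by (rule trace_seq_invariant)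
  have dinv: "(x j - x (Suc j) * x (Suc (Suc j))) * d j + (x (Suc j) - x j * x (Suc (Suc j))) * d (Suc j)
     + (x (Suc (Suc j)) - x j * x (Suc j)) * d (Suc (Suc j)) = 0" for j
    unfolding x_def d_def by (rule trace_deriv_invariant)
  have x0: "x 0 = 1" "d 0 = 0" by (simp_all add: x_def d_def)
  have tns: "(x j)\<^sup>2 \<le> 1 + \<eta> \<Longrightarrow> (x (Suc j))\<^sup>2 \<le> 1 + \<eta> \<Longrightarrow> (x (Suc (Suc j)))\<^sup>2 \<le> 1 + \<eta> \<Longrightarrow> False" for j
    unfolding x_def by (rule three_not_small)
  have nested: "(x (Suc j))\<^sup>2 \<le> 1 + \<eta> \<or> (x j)\<^sup>2 \<le> 1 + \<eta>" if "(x (Suc (Suc j)))\<^sup>2 \<le> 1 + \<eta>" for j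
  proof -
    have iff: "\<bar>u\<bar> \<le> sqrt (1 + \<eta>) \<longleftrightarrow> u\<^sup>2 \<le> 1 + \<eta>" for u
      by (simp flip: real_sqrt_abs)
    show ?thesis
      using trace_seq_nested[of "sqrt (1 + \<eta>)" lam E j] that \<eta> by (simp add: x_def iff)
  qed
  show ?case
  proof (intro conjI impI; elim conjE)
    assume sm: "(x k)\<^sup>2 \<le> 1 + \<eta>" "(x (Suc k))\<^sup>2 \<le> 1 + \<eta>"
    show "S * \<bar>d k\<bar> \<le> \<bar>d (Suc k)\<bar>"
    proof (cases k)
      case 0
      then show ?thesis by (simp add: x0)
    next
      case (Suc j)
      have big: "\<not> (x j)\<^sup>2 \<le> 1 + \<eta>" using tns[of j] sm Suc by auto
      \<comment> \<open>Level 0 has half-trace 1 and is always small, so a level that is not small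
        is at least 1.\<close>
      then obtain i where i: "j = Suc i" using x0 \<eta> by (cases j) auto
      have small: "(x i)\<^sup>2 \<le> 1 + \<eta>" using nested[of i] sm(1) big by (simp add: Suc i)
      have "S * \<bar>d i\<bar> \<le> \<bar>d (Suc (Suc i))\<bar>" using less.IH[of i] small sm by (simp add: Suc i)
      then have "S * \<bar>d (Suc (Suc i))\<bar> \<le>
          \<bar>2 * (x (Suc i) * d (Suc (Suc i)) + x (Suc (Suc i)) * d (Suc i)) - d i\<bar>"
        using inv[of i] dinv[of i] small sm
        by (intro deriv_growth_near[where y = "x i"]) (auto simp: Suc i algebra_simps)
      then show ?thesis by (simp add: Suc i rec algebra_simps)
    qed
  next
    assume sm: "(x k)\<^sup>2 \<le> 1 + \<eta>" "(x (Suc (Suc k)))\<^sup>2 \<le> 1 + \<eta>"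
    show "S * \<bar>d k\<bar> \<le> \<bar>d (Suc (Suc k))\<bar>"
    proof (cases k)
      case 0
      then show ?thesis by (simp add: x0)
    next
      case (Suc j)
      show ?thesis
      proof (cases "(x j)\<^sup>2 \<le> 1 + \<eta>")
        case True
        have "S * \<bar>d j\<bar> \<le> \<bar>d (Suc j)\<bar>" using less.IH[of j] True sm by (simp add: Suc)
        then have "S * \<bar>d (Suc j)\<bar> \<le>
            \<bar>2 * (x (Suc (Suc j)) * d (Suc j) + x (Suc j) * d (Suc (Suc j))) - d j\<bar>"
          using inv[of j] dinv[of j] True sm
          by (intro deriv_growth_near[where y = "x j"]) (auto simp: Suc algebra_simps)
        then show ?thesis by (simp add: Suc rec algebra_simps)
      next
        case False
        then obtain i where i: "j = Suc i" using x0 \<eta> by (cases j) auto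
        have small: "(x i)\<^sup>2 \<le> 1 + \<eta>" using nested[of i] sm(1) False by (simp add: Suc i)
        have "S * \<bar>d i\<bar> \<le> \<bar>d (Suc (Suc i))\<bar>" using less.IH[of i] small sm by (simp add: Suc i)
        moreover have "((4 * (x (Suc (Suc i)))\<^sup>2 - 1) * x (Suc i) - 2 * x (Suc (Suc i)) * x i)\<^sup>2 \<le> 1 + \<eta>"
          using sm(2) by (simp add: Suc i rec power2_eq_square algebra_simps)
        ultimately have "S * \<bar>d (Suc (Suc i))\<bar> \<le>
            \<bar>(8 * x (Suc (Suc i)) * x (Suc i) - 2 * x i) * d (Suc (Suc i))
              + (4 * (x (Suc (Suc i)))\<^sup>2 - 1) * d (Suc i) - 2 * x (Suc (Suc i)) * d i\<bar>"
          using inv[of i] dinv[of i] small sm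
          by (intro deriv_growth_far) (auto simp: Suc i algebra_simps)
        also have "(8 * x (Suc (Suc i)) * x (Suc i) - 2 * x i) * d (Suc (Suc i))
              + (4 * (x (Suc (Suc i)))\<^sup>2 - 1) * d (Suc i) - 2 * x (Suc (Suc i)) * d i = d (Suc (Suc k))"
          by (simp add: Suc i rec power2_eq_square algebra_simps)
        finally show ?thesis by (simp add: Suc i)
      qed
    qed
  qed
qed

text \<open>Each descent by one or two indices along small levels gains a factor \<open>S\<close>,
  hence at least \<open>sqrt S\<close> per index. The chain ends at level 1 or 2, where the
  derivative is 1/2 and the factor \<open>2 * S\<close> absorbs the start; treating
  \<open>k = 2\<close> apart avoids level 0, whose derivative is 0.\<close>

lemma trace_deriv_ge:
  assumes "(trace_seq lam E k)\<^sup>2 \<le> 1 + \<eta>" "k \<ge> 1"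
  shows "sqrt S ^ k \<le> 2 * S * \<bar>trace_deriv lam E k\<bar>"
  using assms
proof (induction k rule: less_induct)
  case (less k)
  have s: "1 \<le> sqrt S" "sqrt S \<le> S" "sqrt S * sqrt S = S"
    using S by (simp_all add: real_le_lsqrt power2_eq_square)
  have SS: "\<bar>S\<bar> = S" using S by simp
  have iff: "\<bar>u\<bar> \<le> sqrt (1 + \<eta>) \<longleftrightarrow> u\<^sup>2 \<le> 1 + \<eta>" for u
    by (simp flip: real_sqrt_abs)
  consider "k = 1" | "k = 2" | j where "k = Suc (Suc j)" "j \<ge> 1"
  proof (cases "k \<le> 2")
    case False
    then show ?thesis using that(3)[of "k - 2"] by simp
  qed (use less.prems(2) that(1,2) in linarith)
  then show ?case
  proof cases
    case 1
    then show ?thesis using s by simp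
  next
    case 2
    then show ?thesis using s by (simp add: numeral_2_eq_2)
  next
    case (3 j)
    consider "(trace_seq lam E (Suc j))\<^sup>2 \<le> 1 + \<eta>" | "(trace_seq lam E j)\<^sup>2 \<le> 1 + \<eta>"
      using trace_seq_nested[of "sqrt (1 + \<eta>)" lam E j] less.prems(1) \<eta> by (auto simp: 3 iff)
    then show ?thesis
    proof cases
      case 1
      have "sqrt S * sqrt S ^ Suc j \<le> S * (2 * S * \<bar>trace_deriv lam E (Suc j)\<bar>)"
        by (rule mult_mono) (use less.IH[of "Suc j"] 1 3 s S in auto)
      also have "\<dots> \<le> 2 * S * \<bar>trace_deriv lam E k\<bar>"
        using trace_deriv_growth[of E "Suc j"] 1 less.prems S by (simp add: 3)
      finally show ?thesis by (simp add: 3)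
    next
      case 2
      have "S * sqrt S ^ j \<le> S * (2 * S * \<bar>trace_deriv lam E j\<bar>)"
        by (rule mult_left_mono) (use less.IH[of j] 2 3 s S in auto)
      also have "\<dots> \<le> 2 * S * \<bar>trace_deriv lam E k\<bar>"
        using trace_deriv_growth[of E "j"] 2 less.prems S by (simp add: 3)
      also have "S * sqrt S ^ j = sqrt S ^ k" by (simp add: 3 SS flip: mult.assoc)
      finally show ?thesis .
    qed
  qed
qed

end

section \<open>Real-rootedness and distance from the real axis\<close>

fun trace_poly :: "'a::field \<Rightarrow> nat \<Rightarrow> 'a poly" where
  "trace_poly l 0 = 1"
| "trace_poly l (Suc 0) = [:0, 1 / 2:]"
| "trace_poly l (Suc (Suc 0)) = [:- l / 2, 1 / 2:]"
| "trace_poly l (Suc (Suc (Suc k))) =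
     smult 2 (trace_poly l (Suc (Suc k)) * trace_poly l (Suc k)) - trace_poly l k"

lemma poly_trace_poly: "poly (trace_poly l k) z = trace_seq l z k"
  by (induction l k rule: trace_poly.induct) (auto simp: field_simps)

lemma poly_pderiv_trace_poly: "poly (pderiv (trace_poly l k)) z = trace_deriv l z k"
  by (induction l k rule: trace_poly.induct)
    (auto simp: pderiv_mult pderiv_diff pderiv_smult pderiv_pCons poly_trace_poly algebra_simps)

lemma cmod_prod_mset_ge_real:
  assumes "\<And>x. x \<in># A \<Longrightarrow> Im x = 0"
  shows "cmod (\<Prod>x\<in>#A. of_real E - x) \<le> cmod (\<Prod>x\<in>#A. Complex E y - x)"
  using assms
proof (induction A)
  case (add x A)
  have "cmod (of_real E - x) \<le> cmod (Complex E y - x)"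
    using add.prems[of x] by (simp add: cmod_def)
  then show ?case using add by (auto simp: norm_mult intro!: mult_mono)
qed simp

text \<open>A real root is at least as far from \<open>Complex E y\<close> as from \<open>E\<close>;
  the inequality holds factor by factor.\<close>

lemma real_rooted_cmod_ge:
  assumes "\<And>z. poly p z = 0 \<Longrightarrow> Im z = 0"
  shows "cmod (poly p (of_real E)) \<le> cmod (poly p (Complex E y))"
proof -
  have "p \<noteq> 0" using assms[of \<i>] by auto
  then obtain A where A: "p = smult (lead_coeff p) (\<Prod>x\<in>#A. [:-x, 1:])"
    using alg_closed_imp_factorization[of p] by auto
  have ev: "poly p w = lead_coeff p * (\<Prod>x\<in>#A. w - x)" for w
    by (subst A) (simp add: poly_prod_mset image_mset.compositionality o_def)
  have "Im x = 0" if "x \<in># A" for x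
    by (rule assms) (use that in \<open>auto simp: ev prod_mset_zero_iff\<close>)
  then show ?thesis
    unfolding ev norm_mult by (intro mult_left_mono cmod_prod_mset_ge_real) auto
qed

text \<open>An Ekeland-type argument: the function \<open>f + (D / 2) \<bar>\<cdot> - E\<bar>\<close> cannot have an interior minimum
  above level 1, since its slope there would not change sign.\<close>

lemma near_level_aux:
  fixes f f' :: "real \<Rightarrow> real"
  assumes der: "\<And>x. (f has_real_derivative f' x) (at x)" and D: "D > 0"
    and lower: "\<And>x. \<bar>f x\<bar> \<le> a \<Longrightarrow> D \<le> \<bar>f' x\<bar>" and E: "1 < f E" "f E \<le> a"
  shows "\<exists>t. f t = 1 \<and> D / 2 * \<bar>E - t\<bar> \<le> f E - 1"
proof -
  define r where "r = (f E - 1) / (D / 2)"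
  have r: "r > 0" "D / 2 * r = f E - 1" using D E by (auto simp: r_def)
  have cont: "continuous_on A f" for A
    using der DERIV_isCont continuous_at_imp_continuous_on by blast
  have "\<exists>s\<in>{E - r..E + r}. f s \<le> 1"
  proof (rule ccontr)
    assume "\<not> ?thesis"
    then have gt: "f s > 1" if "s \<in> {E - r..E + r}" for s using that by (meson not_le)
    obtain t where t: "t \<in> {E - r..E + r}"
      and min: "\<And>s. s \<in> {E - r..E + r} \<Longrightarrow> f t + D / 2 * \<bar>t - E\<bar> \<le> f s + D / 2 * \<bar>s - E\<bar>"
    proof -
      have "\<exists>t\<in>{E - r..E + r}. \<forall>s\<in>{E - r..E + r}. f t + D / 2 * \<bar>t - E\<bar> \<le> f s + D / 2 * \<bar>s - E\<bar>"
        by (rule continuous_attains_inf) (use r in \<open>auto intro!: continuous_intros cont\<close>)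
      then show ?thesis using that by blast
    qed
    have le: "f t + D / 2 * \<bar>t - E\<bar> \<le> f E" using min[of E] r by simp
    have "\<bar>t - E\<bar> \<noteq> r"
    proof
      assume "\<bar>t - E\<bar> = r"
      then have "f t + (f E - 1) \<le> f E" using le r(2) by metis
      then show False using gt[OF t] by simp
    qed
    then have t': "E - r < t" "t < E + r" using t by auto
    have "0 \<le> D / 2 * \<bar>t - E\<bar>" using D by simp
    then have "f t \<le> a" using le E by linarith
    then have D': "D \<le> \<bar>f' t\<bar>" using lower[of t] gt[OF t] by simp
    have nomove: False if "f s < f t - D / 2 * \<bar>s - t\<bar>" "s \<in> {E - r..E + r}" for s
    proof -
      have "D / 2 * \<bar>s - E\<bar> \<le> D / 2 * (\<bar>s - t\<bar> + \<bar>t - E\<bar>)"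
        using D by (intro mult_left_mono) auto
      then show False using min[OF that(2)] that(1) by (simp add: distrib_left)
    qed
    show False
    proof (cases "f' t > 0")
      case True
      have "((\<lambda>x. f x - D / 2 * x) has_real_derivative (f' t - D / 2)) (at t)"
        by (auto intro!: derivative_eq_intros der)
      then obtain d where d: "d > 0" "\<And>h. h > 0 \<Longrightarrow> h < d \<Longrightarrow> f (t - h) - D / 2 * (t - h) < f t - D / 2 * t"
        using DERIV_pos_inc_left[of "\<lambda>x. f x - D / 2 * x" "f' t - D / 2" t] True D' D by auto
      define h where "h = min (d / 2) (t - (E - r))"
      have h: "h > 0" "h < d" "t - h \<in> {E - r..E + r}" using d t' by (auto simp: h_def)
      have "f (t - h) < f t - D / 2 * h"
        using d(2)[of h] h unfolding right_diff_distrib by linarith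
      then show False using nomove[of "t - h"] h by simp
    next
      case False
      have "((\<lambda>x. f x + D / 2 * x) has_real_derivative (f' t + D / 2)) (at t)"
        by (auto intro!: derivative_eq_intros der)
      then obtain d where d: "d > 0" "\<And>h. h > 0 \<Longrightarrow> h < d \<Longrightarrow> f (t + h) + D / 2 * (t + h) < f t + D / 2 * t"
        using DERIV_neg_dec_right[of "\<lambda>x. f x + D / 2 * x" "f' t + D / 2" t] False D' D by auto
      define h where "h = min (d / 2) (E + r - t)"
      have h: "h > 0" "h < d" "t + h \<in> {E - r..E + r}" using d t' by (auto simp: h_def)
      have "f (t + h) < f t - D / 2 * h"
        using d(2)[of h] h unfolding distrib_left by linarith
      then show False using nomove[of "t + h"] h by simp
    qed
  qed
  then obtain s where s: "s \<in> {E - r..E + r}" "f s \<le> 1" by blast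
  have "\<exists>t. \<bar>E - t\<bar> \<le> r \<and> f t = 1"
  proof (cases "s \<le> E")
    case True
    obtain t where "s \<le> t" "t \<le> E" "f t = 1"
      using IVT'[of f s 1 E] s(2) E(1) True cont by auto
    then show ?thesis using s(1) r(1) by (intro exI[of _ t]) auto
  next
    case False
    obtain t where "E \<le> t" "t \<le> s" "f t = 1"
      using IVT2'[of f s 1 E] s(2) E(1) False cont by auto
    then show ?thesis using s(1) r(1) by (intro exI[of _ t]) auto
  qed
  then obtain t where t: "\<bar>E - t\<bar> \<le> r" "f t = 1" by blast
  have "D / 2 * \<bar>E - t\<bar> \<le> D / 2 * r" using t D by (intro mult_left_mono) auto
  then show ?thesis using t r by auto
qed

text \<open>\<open>t\<close> is to be divided out as a root of \<open>f - f t\<close>. Its level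
  stays in \<open>[-1, 1]\<close>, where real-rootedness is available, and the quotient at
  \<open>E\<close> is a derivative or a chord slope of at least \<open>D / 2\<close>.\<close>

lemma near_level:
  fixes f f' :: "real \<Rightarrow> real"
  assumes der: "\<And>x. (f has_real_derivative f' x) (at x)" and D: "D > 0"
    and lower: "\<And>x. \<bar>f x\<bar> \<le> a \<Longrightarrow> D \<le> \<bar>f' x\<bar>" and E: "\<bar>f E\<bar> \<le> a"
  obtains t where "\<bar>f t\<bar> \<le> 1" "t = E \<or> t \<noteq> E \<and> D / 2 * \<bar>E - t\<bar> \<le> \<bar>f E - f t\<bar>"
proof -
  consider "\<bar>f E\<bar> \<le> 1" | "1 < f E" | "1 < - f E" by linarith
  then show ?thesis
  proof cases
    case 1
    then show ?thesis using that[of E] by simp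
  next
    case 2
    then obtain t where "f t = 1" "D / 2 * \<bar>E - t\<bar> \<le> f E - 1"
      using near_level_aux[of f f' D a E] assms by auto
    then show ?thesis using that[of t] 2 by auto
  next
    case 3
    have "\<exists>t. - f t = 1 \<and> D / 2 * \<bar>E - t\<bar> \<le> - f E - 1"
      by (rule near_level_aux[where f' = "\<lambda>x. - f' x" and a = a])
        (use assms 3 in \<open>auto intro!: derivative_eq_intros\<close>)
    then obtain t where "- f t = 1" "D / 2 * \<bar>E - t\<bar> \<le> - f E - 1" by blast
    moreover have "f t = - 1" using \<open>- f t = 1\<close> by simp
    ultimately show ?thesis using that[of t] 3 by auto
  qed
qed

text \<open>Where the half-trace at \<open>E\<close> exceeds \<open>a\<close>, real-rootedness at
  level 0 suffices. Otherwise a real root \<open>t\<close> of the half-trace minus \<open>c\<close>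
  is split off: the linear factor contributes at least \<open>|y|\<close>, and the quotient, again
  real-rooted, is no smaller than at \<open>E\<close>, where it is at least \<open>D / 2\<close>.
  The 1 in \<open>1 + a\<close> pays for \<open>c\<close>.\<close>

lemma trace_seq_large_off_real:
  fixes lam E y D a :: real
  assumes rr: "\<And>z c. \<bar>c\<bar> \<le> 1 \<Longrightarrow> trace_seq (of_real lam) z k = complex_of_real c \<Longrightarrow> Im z = 0"
    and D: "D > 0" and lower: "\<And>E. \<bar>trace_seq lam E k\<bar> \<le> a \<Longrightarrow> D \<le> \<bar>trace_deriv lam E k\<bar>"
    and y: "\<bar>y\<bar> * (D / 2) > 1 + a"
  shows "a < cmod (trace_seq (of_real lam) (Complex E y) k)"
proof (cases "\<bar>trace_seq lam E k\<bar> \<le> a")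
  case False
  have "cmod (poly (trace_poly (of_real lam) k) (of_real E))
      \<le> cmod (poly (trace_poly (of_real lam) k) (Complex E y))"
    using rr[of 0] by (intro real_rooted_cmod_ge) (simp add: poly_trace_poly)
  then show ?thesis using False by (simp add: poly_trace_poly trace_seq_of_real)
next
  case True
  obtain t where t: "\<bar>trace_seq lam t k\<bar> \<le> 1"
    "t = E \<or> t \<noteq> E \<and> D / 2 * \<bar>E - t\<bar> \<le> \<bar>trace_seq lam E k - trace_seq lam t k\<bar>"
    using near_level[of "\<lambda>E. trace_seq lam E k" "\<lambda>E. trace_deriv lam E k" D a E]
      trace_seq_has_derivative D lower True by metis
  define c where "c = trace_seq lam t k"
  define p where "p = trace_poly (of_real lam) k - [:complex_of_real c:]"
  have p: "poly p z = trace_seq (of_real lam) z k - of_real c" for z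
    by (simp add: p_def poly_trace_poly)
  have "poly p (of_real t) = 0" by (simp add: p c_def trace_seq_of_real)
  then obtain q where q: "p = [:- of_real t, 1:] * q"
    by (metis poly_eq_0_iff_dvd dvdE)
  have pq: "poly p z = (z - of_real t) * poly q z" for z by (simp add: q algebra_simps)
  have rrq: "Im z = 0" if "poly q z = 0" for z
  proof (rule rr)
    show "trace_seq (of_real lam) z k = of_real c" using pq[of z] that by (simp add: p)
    show "\<bar>c\<bar> \<le> 1" using t by (simp add: c_def)
  qed
  have "D / 2 \<le> cmod (poly q (of_real E))"
  proof (cases "t = E")
    case True
    have "poly (pderiv p) (of_real E) = poly q (of_real E)"
      unfolding q by (simp add: pderiv_mult pderiv_pCons pderiv_diff pderiv_smult True del: mult_pCons_left)
    moreover have "poly (pderiv p) (of_real E) = of_real (trace_deriv lam E k)"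
      by (simp add: p_def pderiv_diff poly_pderiv_trace_poly trace_deriv_of_real pderiv_pCons)
    ultimately have "cmod (poly q (of_real E)) = \<bar>trace_deriv lam E k\<bar>"
      by (metis norm_of_real)
    then show ?thesis using lower[of E] \<open>\<bar>trace_seq lam E k\<bar> \<le> a\<close> D by simp
  next
    case False
    have "of_real (trace_seq lam E k - c) = of_real (E - t) * poly q (of_real E)"
      using pq[of "of_real E"] by (simp add: p trace_seq_of_real)
    then have "\<bar>trace_seq lam E k - c\<bar> = \<bar>E - t\<bar> * cmod (poly q (of_real E))"
      by (metis norm_mult norm_of_real)
    then have "D / 2 * \<bar>E - t\<bar> \<le> cmod (poly q (of_real E)) * \<bar>E - t\<bar>"
      using t(2) False by (simp add: c_def mult.commute)
    then show ?thesis using False by (simp add: mult_le_cancel_right)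
  qed
  also have "\<dots> \<le> cmod (poly q (Complex E y))"
    using rrq by (rule real_rooted_cmod_ge)
  finally have Q: "D / 2 \<le> cmod (poly q (Complex E y))" .
  have "\<bar>y\<bar> * (D / 2) \<le> cmod (Complex E y - of_real t) * cmod (poly q (Complex E y))"
    using Q D abs_Im_le_cmod[of "Complex E y - of_real t"] by (intro mult_mono) auto
  also have "\<dots> = cmod (trace_seq (of_real lam) (Complex E y) k - of_real c)"
    using pq[of "Complex E y"] by (simp add: p norm_mult)
  also have "\<dots> \<le> cmod (trace_seq (of_real lam) (Complex E y) k) + cmod (of_real c)"
    by (rule norm_triangle_ineq4)
  finally show ?thesis using y t by (simp add: c_def)
qed

section \<open>The Fibonacci potential and its transfer matrices\<close>

lemma golden_theta_bounds: "0.6 < golden_theta" "golden_theta < 0.625"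
proof -
  have "2.2 < sqrt 5" by (rule real_less_rsqrt) (simp add: power2_eq_square)
  moreover have "sqrt 5 < 2.25" by (rule real_less_lsqrt) (simp_all add: power2_eq_square)
  ultimately show "0.6 < golden_theta" "golden_theta < 0.625"
    by (auto simp: golden_theta_def)
qed

lemma golden_theta_square: "golden_theta * golden_theta = 1 - golden_theta"
  by (simp add: golden_theta_def field_simps)

text \<open>Adding \<open>golden_theta\<close> passes the next integer exactly when the fractional
  part is at least \<open>1 - golden_theta\<close>. Repetition and reflection thereby become
  statements about rounding.\<close>

lemma fib_potential_floor:
  "fib_potential lam n = lam * of_int (\<lfloor>of_int (n + 1) * golden_theta\<rfloor> - \<lfloor>of_int n * golden_theta\<rfloor>)"
proof -
  define t where "t = golden_theta"
  define x where "x = of_int n * t"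
  have t: "0 < t" "t < 1" using golden_theta_bounds by (auto simp: t_def)
  have x: "x = of_int \<lfloor>x\<rfloor> + frac x" "0 \<le> frac x" "frac x < 1"
    by (auto simp: frac_def frac_lt_1) linarith+
  have "of_int (n + 1) * t = x + t" by (simp add: x_def algebra_simps)
  moreover have "\<lfloor>x + t\<rfloor> = (if frac x < 1 - t then \<lfloor>x\<rfloor> else \<lfloor>x\<rfloor> + 1)"
  proof (cases "frac x < 1 - t")
    case True
    then have "of_int \<lfloor>x\<rfloor> \<le> x + t" "x + t < of_int \<lfloor>x\<rfloor> + 1" using x t by linarith+
    then show ?thesis using True by (simp add: floor_unique)
  next
    case False
    then have "of_int (\<lfloor>x\<rfloor> + 1) \<le> x + t" "x + t < of_int (\<lfloor>x\<rfloor> + 1) + 1" using x t by simp_all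
    then show ?thesis using False floor_unique by fastforce
  qed
  ultimately show ?thesis
    using x by (auto simp: fib_potential_def indicator_def t_def[symmetric] x_def[symmetric])
qed

text \<open>Since \<open>golden_theta^2 = 1 - golden_theta\<close>, the powers of
  \<open>- golden_theta\<close> obey the Fibonacci recursion; they are the signed errors of the
  convergents.\<close>

lemma fib_mult_golden_theta:
  "real (fib (Suc k)) * golden_theta = real (fib k) - (- golden_theta) ^ Suc k"
proof (induction k rule: fib.induct)
  case 2
  then show ?case using golden_theta_square by simp
next
  case (3 k)
  have "(- golden_theta) ^ Suc (Suc (Suc k)) = (- golden_theta) ^ Suc k * (golden_theta * golden_theta)"
    by simp
  also have "\<dots> = (- golden_theta) ^ Suc k + (- golden_theta) ^ Suc (Suc k)"
    unfolding golden_theta_square by (simp add: algebra_simps)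
  finally show ?case using 3 by (simp add: algebra_simps)
qed simp

text \<open>In the lattice basis formed by two consecutive convergents the errors alternate in sign, so
  they cannot cancel for \<open>0 < n < fib (k + 2)\<close>.\<close>

lemma golden_theta_approx:
  fixes n m :: int
  assumes n: "0 < n" "n < int (fib (Suc (Suc k)))"
  obtains r where "of_int n * golden_theta - of_int m = - ((- golden_theta) ^ Suc k) * r" "r \<ge> 1 \<or> r < - 1"
proof -
  have "\<exists>a b. n = a * int (fib (Suc k)) + b * int (fib (Suc (Suc k))) \<and>
      m = a * int (fib k) + b * int (fib (Suc k))"
  proof (induction k)
    case 0
    show ?case by (intro exI[of _ "n - m"] exI[of _ m]) simp
  next
    case (Suc k)
    then obtain a b where "n = a * int (fib (Suc k)) + b * int (fib (Suc (Suc k)))"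
      "m = a * int (fib k) + b * int (fib (Suc k))" by blast
    then show ?case by (intro exI[of _ "b - a"] exI[of _ a]) (simp add: algebra_simps)
  qed
  then obtain a b where ab: "n = a * int (fib (Suc k)) + b * int (fib (Suc (Suc k)))"
      "m = a * int (fib k) + b * int (fib (Suc k))" by blast
  define t where "t = golden_theta"
  have t: "0 < t" using golden_theta_bounds by (auto simp: t_def)
  have "of_int n * t - of_int m = of_int a * (real (fib (Suc k)) * t - real (fib k))
      + of_int b * (real (fib (Suc (Suc k))) * t - real (fib (Suc k)))"
    unfolding ab by (simp add: algebra_simps)
  also have "\<dots> = of_int a * (- ((- t) ^ Suc k)) + of_int b * (- ((- t) ^ Suc (Suc k)))"
    unfolding t_def fib_mult_golden_theta by simp
  also have "\<dots> = - ((- t) ^ Suc k) * (of_int a - t * of_int b)" by (simp add: algebra_simps)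
  finally have e: "of_int n * t - of_int m = - ((- t) ^ Suc k) * (of_int a - t * of_int b)" .
  have fpos: "int (fib (Suc k)) \<ge> 1" "int (fib (Suc (Suc k))) \<ge> 1"
    using fib_neq_0_nat[of "Suc k"] fib_neq_0_nat[of "Suc (Suc k)"] by linarith+
  \<comment> \<open>For \<open>b >= 1\<close> the bound below -1 is strict. This strictness later
    keeps a shifted value strictly below the next integer.\<close>
  consider "b = 0" | "b \<ge> 1" | "b \<le> - 1" by linarith
  then have "of_int a - t * of_int b \<ge> 1 \<or> of_int a - t * of_int b < - 1"
  proof cases
    case 1
    then have "a > 0" using ab n fpos by (simp add: zero_less_mult_iff)
    then show ?thesis using 1 by simp
  next
    case 2
    have "a < 0"
    proof (rule ccontr)
      assume "\<not> a < 0"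
      then have "0 \<le> a * int (fib (Suc k))" by simp
      moreover have "1 * int (fib (Suc (Suc k))) \<le> b * int (fib (Suc (Suc k)))"
        using 2 by (intro mult_right_mono) auto
      ultimately show False using ab n by linarith
    qed
    then have "real_of_int a \<le> -1" by linarith
    moreover have "t * of_int b > 0" using 2 t by simp
    ultimately show ?thesis by linarith
  next
    case 3
    have "a > 0"
    proof (rule ccontr)
      assume "\<not> a > 0"
      then have "a * int (fib (Suc k)) \<le> 0" by (simp add: mult_nonpos_nonneg)
      moreover have "b * int (fib (Suc (Suc k))) \<le> 0" using 3 by (simp add: mult_nonpos_nonneg)
      ultimately show False using ab n by linarith
    qed
    then have "real_of_int a \<ge> 1" by linarith
    moreover have "t * of_int b < 0" using 3 t by (simp add: mult_pos_neg)
    ultimately show ?thesis by linarith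
  qed
  then show ?thesis using that[OF e[unfolded t_def]] by (simp add: t_def)
qed

text \<open>The shift adds the integer \<open>fib k\<close> and the error \<open>- d\<close>. By the
  approximation lemma the neighbouring integer on the side towards which \<open>- d\<close> moves
  the value is too far away to be crossed.\<close>

lemma floor_golden_theta_shift:
  fixes n :: int
  assumes n: "0 < n" "n < int (fib (Suc (Suc k)))"
  shows "\<lfloor>of_int (n + int (fib (Suc k))) * golden_theta\<rfloor> = \<lfloor>of_int n * golden_theta\<rfloor> + int (fib k)"
proof -
  define t d x where "t = golden_theta" and "d = (- t) ^ Suc k" and "x = of_int n * t"
  have d0: "d \<noteq> 0" using golden_theta_bounds by (simp add: d_def t_def)
  have "\<lfloor>x - d\<rfloor> = \<lfloor>x\<rfloor>"
  proof (rule floor_unique)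
    obtain r where r: "x - of_int \<lfloor>x\<rfloor> = - d * r" "r \<ge> 1 \<or> r < - 1"
      using golden_theta_approx[OF n, of "\<lfloor>x\<rfloor>"] by (auto simp: x_def t_def d_def)
    have "0 \<le> - d * r" using r(1) by (metis floor_correct diff_ge_0_iff_ge)
    show "of_int \<lfloor>x\<rfloor> \<le> x - d"
    proof (cases "d > 0")
      case True
      then have "r \<le> 0" using \<open>0 \<le> - d * r\<close> by (simp add: mult_le_0_iff)
      then have "d * (r + 1) \<le> 0" using r(2) True by (simp add: mult_le_0_iff)
      then show ?thesis using r(1) by (simp add: algebra_simps)
    qed (use floor_correct[of x] in linarith)
    obtain r where r: "x - of_int (\<lfloor>x\<rfloor> + 1) = - d * r" "r \<ge> 1 \<or> r < - 1"
      using golden_theta_approx[OF n, of "\<lfloor>x\<rfloor> + 1"] by (auto simp: x_def t_def d_def)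
    have neg: "- d * r < 0" using r(1) floor_correct[of x] by linarith
    show "x - d < of_int \<lfloor>x\<rfloor> + 1"
    proof (cases "d > 0")
      case False
      then have "d < 0" using d0 by simp
      then have "r < 0" using neg by (simp add: zero_less_mult_iff)
      then have "d * (r + 1) > 0" using r(2) \<open>d < 0\<close> by (intro mult_neg_neg) auto
      then show ?thesis using r(1) by (simp add: algebra_simps)
    qed (use floor_correct[of x] in linarith)
  qed
  moreover have "of_int (n + int (fib (Suc k))) * t = (x - d) + of_int (int (fib k))"
    using fib_mult_golden_theta[of k] by (simp add: x_def d_def t_def algebra_simps)
  ultimately show ?thesis by (simp only: t_def[symmetric] x_def[symmetric] floor_add_int[symmetric])
qed

lemma fib_potential_shift:
  assumes "0 < n" "n + 1 < int (fib (Suc (Suc k)))"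
  shows "fib_potential lam (n + int (fib (Suc k))) = fib_potential lam n"
proof -
  have eq: "n + int (fib (Suc k)) + 1 = (n + 1) + int (fib (Suc k))" by simp
  have fl: "\<lfloor>of_int (n + int (fib (Suc k))) * golden_theta\<rfloor> = \<lfloor>of_int n * golden_theta\<rfloor> + int (fib k)"
    "\<lfloor>of_int (n + 1 + int (fib (Suc k))) * golden_theta\<rfloor> = \<lfloor>of_int (n + 1) * golden_theta\<rfloor> + int (fib k)"
    using assms by (intro floor_golden_theta_shift; simp)+
  show ?thesis unfolding fib_potential_floor eq fl by simp
qed

lemma le_fib_Suc_Suc: "n \<le> fib (Suc (Suc n))"
proof (induction n)
  case (Suc n)
  have "fib (Suc n) \<ge> 1" using fib_neq_0_nat[of "Suc n"] by linarith
  then show ?case using Suc by simp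
qed simp

lemma of_int_golden_theta_not_int:
  fixes n :: int
  assumes "0 < n"
  shows "of_int n * golden_theta \<notin> \<int>"
proof
  assume "of_int n * golden_theta \<in> \<int>"
  then obtain m where m: "of_int n * golden_theta = of_int m" by (auto elim: Ints_cases)
  have "n < int (fib (Suc (Suc (Suc (nat n)))))"
    using le_fib_Suc_Suc[of "Suc (nat n)"] assms by linarith
  then obtain r where "of_int n * golden_theta - of_int m = - ((- golden_theta) ^ Suc (Suc (nat n))) * r"
    "r \<ge> 1 \<or> r < - 1"
    using golden_theta_approx[OF assms, of "Suc (nat n)" m] by blast
  then show False using m golden_theta_bounds by auto
qed

text \<open>For non-integral \<open>y\<close> the floor of \<open>- y\<close> is
  \<open>- floor y - 1\<close>, so the difference of floors survives. The left half-line thus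
  carries the same blocks as the right one; \<open>m = 0\<close> is excluded because
  \<open>0 * golden_theta\<close> is integral.\<close>

lemma fib_potential_reflect:
  assumes "0 < m"
  shows "fib_potential lam (- 1 - m) = fib_potential lam m"
proof -
  have fl: "\<lfloor>- (of_int k * golden_theta)\<rfloor> = - \<lfloor>of_int k * golden_theta\<rfloor> - 1" if "0 < k" for k :: int
    using of_int_golden_theta_not_int[OF that] ceiling_altdef[of "of_int k * golden_theta"]
    by (simp add: floor_minus Ints_def) (metis rangeI)
  have "of_int (- 1 - m + 1) * golden_theta = - (of_int m * golden_theta)"
    "of_int (- 1 - m) * golden_theta = - (of_int (m + 1) * golden_theta)"
    by (simp_all add: algebra_simps)
  then show ?thesis
    unfolding fib_potential_floor using fl[of m] fl[of "m + 1"] assms by simp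
qed

lemma fib_potential_initial:
  "fib_potential lam 1 = lam" "fib_potential lam 2 = 0" "fib_potential lam 3 = lam"
proof -
  have "\<lfloor>golden_theta\<rfloor> = 0" "\<lfloor>2 * golden_theta\<rfloor> = 1" "\<lfloor>3 * golden_theta\<rfloor> = 1" "\<lfloor>4 * golden_theta\<rfloor> = 2"
    using golden_theta_bounds by (simp_all add: floor_eq_iff)
  then show "fib_potential lam 1 = lam" "fib_potential lam 2 = 0" "fib_potential lam 3 = lam"
    by (simp_all add: fib_potential_floor)
qed

section \<open>Transfer matrices over Fibonacci blocks and their traces\<close>

definition step_matrix :: "real \<Rightarrow> complex \<Rightarrow> complex^2^2" where
  "step_matrix v z = vector [vector [z - of_real v, - 1], vector [1, 0]]"

fun transfer_matrix :: "(nat \<Rightarrow> real) \<Rightarrow> complex \<Rightarrow> nat \<Rightarrow> complex^2^2" where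
  "transfer_matrix V z 0 = mat 1"
| "transfer_matrix V z (Suc n) = step_matrix (V (Suc n)) z ** transfer_matrix V z n"

lemma step_matrix_simps [simp]:
  "step_matrix v z $ 1 $ 1 = z - of_real v" "step_matrix v z $ 1 $ 2 = - 1"
  "step_matrix v z $ 2 $ 1 = 1" "step_matrix v z $ 2 $ 2 = 0"
  by (simp_all add: step_matrix_def)

lemma det_step_matrix [simp]: "det (step_matrix v z) = 1"
  by (simp add: det_2)

lemma det_transfer_matrix [simp]: "det (transfer_matrix V z n) = 1"
  by (induction n) (simp_all add: det_mul)

lemma transfer_matrix_shift:
  assumes "\<And>m. 1 \<le> m \<Longrightarrow> m \<le> n \<Longrightarrow> V (m + N) = V m"
  shows "transfer_matrix V z (n + N) = transfer_matrix V z n ** transfer_matrix V z N"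
  using assms
proof (induction n)
  case (Suc n)
  have "V (Suc (n + N)) = V (Suc n)" using Suc.prems[of "Suc n"] by simp
  then show ?case using Suc by (simp add: matrix_mul_assoc)
qed simp

lemma matrix_mult_2:
  "((A :: complex^2^2) ** B) $ i $ j = A $ i $ 1 * B $ 1 $ j + A $ i $ 2 * B $ 2 $ j"
  by (simp add: matrix_matrix_mult_def sum_2)

lemma matrix_vector_2:
  "((A :: complex^2^2) *v x) $ i = A $ i $ 1 * x $ 1 + A $ i $ 2 * x $ 2"
  by (simp add: matrix_vector_mult_def sum_2)

lemma trace_2: "trace (A :: complex^2^2) = A $ 1 $ 1 + A $ 2 $ 2"
  by (simp add: trace_def sum_2)

text \<open>Cayley-Hamilton for \<open>B\<close> under the cyclic trace. With \<open>A = M k\<close>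
  and \<open>B = M (k + 1)\<close> it produces the trace recursion.\<close>

lemma trace_sandwich:
  fixes A B :: "complex^2^2"
  assumes "det B = 1"
  shows "trace (B ** (A ** B)) = trace (A ** B) * trace B - trace A"
proof -
  have "trace (A ** B) * trace B - trace (B ** (A ** B)) = trace A * det B"
    by (simp add: trace_2 det_2 matrix_mult_2 algebra_simps)
  then show ?thesis using assms by (simp add: algebra_simps)
qed

lemma cayley_hamilton_2:
  fixes A :: "complex^2^2"
  assumes "det A = 1"
  shows "(A *v (A *v x)) $ i = trace A * (A *v x) $ i - x $ i"
proof -
  have "\<forall>i. trace A * (A *v x) $ i - (A *v (A *v x)) $ i = det A * x $ i"
    by (simp add: forall_2 trace_2 det_2 matrix_vector_2 algebra_simps)
  then show ?thesis using assms by (simp add: algebra_simps)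
qed

abbreviation fib_transfer :: "real \<Rightarrow> complex \<Rightarrow> nat \<Rightarrow> complex^2^2" where
  "fib_transfer lam \<equiv> transfer_matrix (\<lambda>n. fib_potential lam (int n))"

lemma fib_Suc_ge: "k \<ge> 3 \<Longrightarrow> fib (Suc k) > fib k" "k \<ge> 4 \<Longrightarrow> fib (Suc k) > fib k + 1"
proof -
  have 2: "fib (Suc (Suc (Suc j))) \<ge> 2" for j
    by (induction j) (auto simp: numeral_eq_Suc)
  show "k \<ge> 3 \<Longrightarrow> fib (Suc k) > fib k"
    using fib_neq_0_nat[of "k - 1"] by (cases k) auto
  show "k \<ge> 4 \<Longrightarrow> fib (Suc k) > fib k + 1"
    using 2[of "k - 4"] by (cases k) (auto simp: numeral_eq_Suc Suc_diff_Suc)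
qed

lemma fib_transfer_rec:
  assumes "k \<ge> 2"
  shows "fib_transfer lam z (fib (Suc (Suc k))) = fib_transfer lam z (fib k) ** fib_transfer lam z (fib (Suc k))"
proof -
  have "fib (Suc k) \<ge> 2"
    using assms fib_Suc_ge(1)[of k] fib_neq_0_nat[of k] by (cases "k = 2") (auto simp: numeral_eq_Suc)
  then have "fib_potential lam (int (m + fib (Suc k))) = fib_potential lam (int m)"
    if "1 \<le> m" "m \<le> fib k" for m
    using fib_potential_shift[of "int m" k lam] that by simp
  then show ?thesis
    using transfer_matrix_shift[of "fib k" "\<lambda>n. fib_potential lam (int n)" "fib (Suc k)" z]
    by (simp add: add.commute)
qed

text \<open>The block recursion fails for the blocks of length \<open>fib 1 = fib 2 = 1\<close>, as
  the first two sites carry \<open>lam\<close> and 0. Taking the free step matrix as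
  \<open>M 1\<close> repairs it and explains the start value \<open>z / 2\<close>; the start value 1
  is what the trace recursion then requires at index 0.\<close>

lemma trace_fib_transfer:
  "trace (fib_transfer lam z (fib (Suc (Suc k)))) = 2 * trace_seq (of_real lam) z (Suc (Suc k))"
proof -
  define M where "M = (\<lambda>k. if k = 1 then step_matrix 0 z else fib_transfer lam z (fib k))"
  have M2: "M 2 = step_matrix lam z" by (simp add: M_def numeral_2_eq_2 fib_potential_initial)
  have rec: "M (Suc (Suc k)) = M k ** M (Suc k)" if "k \<ge> 1" for k
    using that fib_transfer_rec[of k lam z]
    by (cases "k = 1") (auto simp: M_def fib_potential_initial numeral_eq_Suc)
  have det: "det (M k) = 1" for k by (simp add: M_def)
  have "trace (M k) = 2 * trace_seq (of_real lam) z k" if "k \<ge> 1" for k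
    using that
  proof (induction k rule: less_induct)
    case (less k)
    consider "k = 1" | "k = 2" | "k = 3" | j where "k = Suc (Suc (Suc j))" "j \<ge> 1"
    proof (cases "k \<le> 3")
      case False
      then show ?thesis using that(4)[of "k - 3"] by simp
    qed (use less.prems that(1,2,3) in linarith)
    then show ?case
    proof cases
      case 1
      then show ?thesis by (simp add: M_def trace_2)
    next
      case 2
      then show ?thesis by (simp add: M2 trace_2 numeral_2_eq_2[symmetric]) (simp add: numeral_2_eq_2)
    next
      case 3
      have "M 3 = step_matrix 0 z ** step_matrix lam z"
        using rec[of 1] M2 by (simp add: numeral_eq_Suc M_def)
      then show ?thesis using 3
        by (simp add: trace_2 matrix_mult_2 numeral_3_eq_3 field_simps)
    next
      case (4 j)
      have "M k = M (Suc j) ** (M j ** M (Suc j))"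
        using rec[of "Suc j"] rec[of j] 4 by simp
      then have "trace (M k) = trace (M (Suc (Suc j))) * trace (M (Suc j)) - trace (M j)"
        using trace_sandwich[OF det, of "Suc j" "M j"] rec[of j] 4 by simp
      also have "\<dots> = 2 * trace_seq (of_real lam) z k"
        using less.IH[of j] less.IH[of "Suc j"] less.IH[of "Suc (Suc j)"] 4
        by (simp add: algebra_simps)
      finally show ?thesis .
    qed
  qed
  from this[of "Suc (Suc k)"] show ?thesis by (simp add: M_def)
qed

text \<open>The shift property over \<open>fib k\<close> sites reaches \<open>m = fib k\<close> only
  if \<open>fib k + 1 < fib (k + 1)\<close>, which holds from \<open>k = 4\<close> on.\<close>

lemma fib_transfer_double:
  assumes "k \<ge> 4"
  shows "fib_transfer lam z (fib k + fib k) = fib_transfer lam z (fib k) ** fib_transfer lam z (fib k)"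
proof (rule transfer_matrix_shift)
  obtain j where j: "k = Suc j" using assms by (cases k) auto
  show "fib_potential lam (int (m + fib k)) = fib_potential lam (int m)" if "1 \<le> m" "m \<le> fib k" for m
    using fib_potential_shift[of "int m" j lam] that fib_Suc_ge(2)[OF assms] by (simp add: j)
qed

lemma transfer_matrix_solution:
  assumes "\<And>n. n \<ge> 1 \<Longrightarrow> u (Suc n) + u (n - 1) + of_real (V n) * u n = z * u n"
  shows "transfer_matrix V z n *v vector [u (Suc 0), u 0] = vector [u (Suc n), u n]"
proof (induction n)
  case (Suc n)
  have "transfer_matrix V z (Suc n) *v vector [u (Suc 0), u 0] = step_matrix (V (Suc n)) z *v vector [u (Suc n), u n]"
    by (simp add: Suc flip: matrix_vector_mul_assoc)
  also have "\<dots> = vector [u (Suc (Suc n)), u (Suc n)]"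
    using assms[of "Suc n"] by (simp add: vec_eq_iff forall_2 matrix_vector_2 algebra_simps)
  finally show ?case .
qed simp

text \<open>Gordon's three-block argument: the potential repeats its first \<open>fib k\<close> values, so
  Cayley--Hamilton expresses the solution at \<open>fib k\<close> by its values at 0 and \<open>2 fib k\<close>, divided
  by the trace.\<close>

lemma fib_solution_le:
  fixes u :: "nat \<Rightarrow> complex"
  assumes k: "k \<ge> 4" and bound: "\<And>n. cmod (u n) \<le> B"
    and sol: "\<And>n. n \<ge> 1 \<Longrightarrow> u (Suc n) + u (n - 1) + of_real (fib_potential lam (int n)) * u n = z * u n"
  shows "cmod (trace_seq (of_real lam) z k) * cmod (u (fib k)) \<le> B"
    and "cmod (trace_seq (of_real lam) z k) * cmod (u (Suc (fib k))) \<le> B"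
proof -
  define N A v where "N = fib k" and "A = fib_transfer lam z N" and "v = (vector [u (Suc 0), u 0] :: complex^2)"
  have tr: "trace A = 2 * trace_seq (of_real lam) z k"
    using trace_fib_transfer[of lam z "k - 2"] k by (simp add: A_def N_def numeral_eq_Suc Suc_diff_Suc)
  have Av: "A *v v = vector [u (Suc N), u N]"
    unfolding A_def v_def using sol by (rule transfer_matrix_solution)
  have "A *v (A *v v) = vector [u (Suc (N + N)), u (N + N)]"
    unfolding matrix_vector_mul_assoc A_def v_def N_def fib_transfer_double[OF k, symmetric]
    using sol by (rule transfer_matrix_solution)
  then have "trace A * (A *v v) $ i = (vector [u (Suc (N + N)), u (N + N)] :: complex^2) $ i + v $ i" for i
    using cayley_hamilton_2[of A v i] by (simp add: A_def)
  from this[of 1] this[of 2]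
  have *: "2 * (trace_seq (of_real lam) z k * u (Suc N)) = u (Suc (N + N)) + u (Suc 0)"
    "2 * (trace_seq (of_real lam) z k * u N) = u (N + N) + u 0"
    unfolding Av by (simp_all add: tr v_def mult.assoc)
  have half: "cmod (t * w) \<le> B" if "2 * (t * w) = a + b" "cmod a \<le> B" "cmod b \<le> B" for t w a b
  proof -
    have "2 * cmod (t * w) = cmod (a + b)" using that(1) by (metis norm_mult norm_numeral)
    then show ?thesis using norm_triangle_ineq[of a b] that by linarith
  qed
  show "cmod (trace_seq (of_real lam) z k) * cmod (u (fib k)) \<le> B"
    "cmod (trace_seq (of_real lam) z k) * cmod (u (Suc (fib k))) \<le> B"
    using half[OF *(2)] half[OF *(1)] bound by (simp_all add: norm_mult N_def)
qed

text \<open>A half-trace in \<open>[-1, 1]\<close> and determinant 1 give an eigenvalue \<mu> of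
  modulus 1, hence a solution that picks up only a phase over the block. The current
  \<open>W\<close> is then the same at both ends, yet it changes by \<open>Im z * |u|^2\<close> at
  each site; for nonreal \<open>z\<close> the solution must vanish, against the choice of an
  eigenvector.\<close>

lemma fib_trace_real_rooted:
  assumes c: "\<bar>c\<bar> \<le> 1" and tr: "trace_seq (of_real lam) z k = complex_of_real c" and k: "k \<ge> 2"
  shows "Im z = 0"
proof (rule ccontr)
  assume nz: "Im z \<noteq> 0"
  define N V where "N = fib k" and "V = (\<lambda>n. fib_potential lam (int n))"
  define A \<mu> where "A = transfer_matrix V z N" and "\<mu> = Complex c (sqrt (1 - c\<^sup>2))"
  have trA: "trace A = 2 * of_real c" 
    using trace_fib_transfer[of lam z "k - 2"] k tr by (simp add: A_def V_def N_def numeral_eq_Suc Suc_diff_Suc)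
  have detA: "det A = 1" by (simp add: A_def)
  have c2: "c\<^sup>2 \<le> 1" using c by (simp add: abs_square_le_1)
  then have \<mu>1: "cmod \<mu> = 1" by (simp add: \<mu>_def cmod_def)
  have \<mu>2: "\<mu> * \<mu> - 2 * of_real c * \<mu> + 1 = 0"
    using c2 by (simp add: \<mu>_def complex_eq_iff power2_eq_square algebra_simps)
  have "det (A - mat \<mu>) = \<mu> * \<mu> - trace A * \<mu> + det A"
    by (simp add: det_2 trace_2 mat_def algebra_simps)
  also have "\<dots> = 0" using \<mu>2 by (simp add: trA detA)
  finally have "\<not> invertible (A - mat \<mu>)" by (simp add: invertible_det_nz)
  then obtain v where v: "v \<noteq> 0" "(A - mat \<mu>) *v v = 0"
    by (metis invertible_left_inverse matrix_left_invertible_ker)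
  define u where "u n = (transfer_matrix V z n *v v) $ 2" for n
  have u1: "(transfer_matrix V z n *v v) $ 1 = u (Suc n)" for n
    unfolding u_def by (simp add: matrix_vector_2 flip: matrix_vector_mul_assoc)
  have rec: "u (Suc (Suc n)) = (z - of_real (V (Suc n))) * u (Suc n) - u n" for n
    unfolding u1[symmetric] by (simp add: matrix_vector_2[of "step_matrix _ _"] u1 u_def[symmetric] flip: matrix_vector_mul_assoc)
  have Av: "A *v v = \<mu> *s v"
    using v(2) by (simp add: vec_eq_iff forall_2 matrix_vector_2 mat_def algebra_simps)
  have uN: "u N = \<mu> * u 0" "u (Suc N) = \<mu> * u 1"
  proof -
    show "u N = \<mu> * u 0" using Av by (simp add: u_def A_def[symmetric])
    have "u (Suc N) = \<mu> * v $ 1" using Av by (simp add: u1[symmetric] A_def[symmetric])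
    moreover have "u 1 = v $ 1" using u1[of 0] by simp
    ultimately show "u (Suc N) = \<mu> * u 1" by simp
  qed
  define W where "W n = Im (cnj (u n) * u (Suc n))" for n
  have W: "W n = W 0 + Im z * (\<Sum>m<n. (cmod (u (Suc m)))\<^sup>2)" for n
  proof (induction n)
    case (Suc n)
    have "W (Suc n) = W n + Im z * (cmod (u (Suc n)))\<^sup>2"
      unfolding W_def rec cmod_power2 by (simp add: algebra_simps power2_eq_square)
    then show ?case using Suc by (simp add: algebra_simps)
  qed simp
  have "cnj (u N) * u (Suc N) = (\<mu> * cnj \<mu>) * (cnj (u 0) * u 1)" by (simp add: uN mult_ac)
  also have "\<mu> * cnj \<mu> = 1" using complex_norm_square[of \<mu>] \<mu>1 by simp
  finally have "W N = W 0" by (simp add: W_def)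
  then have "(\<Sum>m<N. (cmod (u (Suc m)))\<^sup>2) = 0" using W[of N] nz by simp
  then have z: "u (Suc m) = 0" if "m < N" for m
    using that by (simp add: sum_nonneg_eq_0_iff)
  have N: "N > 0" using k by (simp add: N_def fib_neq_0_nat)
  have "u 1 = 0" using z[of 0] N by simp
  moreover have "u 0 = 0" using z[of "N - 1"] N uN(1) \<mu>1 by auto
  ultimately have "v = 0" using u1[of 0] by (simp add: u_def vec_eq_iff forall_2)
  then show False using v by simp
qed

section \<open>Resolvents of bounded self-adjoint operators\<close>

lift_definition ell2_shift :: "int \<Rightarrow> ell2 \<Rightarrow> ell2" is "\<lambda>k f n. f (n + k)"
  by (rule square_summable_shift(1))

lift_definition ell2_restrict :: "int set \<Rightarrow> ell2 \<Rightarrow> ell2" is "\<lambda>A f n. (if n \<in> A then 1 else 0) * f n"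
  by (rule square_summable_mult[where B = 1]) auto

lemma norm_ell2_scaleC: "norm (ell2_scaleC c x) = cmod c * norm x"
proof (rule power2_eq_imp_eq)
  show "(norm (ell2_scaleC c x))\<^sup>2 = (cmod c * norm x)\<^sup>2"
    unfolding ell2_norm_square power_mult_distrib ell2_scaleC.rep_eq
    by (simp add: norm_mult power_mult_distrib infsum_cmult_right')
qed auto

lemma norm_ell2_delta [simp]: "norm (ell2_delta m) = 1"
proof -
  have "(norm (ell2_delta m))\<^sup>2 = (\<Sum>\<^sub>\<infinity>n. if n = m then 1 else 0)"
    unfolding ell2_norm_square ell2_delta.rep_eq by (intro infsum_cong) auto
  also have "\<dots> = (\<Sum>\<^sub>\<infinity>n\<in>{m}. 1)"
    by (rule infsum_cong_neutral) auto
  finally have "(norm (ell2_delta m))\<^sup>2 = 1\<^sup>2" by simp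
  then show ?thesis by (rule power2_eq_imp_eq) auto
qed

lemma ell2_cinner_delta: "ell2_cinner x (ell2_delta n) = ell2_coeff x n"
proof -
  have "ell2_cinner x (ell2_delta n) = (\<Sum>\<^sub>\<infinity>k\<in>{n}. ell2_coeff x k)"
    unfolding ell2_cinner_def ell2_delta.rep_eq by (rule infsum_cong_neutral) auto
  then show ?thesis by simp
qed

lemma ell2_cinner_scaleC_left: "ell2_cinner (ell2_scaleC c x) y = c * ell2_cinner x y"
  unfolding ell2_cinner_def ell2_scaleC.rep_eq by (simp add: mult.assoc infsum_cmult_right')

lemma ell2_cinner_diff_left: "ell2_cinner (x - y) z = ell2_cinner x z - ell2_cinner y z"
  using ell2_cinner_add_left[of "x - y" y z] by simp

lemma ell2_scaleC_simps:
  "ell2_scaleC c (x + y) = ell2_scaleC c x + ell2_scaleC c y"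
  "ell2_scaleC c (x - y) = ell2_scaleC c x - ell2_scaleC c y"
  "ell2_scaleC (c + d) x = ell2_scaleC c x + ell2_scaleC d x"
  "ell2_scaleC (c - d) x = ell2_scaleC c x - ell2_scaleC d x"
  "ell2_scaleC c (ell2_scaleC d x) = ell2_scaleC (c * d) x"
  "ell2_scaleC 1 x = x" "ell2_scaleC 0 x = 0" "ell2_scaleC c 0 = 0"
  by (transfer; simp add: algebra_simps)+

lemma ell2_scaleC_of_real: "ell2_scaleC (of_real r) x = r *\<^sub>R x"
  by transfer simp

lemma fib_hamiltonian_scaleC:
  "fib_hamiltonian lam (ell2_scaleC c x) = ell2_scaleC c (fib_hamiltonian lam x)"
  by (rule ell2_eqI) (simp add: fib_hamiltonian_coeff ell2_scaleC.rep_eq algebra_simps)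

lemma fib_hamiltonian_symmetric:
  "ell2_cinner (fib_hamiltonian lam x) y = ell2_cinner x (fib_hamiltonian lam y)"
proof -
  let ?x = "ell2_coeff x" and ?y = "ell2_coeff y" and ?V = "\<lambda>n. complex_of_real (fib_potential lam n)"
  have shift: "(\<Sum>\<^sub>\<infinity>n. f (n + k)) = (\<Sum>\<^sub>\<infinity>n. f n)" for f :: "int \<Rightarrow> complex" and k
    by (rule infsum_reindex_bij_betw) (rule bij_betwI[where g = "\<lambda>n. n - k"], auto)
  have sx: "(\<lambda>n. ?x (n + k) * cnj (?y n)) summable_on UNIV" for k
    using ell2_inner_summable[of "ell2_shift k x" y] by (simp add: ell2_shift.rep_eq)
  have sy: "(\<lambda>n. ?x n * cnj (?y (n + k))) summable_on UNIV" for k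
    using ell2_inner_summable[of x "ell2_shift k y"] by (simp add: ell2_shift.rep_eq)
  \<comment> \<open>\<open>V x\<close> is square summable because it equals \<open>H x\<close> minus
    the two shifts of \<open>x\<close>.\<close>
  have sV: "(\<lambda>n. ?V n * ?x n * cnj (?y n)) summable_on UNIV"
  proof -
    have "(\<lambda>n. ell2_coeff (fib_hamiltonian lam x - ell2_shift 1 x - ell2_shift (- 1) x) n * cnj (?y n))
        summable_on UNIV"
      by (rule ell2_inner_summable)
    then show ?thesis by (simp add: minus_ell2.rep_eq fib_hamiltonian_coeff ell2_shift.rep_eq)
  qed
  have "ell2_cinner (fib_hamiltonian lam x) y
      = (\<Sum>\<^sub>\<infinity>n. ?x (n + 1) * cnj (?y n) + ?x (n + - 1) * cnj (?y n) + ?V n * ?x n * cnj (?y n))"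
    unfolding ell2_cinner_def by (intro infsum_cong) (simp add: fib_hamiltonian_coeff algebra_simps)
  also have "\<dots> = (\<Sum>\<^sub>\<infinity>n. ?x (n + 1) * cnj (?y n)) + (\<Sum>\<^sub>\<infinity>n. ?x (n + - 1) * cnj (?y n))
      + (\<Sum>\<^sub>\<infinity>n. ?V n * ?x n * cnj (?y n))"
    by (simp only: infsum_add summable_on_add sx sV)
  also have "(\<Sum>\<^sub>\<infinity>n. ?x (n + 1) * cnj (?y n)) = (\<Sum>\<^sub>\<infinity>n. ?x n * cnj (?y (n + - 1)))"
    using shift[of "\<lambda>n. ?x n * cnj (?y (n + - 1))" 1] by simp
  also have "(\<Sum>\<^sub>\<infinity>n. ?x (n + - 1) * cnj (?y n)) = (\<Sum>\<^sub>\<infinity>n. ?x n * cnj (?y (n + 1)))"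
    using shift[of "\<lambda>n. ?x n * cnj (?y (n + 1))" "- 1"] by simp
  also have "(\<Sum>\<^sub>\<infinity>n. ?x n * cnj (?y (n + - 1))) + (\<Sum>\<^sub>\<infinity>n. ?x n * cnj (?y (n + 1)))
      + (\<Sum>\<^sub>\<infinity>n. ?V n * ?x n * cnj (?y n))
      = (\<Sum>\<^sub>\<infinity>n. ?x n * cnj (?y (n + - 1)) + ?x n * cnj (?y (n + 1)) + ?V n * ?x n * cnj (?y n))"
    by (simp only: infsum_add summable_on_add sy sV)
  also have "\<dots> = ell2_cinner x (fib_hamiltonian lam y)"
    unfolding ell2_cinner_def by (intro infsum_cong) (simp add: fib_hamiltonian_coeff algebra_simps)
  finally show ?thesis .
qed

text \<open>A small step along the residual is a contraction.\<close>

lemma coercive_surj: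
  fixes A :: "'a :: {real_inner, banach} \<Rightarrow>\<^sub>L 'a"
  assumes c: "c > 0" and coercive: "\<And>u. c * (norm u)\<^sup>2 \<le> inner (A u) u"
  shows "\<exists>u. A u = b"
proof -
  define M where "M = norm A + c"
  have M: "M > 0" "c \<le> M" using c by (auto simp: M_def add_nonneg_pos)
  \<comment> \<open>This \<open>s\<close> minimizes the contraction bound
    \<open>1 - 2 * s * c + s^2 * M^2\<close>; the summand \<open>c\<close> in \<open>M\<close>
    ensures \<open>c <= M\<close> and \<open>M > 0\<close>.\<close>
  define s where "s = c / M\<^sup>2"
  have s: "s > 0" using c M by (simp add: s_def)
  define q where "q = sqrt (1 - c\<^sup>2 / M\<^sup>2)"
  have cM: "c\<^sup>2 / M\<^sup>2 \<le> 1" using M c by (simp add: power_mono)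
  have q: "0 \<le> q" "q < 1" "q\<^sup>2 = 1 - c\<^sup>2 / M\<^sup>2"
    using cM c M by (auto simp: q_def)
  define \<phi> where "\<phi> u = u - s *\<^sub>R (A u - b)" for u
  have "dist (\<phi> u) (\<phi> v) \<le> q * dist u v" for u v
  proof -
    define w where "w = u - v"
    have "(norm (A w))\<^sup>2 \<le> (M * norm w)\<^sup>2"
      using norm_blinfun[of A w] c by (intro power_mono) (auto simp: M_def distrib_right intro: order_trans)
    then have Aw: "(norm (A w))\<^sup>2 \<le> M\<^sup>2 * (norm w)\<^sup>2" by (simp add: power_mult_distrib)
    have "(norm (w - s *\<^sub>R A w))\<^sup>2 = (norm w)\<^sup>2 - 2 * s * inner (A w) w + s\<^sup>2 * (norm (A w))\<^sup>2"
      unfolding power2_norm_eq_inner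
      by (simp add: inner_diff_left inner_diff_right inner_commute power2_eq_square algebra_simps)
    also have "\<dots> \<le> (norm w)\<^sup>2 - 2 * s * (c * (norm w)\<^sup>2) + s\<^sup>2 * (M\<^sup>2 * (norm w)\<^sup>2)"
      using coercive[of w] Aw s by (intro add_mono diff_mono mult_left_mono) auto
    also have "\<dots> = (1 - 2 * (s * c) + s\<^sup>2 * M\<^sup>2) * (norm w)\<^sup>2" by (simp add: algebra_simps)
    also have "\<dots> = q\<^sup>2 * (norm w)\<^sup>2"
    proof -
      have "s * c = c\<^sup>2 / M\<^sup>2" "s\<^sup>2 * M\<^sup>2 = c\<^sup>2 / M\<^sup>2"
        using M by (simp_all add: s_def power2_eq_square)
      then show ?thesis unfolding q(3) by simp
    qed
    finally have "(norm (w - s *\<^sub>R A w))\<^sup>2 \<le> (q * norm w)\<^sup>2"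
      by (simp add: power_mult_distrib)
    then have "norm (w - s *\<^sub>R A w) \<le> q * norm w"
      by (rule power2_le_imp_le) (simp add: q(1))
    then show ?thesis
      by (simp add: \<phi>_def w_def dist_norm blinfun.diff_right algebra_simps)
  qed
  then have "\<exists>!u. \<phi> u = u"
    using banach_fix_type[of q \<phi>] q by blast
  then obtain u where "\<phi> u = u" by auto
  then have "s *\<^sub>R (A u - b) = 0" by (simp add: \<phi>_def)
  then show ?thesis using s by auto
qed

lemma norm_funpow_blinfun_le:
  fixes H :: "'a::real_normed_vector \<Rightarrow>\<^sub>L 'a"
  shows "norm ((blinfun_apply H ^^ k) x) \<le> norm H ^ k * norm x"
proof (induction k)
  case (Suc k)
  have "norm ((blinfun_apply H ^^ Suc k) x) \<le> norm H * norm ((blinfun_apply H ^^ k) x)"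
    by (simp add: norm_blinfun)
  also have "\<dots> \<le> norm H * (norm H ^ k * norm x)" using Suc by (intro mult_left_mono) auto
  finally show ?case by (simp add: mult_ac)
qed simp

text \<open>Not the whole resolvent set, but the points reached by coercivity or by a contraction.
  The second alternative is there because the contours cross the real axis.\<close>

definition resolvent_dom :: "(ell2 \<Rightarrow>\<^sub>L ell2) \<Rightarrow> complex set" where
  "resolvent_dom H = {z. Im z \<noteq> 0 \<or> cmod z > norm H}"

definition resolvent :: "(ell2 \<Rightarrow>\<^sub>L ell2) \<Rightarrow> complex \<Rightarrow> ell2 \<Rightarrow> ell2" where
  "resolvent H z b = (THE u. H u - ell2_scaleC z u = b)"

lemma open_resolvent_dom: "open (resolvent_dom H)"
proof -
  have "resolvent_dom H = {z. Im z < 0} \<union> {z. Im z > 0} \<union> {z. norm H < cmod z}"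
    by (auto simp: resolvent_dom_def)
  moreover have "open {z. Im z < 0}" "open {z. Im z > 0}" "open {z. norm H < cmod z}"
    by (auto intro!: open_Collect_less continuous_intros)
  ultimately show ?thesis by (auto intro!: open_Un)
qed

lemma resolvent_lower_far:
  fixes H :: "ell2 \<Rightarrow>\<^sub>L ell2"
  shows "(cmod z - norm H) * norm u \<le> norm (H u - ell2_scaleC z u)"
proof -
  have "norm (ell2_scaleC z u) - norm (H u) \<le> norm (H u - ell2_scaleC z u)"
    using norm_triangle_ineq2[of "ell2_scaleC z u" "H u"] by (simp add: norm_minus_commute)
  then show ?thesis using norm_blinfun[of H u] by (simp add: norm_ell2_scaleC algebra_simps)
qed

context
  fixes H :: "ell2 \<Rightarrow>\<^sub>L ell2"
  assumes sym: "\<And>x y. ell2_cinner (H x) y = ell2_cinner x (H y)"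
    and lin: "\<And>c x. H (ell2_scaleC c x) = ell2_scaleC c (H x)"
begin

text \<open>\<open><H u, u>\<close> is real, so only the \<open>z\<close> term has an imaginary
  part, and the factor \<i> moves that part into the real inner product. Both solvability and the
  bound \<open>1 / |Im z|\<close> rest on this.\<close>

lemma resolvent_coercive:
  "inner (ell2_scaleC \<i> (H u - ell2_scaleC z u)) u = Im z * (norm u)\<^sup>2"
proof -
  have "cnj (ell2_cinner (H u) u) = ell2_cinner (H u) u"
    using sym[of u u] ell2_cinner_commute[of u "H u"] by simp
  then have "Im (ell2_cinner (H u) u) = 0" by (simp add: complex_eq_iff)
  then show ?thesis
    by (simp add: inner_ell2_def ell2_cinner_scaleC_left ell2_cinner_diff_left ell2_cinner_self
        ell2_norm_square)
qed

lemma resolvent_lower_near: "\<bar>Im z\<bar> * norm u \<le> norm (H u - ell2_scaleC z u)"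
proof (cases "u = 0")
  case False
  have "\<bar>Im z\<bar> * norm u * norm u = \<bar>inner (ell2_scaleC \<i> (H u - ell2_scaleC z u)) u\<bar>"
    by (simp add: resolvent_coercive abs_mult power2_eq_square)
  also have "\<dots> \<le> norm (ell2_scaleC \<i> (H u - ell2_scaleC z u)) * norm u"
    by (rule Cauchy_Schwarz_ineq2)
  also have "\<dots> = norm (H u - ell2_scaleC z u) * norm u" by (simp add: norm_ell2_scaleC)
  finally show ?thesis using False by simp
qed simp

lemma resolvent_surj:
  assumes "z \<in> resolvent_dom H"
  shows "\<exists>u. H u - ell2_scaleC z u = b"
proof (cases "Im z = 0")
  case False
  define \<sigma> where "\<sigma> = \<i> * of_real (sgn (Im z))"
  define A where "A = scaleC_blinfun \<sigma> o\<^sub>L (H - scaleC_blinfun z)"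
  have A: "A u = ell2_scaleC \<sigma> (H u - ell2_scaleC z u)" for u
    by (simp add: A_def blinfun.diff_left scaleC_blinfun.rep_eq)
  have "\<bar>Im z\<bar> * (norm u)\<^sup>2 \<le> inner (A u) u" for u
  proof -
    have "A u = sgn (Im z) *\<^sub>R ell2_scaleC \<i> (H u - ell2_scaleC z u)"
      by (simp add: A \<sigma>_def ell2_scaleC_simps(5)[symmetric] mult.commute[of \<i>] ell2_scaleC_of_real)
    then have "inner (A u) u = sgn (Im z) * (Im z * (norm u)\<^sup>2)"
      by (simp add: resolvent_coercive)
    then show ?thesis by (simp add: abs_sgn mult_ac)
  qed
  then obtain u where u: "A u = ell2_scaleC \<sigma> b"
    using coercive_surj[of "\<bar>Im z\<bar>" A] False by auto
  have "\<sigma> \<noteq> 0" using False by (simp add: \<sigma>_def sgn_eq_0_iff)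
  then have inv: "ell2_scaleC (1 / \<sigma>) (ell2_scaleC \<sigma> x) = x" for x
    by (simp add: ell2_scaleC_simps)
  have "H u - ell2_scaleC z u = ell2_scaleC (1 / \<sigma>) (A u)" by (simp only: A inv)
  then have "H u - ell2_scaleC z u = b" by (simp only: u inv)
  then show ?thesis by blast
next
  case True
  then have z: "cmod z > norm H" using assms by (simp add: resolvent_dom_def)
  then have z0: "z \<noteq> 0" using norm_ge_zero[of H] by auto
  define \<phi> where "\<phi> u = ell2_scaleC (1 / z) (H u - b)" for u
  have "dist (\<phi> u) (\<phi> v) \<le> norm H / cmod z * dist u v" for u v
  proof -
    have "\<phi> u - \<phi> v = ell2_scaleC (1 / z) (H (u - v))"
      by (simp add: \<phi>_def ell2_scaleC_simps(2)[symmetric] blinfun.diff_right)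
    then show ?thesis using norm_blinfun[of H "u - v"] z0
      by (simp add: dist_norm norm_ell2_scaleC norm_divide divide_right_mono)
  qed
  moreover have "0 \<le> norm H / cmod z" "norm H / cmod z < 1" using z z0 by auto
  ultimately have "\<exists>!u. \<phi> u = u"
    using banach_fix_type[of "norm H / cmod z" \<phi>] by blast
  then obtain u where "\<phi> u = u" by auto
  then have "ell2_scaleC z u = ell2_scaleC z (\<phi> u)" by simp
  also have "\<dots> = H u - b" using z0 by (simp add: \<phi>_def ell2_scaleC_simps(5,6))
  finally have "ell2_scaleC z u = H u - b" .
  then show ?thesis by (intro exI[of _ u]) simp
qed

lemma resolvent_lower:
  assumes "z \<in> resolvent_dom H"
  shows "\<exists>c>0. \<forall>u. c * norm u \<le> norm (H u - ell2_scaleC z u)"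
proof (cases "Im z = 0")
  case False
  then show ?thesis using resolvent_lower_near by (intro exI[of _ "\<bar>Im z\<bar>"]) simp
next
  case True
  then show ?thesis using resolvent_lower_far[of z H] assms
    by (intro exI[of _ "cmod z - norm H"]) (simp add: resolvent_dom_def)
qed

lemma resolvent_ex1:
  assumes "z \<in> resolvent_dom H"
  shows "\<exists>!u. H u - ell2_scaleC z u = b"
proof -
  obtain c where c: "c > 0" "\<And>u. c * norm u \<le> norm (H u - ell2_scaleC z u)"
    using resolvent_lower[OF assms] by blast
  have "u = v" if "H u - ell2_scaleC z u = b" "H v - ell2_scaleC z v = b" for u v
  proof -
    have "H (u - v) - ell2_scaleC z (u - v) = 0"
      using that by (simp add: blinfun.diff_right ell2_scaleC_simps algebra_simps)
    then have "c * norm (u - v) \<le> 0" using c(2)[of "u - v"] by simp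
    then show ?thesis using c(1) by (simp add: mult_le_0_iff)
  qed
  then show ?thesis using resolvent_surj[OF assms, of b] by blast
qed

lemma resolvent_eq:
  assumes "z \<in> resolvent_dom H"
  shows "H (resolvent H z b) - ell2_scaleC z (resolvent H z b) = b"
  unfolding resolvent_def by (rule theI'[OF resolvent_ex1[OF assms]])

lemma resolvent_unique:
  assumes "z \<in> resolvent_dom H" "H u - ell2_scaleC z u = b"
  shows "u = resolvent H z b"
  using resolvent_ex1[OF assms(1)] resolvent_eq[OF assms(1)] assms(2) by blast

text \<open>By the resolvent identity the difference quotient is the resolvent at \<open>z\<close>
  applied to \<open>g w\<close>. It remains to see that \<open>g\<close> is continuous at
  \<open>z\<close>, which follows from the lower bound \<open>c\<close>.\<close>

lemma resolvent_coeff_holomorphic: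
  "(\<lambda>z. ell2_coeff (resolvent H z b) n) holomorphic_on resolvent_dom H"
proof (rule holomorphic_onI)
  fix z assume z: "z \<in> resolvent_dom H"
  obtain c where c: "c > 0" "\<And>u. c * norm u \<le> norm (H u - ell2_scaleC z u)"
    using resolvent_lower[OF z] by blast
  define g where "g = (\<lambda>w. resolvent H w b)"
  define r where "r = resolvent H z"
  have r: "H (r x) - ell2_scaleC z (r x) = x" for x unfolding r_def by (rule resolvent_eq[OF z])
  have rnorm: "norm (r x) \<le> norm x / c" for x
    using c(2)[of "r x"] c(1) by (simp add: r field_simps)
  have rdiff: "r x - r y = r (x - y)" for x y
    unfolding r_def by (rule resolvent_unique[OF z])
      (use r[of x] r[of y] in \<open>simp add: r_def blinfun.diff_right ell2_scaleC_simps algebra_simps\<close>)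
  have gdiff: "g w - g z = ell2_scaleC (w - z) (r (g w))" if "w \<in> resolvent_dom H" for w
  proof -
    have gw: "H (g w) - ell2_scaleC w (g w) = b" unfolding g_def by (rule resolvent_eq[OF that])
    have gz: "H (g z) - ell2_scaleC z (g z) = b" unfolding g_def by (rule resolvent_eq[OF z])
    have "H (g w - g z) - ell2_scaleC z (g w - g z)
        = (H (g w) - ell2_scaleC w (g w)) + ell2_scaleC (w - z) (g w) - (H (g z) - ell2_scaleC z (g z))"
      by (simp add: blinfun.diff_right ell2_scaleC_simps algebra_simps)
    then have "H (g w - g z) - ell2_scaleC z (g w - g z) = ell2_scaleC (w - z) (g w)"
      by (simp add: gw gz)
    moreover have "H (ell2_scaleC (w - z) (r (g w))) - ell2_scaleC z (ell2_scaleC (w - z) (r (g w)))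
        = ell2_scaleC (w - z) (g w)"
    proof -
      have "H (ell2_scaleC (w - z) (r (g w))) - ell2_scaleC z (ell2_scaleC (w - z) (r (g w)))
        = ell2_scaleC (w - z) (H (r (g w)) - ell2_scaleC z (r (g w)))"
        by (simp only: lin ell2_scaleC_simps(2,5) mult.commute)
      then show ?thesis by (simp add: r)
    qed
    ultimately show ?thesis
      using resolvent_unique[OF z, of "g w - g z" "ell2_scaleC (w - z) (g w)"]
        resolvent_unique[OF z, of "ell2_scaleC (w - z) (r (g w))" "ell2_scaleC (w - z) (g w)"] by simp
  qed
  have gcont: "norm (g w - g z) \<le> 2 / c * norm (g z) * cmod (w - z)"
    if "w \<in> resolvent_dom H" "cmod (w - z) \<le> c / 2" for w
  proof -
    have "norm (g w - g z) \<le> cmod (w - z) * (norm (g w) / c)"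
      unfolding gdiff[OF that(1)] norm_ell2_scaleC by (intro mult_left_mono rnorm) auto
    also have "\<dots> \<le> cmod (w - z) * ((norm (g z) + norm (g w - g z)) / c)"
      using norm_triangle_ineq[of "g z" "g w - g z"] c(1)
      by (intro mult_left_mono divide_right_mono) auto
    also have "\<dots> = cmod (w - z) / c * norm (g z) + cmod (w - z) / c * norm (g w - g z)"
      by (simp add: add_divide_distrib distrib_left)
    also have "\<dots> \<le> cmod (w - z) / c * norm (g z) + 1 / 2 * norm (g w - g z)"
      using that(2) c(1) by (intro add_left_mono mult_right_mono) (auto simp: field_simps)
    finally have "norm (g w - g z) \<le> 2 * (cmod (w - z) / c * norm (g z))" by simp
    then show ?thesis by (simp add: mult_ac)
  qed
  have "((\<lambda>w. (ell2_coeff (g w) n - ell2_coeff (g z) n) / (w - z)) \<longlongrightarrow> ell2_coeff (r (g z)) n) (at z)"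
  proof (rule Lim_transform_bound[where g = "\<lambda>w. 2 / c\<^sup>2 * norm (g z) * cmod (w - z)", THEN LIM_zero_cancel])
    have "((\<lambda>w. 2 / c\<^sup>2 * norm (g z) * cmod (w - z)) \<longlongrightarrow> 2 / c\<^sup>2 * norm (g z) * cmod (z - z)) (at z)"
      by (intro tendsto_intros)
    then show "((\<lambda>w. 2 / c\<^sup>2 * norm (g z) * cmod (w - z)) \<longlongrightarrow> 0) (at z)" by simp
    have "eventually (\<lambda>w. w \<in> resolvent_dom H) (at z)"
      using open_resolvent_dom z by (rule eventually_at_in_open')
    moreover have "eventually (\<lambda>w. dist w z < c / 2) (at z)"
      unfolding eventually_at using c(1) by (intro exI[of _ "c / 2"]) auto
    moreover have "eventually (\<lambda>w. w \<noteq> z) (at z)" by (rule eventually_neq_at_within)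
    ultimately show "\<forall>\<^sub>F w in at z. norm ((ell2_coeff (g w) n - ell2_coeff (g z) n) / (w - z)
        - ell2_coeff (r (g z)) n) \<le> norm (2 / c\<^sup>2 * norm (g z) * cmod (w - z))"
    proof eventually_elim
      case (elim w)
      have "ell2_coeff (g w) n - ell2_coeff (g z) n = (w - z) * ell2_coeff (r (g w)) n"
        using arg_cong[OF gdiff[OF elim(1)], of "\<lambda>x. ell2_coeff x n"]
        by (simp add: minus_ell2.rep_eq ell2_scaleC.rep_eq)
      then have "(ell2_coeff (g w) n - ell2_coeff (g z) n) / (w - z) - ell2_coeff (r (g z)) n
          = ell2_coeff (r (g w - g z)) n"
        using elim(3) by (simp add: rdiff[symmetric] minus_ell2.rep_eq)
      also have "cmod \<dots> \<le> norm (g w - g z) / c"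
        using ell2_coeff_le_norm[of "r (g w - g z)" n] rnorm[of "g w - g z"] by linarith
      also have "\<dots> \<le> (2 / c * norm (g z) * cmod (w - z)) / c"
        using gcont[OF elim(1)] elim(2) c(1) by (intro divide_right_mono) (auto simp: dist_norm)
      finally show ?case using c(1) by (simp add: power2_eq_square)
    qed
  qed
  then have "((\<lambda>z. ell2_coeff (g z) n) has_field_derivative ell2_coeff (r (g z)) n) (at z)"
    by (simp add: has_field_derivative_iff)
  then show "(\<lambda>z. ell2_coeff (resolvent H z b) n) field_differentiable at z within resolvent_dom H"
    unfolding g_def field_differentiable_def using has_field_derivative_at_within by blast
qed

text \<open>The partial sum solves the equation up to the single term \<open>z^(-K) H^K b\<close>,
  so the lower bound for \<open>H - z\<close> controls the remainder. The plus sign occurs because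
  the inverse of \<open>H - z\<close> is minus the series.\<close>

lemma resolvent_neumann:
  assumes z: "cmod z > norm H"
  shows "cmod (ell2_coeff (resolvent H z b) n
      + (\<Sum>k<K. ell2_coeff ((blinfun_apply H ^^ k) b) n / z ^ Suc k))
    \<le> (norm H / cmod z) ^ K * norm b / (cmod z - norm H)"
proof -
  have z0: "z \<noteq> 0" using z norm_ge_zero[of H] by auto
  have dom: "z \<in> resolvent_dom H" using z by (simp add: resolvent_dom_def)
  define h where "h k = (blinfun_apply H ^^ k) b" for k
  define u where "u = (\<lambda>K. \<Sum>k<K. ell2_scaleC (1 / z ^ Suc k) (h k))"
  have u: "H (u K) - ell2_scaleC z (u K) = ell2_scaleC (1 / z ^ K) (h K) - b" for K
  proof (induction K)
    case 0
    show ?case by (simp add: u_def h_def ell2_scaleC_simps blinfun.zero_right)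
  next
    case (Suc K)
    have Hh: "H (h K) = h (Suc K)" by (simp add: h_def)
    have "u (Suc K) = u K + ell2_scaleC (1 / z ^ Suc K) (h K)" by (simp add: u_def)
    then have "H (u (Suc K)) - ell2_scaleC z (u (Suc K)) = (H (u K) - ell2_scaleC z (u K))
        + ell2_scaleC (1 / z ^ Suc K) (h (Suc K)) - ell2_scaleC (1 / z ^ K) (h K)"
      using z0 by (simp add: blinfun.add_right lin Hh ell2_scaleC_simps algebra_simps)
    then show ?case using Suc by simp
  qed
  have hn: "norm (h k) \<le> norm H ^ k * norm b" for k
    unfolding h_def by (rule norm_funpow_blinfun_le)
  define e where "e = resolvent H z b + u K"
  have "H e - ell2_scaleC z e = ell2_scaleC (1 / z ^ K) (h K)"
    using u[of K] resolvent_eq[OF dom, of b]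
    by (simp add: e_def blinfun.add_right ell2_scaleC_simps algebra_simps)
  then have "(cmod z - norm H) * norm e \<le> norm (ell2_scaleC (1 / z ^ K) (h K))"
    using resolvent_lower_far[of z H e] by simp
  also have "\<dots> \<le> 1 / cmod z ^ K * (norm H ^ K * norm b)"
    unfolding norm_ell2_scaleC using hn[of K]
    by (simp add: norm_divide norm_power divide_right_mono)
  also have "\<dots> = (norm H / cmod z) ^ K * norm b" by (simp add: power_divide)
  finally have "norm e \<le> (norm H / cmod z) ^ K * norm b / (cmod z - norm H)"
    using z by (subst pos_le_divide_eq) (simp_all add: mult.commute)
  moreover have coeffs: "ell2_coeff (u K) n = (\<Sum>k<K. ell2_coeff (h k) n / z ^ Suc k)" for K
  proof (induction K)
    case (Suc K)
    have "u (Suc K) = u K + ell2_scaleC (1 / z ^ Suc K) (h K)" by (simp add: u_def)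
    then show ?case using Suc by (simp add: plus_ell2.rep_eq ell2_scaleC.rep_eq)
  qed (simp add: u_def zero_ell2.rep_eq)
  ultimately show ?thesis
    using ell2_coeff_le_norm[of e n] by (simp add: e_def plus_ell2.rep_eq h_def)
qed

end

section \<open>Decay of the Green function and conservation of the norm\<close>

text \<open>Gordon's bound controls the values at the two sites where the block ends. Cutting the
  Green function off beyond that edge leaves a vector whose image under \<open>H - z\<close> lives
  on these two sites only, so its norm is at most \<tau> times the sum of the two values. Hence the
  bound holds at every site beyond the edge.\<close>

lemma green_function_le:
  fixes lam :: real and z :: complex
  defines "u \<equiv> ell2_coeff (resolvent (fib_hamiltonian lam) z (ell2_delta 1))" and "\<tau> \<equiv> 1 / \<bar>Im z\<bar>"
  assumes z: "Im z \<noteq> 0" and k: "k \<ge> 4" and n: "n > int (fib k) \<or> n < - 1 - int (fib k)"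
  shows "cmod (trace_seq (of_real lam) z k) * cmod (u n) \<le> 2 * \<tau> * (\<tau> + 1)"
proof -
  define H where "H = fib_hamiltonian lam"
  define U where "U = resolvent H z (ell2_delta 1)"
  define X where "X = cmod (trace_seq (of_real lam) z k)"
  define N where "N = int (fib k)"
  have N: "N \<ge> 1" using k fib_neq_0_nat[of k] by (simp add: N_def)
  have \<tau>: "\<tau> > 0" using z by (simp add: \<tau>_def)
  have dom: "z \<in> resolvent_dom H" using z by (simp add: resolvent_dom_def)
  have low: "norm w \<le> \<tau> * norm (H w - ell2_scaleC z w)" for w
    using resolvent_lower_near[of H z w] fib_hamiltonian_symmetric fib_hamiltonian_scaleC z
    by (simp add: H_def \<tau>_def field_simps)
  have Ueq: "H U - ell2_scaleC z U = ell2_delta 1"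
    unfolding U_def using fib_hamiltonian_symmetric fib_hamiltonian_scaleC dom
    by (intro resolvent_eq) (auto simp: H_def)
  have "norm U \<le> \<tau>" using low[of U] by (simp add: Ueq)
  then have ub: "cmod (u m) \<le> \<tau>" for m
    using ell2_coeff_le_norm[of U m] by (simp add: u_def U_def H_def)
  have ueq: "u (m + 1) + u (m - 1) + of_real (fib_potential lam m) * u m - z * u m = (if m = 1 then 1 else 0)" for m
    using arg_cong[OF Ueq, of "\<lambda>x. ell2_coeff x m"]
    by (simp add: minus_ell2.rep_eq ell2_scaleC.rep_eq ell2_delta.rep_eq H_def fib_hamiltonian_coeff u_def U_def)
  have edge: "X * cmod (u m) \<le> 2 * \<tau> * (\<tau> + 1)"
    if w: "\<And>j. ell2_coeff w j = (if j \<in> A then 1 else 0) * u j" and m: "m \<in> A"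
      and src: "H w - ell2_scaleC z w = ell2_scaleC a (ell2_delta p) + ell2_scaleC b (ell2_delta q)"
      and ab: "X * cmod a \<le> \<tau> + 1" "X * cmod b \<le> \<tau> + 1" for w A m a b p q
  proof -
    have "cmod (u m) \<le> norm w" using ell2_coeff_le_norm[of w m] w[of m] m by simp
    also have "\<dots> \<le> \<tau> * norm (H w - ell2_scaleC z w)" by (rule low)
    also have "\<dots> \<le> \<tau> * (cmod a + cmod b)"
      unfolding src using \<tau> norm_triangle_ineq[of "ell2_scaleC a (ell2_delta p)" "ell2_scaleC b (ell2_delta q)"]
      by (intro mult_left_mono) (auto simp: norm_ell2_scaleC)
    finally have "X * cmod (u m) \<le> X * (\<tau> * (cmod a + cmod b))"
      by (rule mult_left_mono) (simp add: X_def)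
    also have "\<dots> = \<tau> * (X * cmod a + X * cmod b)" by (simp add: algebra_simps)
    also have "\<dots> \<le> \<tau> * ((\<tau> + 1) + (\<tau> + 1))" using ab \<tau> by (intro mult_left_mono add_mono) auto
    finally show ?thesis by (simp add: algebra_simps)
  qed
  have "X * cmod (u n) \<le> 2 * \<tau> * (\<tau> + 1)"
  proof (cases "n > N")
    case True
    \<comment> \<open>The source sits at site 1. Lowering the value at site 0 by 1 absorbs it, so
      that \<open>v\<close> solves the homogeneous equation from site 1 on.\<close>
    define v where "v m = (if m = 0 then u 0 - 1 else u (int m))" for m
    have vb: "cmod (v m) \<le> \<tau> + 1" for m
    proof -
      have "cmod (u 0 - 1) \<le> \<tau> + 1" using norm_triangle_ineq4[of "u 0" 1] ub[of 0] by simp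
      then show ?thesis using ub[of "int m"] by (auto simp: v_def)
    qed
    have veq: "v (Suc m) + v (m - 1) + of_real (fib_potential lam (int m)) * v m = z * v m" if "m \<ge> 1" for m
      using ueq[of "int m"] that by (auto simp: v_def of_nat_diff algebra_simps)
    have edges: "X * cmod (u N) \<le> \<tau> + 1" "X * cmod (u (N + 1)) \<le> \<tau> + 1"
      using fib_solution_le[OF k vb veq] N by (auto simp: v_def X_def N_def add.commute)
    define w where "w = ell2_restrict {N<..} U"
    have w: "ell2_coeff w j = (if j \<in> {N<..} then 1 else 0) * u j" for j
      by (simp add: w_def ell2_restrict.rep_eq u_def U_def H_def)
    have src: "H w - ell2_scaleC z w
        = ell2_scaleC (- u N) (ell2_delta (N + 1)) + ell2_scaleC (u (N + 1)) (ell2_delta N)"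
    proof (rule ell2_eqI)
      fix j
      consider "j < N" | "j = N" | "j = N + 1" | "j > N + 1" by linarith
      then show "ell2_coeff (H w - ell2_scaleC z w) j
          = ell2_coeff (ell2_scaleC (- u N) (ell2_delta (N + 1)) + ell2_scaleC (u (N + 1)) (ell2_delta N)) j"
        using ueq[of j] N
        by cases (auto simp: minus_ell2.rep_eq plus_ell2.rep_eq ell2_scaleC.rep_eq ell2_delta.rep_eq
            H_def fib_hamiltonian_coeff w algebra_simps)
    qed
    show ?thesis by (rule edge[where A = "{N<..}", OF w _ src]) (use True edges in auto)
  next
    case False
    then have n': "n < - 1 - N" using n by (simp add: N_def)
    \<comment> \<open>Reflection takes the sites \<open>m >= 1\<close> to sites at most -2, away
      from the source and with the same potential.\<close>
    define v where "v m = u (- 1 - int m)" for m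
    have vb: "cmod (v m) \<le> \<tau> + 1" for m using ub[of "- 1 - int m"] by (simp add: v_def)
    have veq: "v (Suc m) + v (m - 1) + of_real (fib_potential lam (int m)) * v m = z * v m" if "m \<ge> 1" for m
    proof -
      have "- 1 - int (Suc m) = (- 1 - int m) - 1" "- 1 - int (m - 1) = (- 1 - int m) + 1"
        using that by (auto simp: of_nat_diff)
      then show ?thesis
        using ueq[of "- 1 - int m"] that fib_potential_reflect[of "int m" lam]
        by (simp add: v_def algebra_simps)
    qed
    have edges: "X * cmod (u (- 1 - N)) \<le> \<tau> + 1" "X * cmod (u (- 2 - N)) \<le> \<tau> + 1"
      using fib_solution_le[OF k vb veq] N by (auto simp: v_def X_def N_def)
    define w where "w = ell2_restrict {..<- 1 - N} U"
    have w: "ell2_coeff w j = (if j \<in> {..<- 1 - N} then 1 else 0) * u j" for j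
      by (simp add: w_def ell2_restrict.rep_eq u_def U_def H_def)
    have src: "H w - ell2_scaleC z w
        = ell2_scaleC (- u (- 1 - N)) (ell2_delta (- 2 - N)) + ell2_scaleC (u (- 2 - N)) (ell2_delta (- 1 - N))"
    proof (rule ell2_eqI)
      fix j
      consider "j < - 2 - N" | "j = - 2 - N" | "j = - 1 - N" | "j > - 1 - N" by linarith
      then show "ell2_coeff (H w - ell2_scaleC z w) j
          = ell2_coeff (ell2_scaleC (- u (- 1 - N)) (ell2_delta (- 2 - N)) + ell2_scaleC (u (- 2 - N)) (ell2_delta (- 1 - N))) j"
      proof cases
        case 2
        show ?thesis unfolding 2 using ueq[of "- 2 - N"] N
          by (simp add: minus_ell2.rep_eq plus_ell2.rep_eq ell2_scaleC.rep_eq ell2_delta.rep_eq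
            H_def fib_hamiltonian_coeff w algebra_simps)
      next
        case 3
        have "u (- N - 2) = u (- 2 - N)" by (rule arg_cong) simp
        then show ?thesis unfolding 3 using N
          by (simp add: minus_ell2.rep_eq plus_ell2.rep_eq ell2_scaleC.rep_eq ell2_delta.rep_eq
            H_def fib_hamiltonian_coeff w algebra_simps)
      qed (use ueq[of j] N in \<open>auto simp: minus_ell2.rep_eq plus_ell2.rep_eq ell2_scaleC.rep_eq
        ell2_delta.rep_eq H_def fib_hamiltonian_coeff w algebra_simps\<close>)
    qed
    show ?thesis by (rule edge[where A = "{..<- 1 - N}", OF w _ src]) (use n' edges in auto)
  qed
  then show ?thesis by (simp add: X_def)
qed

section \<open>The exponential series of the evolution\<close>

lemma bounded_linear_ell2_coeff: "bounded_linear (\<lambda>x. ell2_coeff x n)"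
  by (rule bounded_linear_intro[where K = 1])
    (auto simp: plus_ell2.rep_eq scaleR_ell2.rep_eq scaleR_conv_of_real ell2_coeff_le_norm)

lemma blinfun_exp_sums:
  fixes A :: "'a::banach \<Rightarrow>\<^sub>L 'a"
  shows "(\<lambda>k. (1 / fact k) *\<^sub>R (blinfun_apply A ^^ k) x) sums blinfun_exp A x"
proof -
  have "(\<lambda>k. (1 / fact k) *\<^sub>R ((\<lambda>B. A o\<^sub>L B) ^^ k) id_blinfun) sums blinfun_exp A"
    unfolding blinfun_exp_def by (intro summable_sums summable_blinfun_exp)
  then have "(\<lambda>k. blinfun_apply ((1 / fact k) *\<^sub>R ((\<lambda>B. A o\<^sub>L B) ^^ k) id_blinfun) x) sums blinfun_exp A x"
    by (rule bounded_linear.sums[OF blinfun.bounded_linear_left])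
  moreover have "blinfun_apply (((\<lambda>B. A o\<^sub>L B) ^^ k) id_blinfun) x = (blinfun_apply A ^^ k) x" for k
    by (induction k) auto
  ultimately show ?thesis by (simp add: blinfun.scaleR_left)
qed

context
  fixes H :: "ell2 \<Rightarrow>\<^sub>L ell2"
  assumes sym: "\<And>x y. ell2_cinner (H x) y = ell2_cinner x (H y)"
    and lin: "\<And>c x. H (ell2_scaleC c x) = ell2_scaleC c (H x)"
begin

lemma evolution_coeff_sums:
  "(\<lambda>k. (- \<i> * of_real t) ^ k / fact k * ell2_coeff ((blinfun_apply H ^^ k) x) n)
    sums ell2_coeff (evolution H t x) n"
proof -
  define c where "c = - \<i> * complex_of_real t"
  have "(blinfun_apply (scaleC_blinfun c o\<^sub>L H) ^^ k) x = ell2_scaleC (c ^ k) ((blinfun_apply H ^^ k) x)" for k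
    by (induction k) (simp_all add: ell2_scaleC_simps scaleC_blinfun.rep_eq lin mult.commute)
  then have "(\<lambda>k. (1 / fact k) *\<^sub>R ell2_scaleC (c ^ k) ((blinfun_apply H ^^ k) x)) sums evolution H t x"
    using blinfun_exp_sums[of "scaleC_blinfun c o\<^sub>L H" x] by (simp add: evolution_def c_def)
  from bounded_linear.sums[OF bounded_linear_ell2_coeff this, of n] show ?thesis
    by (simp add: scaleR_ell2.rep_eq ell2_scaleC.rep_eq c_def mult_ac)
qed

text \<open>The partial sums of the exponential series solve the evolution equation up to their last
  term, which tends to 0; the equation itself conserves the norm.\<close>

lemma norm_evolution: "norm (evolution H t x) = norm x"
proof -
  define B where "B = scaleC_blinfun (- \<i>) o\<^sub>L H"
  have B: "B u = ell2_scaleC (- \<i>) (H u)" for u by (simp add: B_def scaleC_blinfun.rep_eq)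
  have skew: "inner (B u) u = 0" for u
  proof -
    have "cnj (ell2_cinner (H u) u) = ell2_cinner (H u) u"
      using sym[of u u] ell2_cinner_commute[of u "H u"] by simp
    then have "Im (ell2_cinner (H u) u) = 0" by (simp add: complex_eq_iff)
    then show ?thesis by (simp add: inner_ell2_def B ell2_cinner_scaleC_left)
  qed
  define b where "b k = (blinfun_apply B ^^ k) x" for k
  define S where "S m t = (\<Sum>k<m. (t ^ k / fact k) *\<^sub>R b k)" for m and t :: real
  define h where "h = norm B"
  have bn: "norm (b k) \<le> h ^ k * norm x" for k
    unfolding b_def h_def by (rule norm_funpow_blinfun_le)
  have lim: "(\<lambda>m. S m t) \<longlonglongrightarrow> evolution H t x" for t
  proof -
    have "(blinfun_apply (scaleC_blinfun (- \<i> * of_real t) o\<^sub>L H) ^^ k) x = t ^ k *\<^sub>R b k" for k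
    proof (induction k)
      case (Suc k)
      have "ell2_scaleC (- \<i> * of_real t) y = t *\<^sub>R ell2_scaleC (- \<i>) y" for y
        by (simp add: ell2_scaleC_simps(5) mult.commute flip: ell2_scaleC_of_real)
      moreover have "ell2_scaleC (- \<i>) (r *\<^sub>R y) = r *\<^sub>R ell2_scaleC (- \<i>) y" for r y
        by transfer (simp add: fun_eq_iff)
      ultimately show ?case using Suc by (simp add: b_def B blinfun.scaleR_right scaleC_blinfun.rep_eq)
    qed (simp add: b_def)
    then show ?thesis
      using blinfun_exp_sums[of "scaleC_blinfun (- \<i> * of_real t) o\<^sub>L H" x]
      by (simp add: evolution_def S_def sums_def)
  qed
  have dS: "(S (Suc m) has_vector_derivative B (S m t)) (at t)" for m t
  proof (induction m)
    case 0
    show ?case by (simp add: S_def blinfun.zero_right)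
  next
    case (Suc m)
    have eq: "S (Suc (Suc m)) = (\<lambda>t. S (Suc m) t + (t ^ Suc m / fact (Suc m)) *\<^sub>R b (Suc m))"
      by (simp add: S_def fun_eq_iff)
    have "((\<lambda>t::real. t ^ Suc m / fact (Suc m)) has_real_derivative t ^ m / fact m) (at t)"
      by (auto intro!: derivative_eq_intros simp: divide_simps) (cases m; simp add: algebra_simps)
    then have "((\<lambda>t. (t ^ Suc m / fact (Suc m)) *\<^sub>R b (Suc m)) has_vector_derivative
        (t ^ m / fact m) *\<^sub>R b (Suc m)) (at t)"
      using has_vector_derivative_scaleR[OF _ has_vector_derivative_const[of "b (Suc m)"]] by fastforce
    from has_vector_derivative_add[OF Suc this] show ?case
      unfolding eq by (simp add: S_def blinfun.add_right blinfun.scaleR_right b_def)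
  qed
  have Sn: "norm (S m s) \<le> exp (\<bar>s\<bar> * h) * norm x" for m s
  proof -
    have "norm (S m s) \<le> (\<Sum>k<m. (\<bar>s\<bar> * h) ^ k / fact k * norm x)"
      unfolding S_def
    proof (rule sum_norm_le)
      fix k
      have "norm ((s ^ k / fact k) *\<^sub>R b k) \<le> \<bar>s\<bar> ^ k / fact k * (h ^ k * norm x)"
        using bn[of k] by (simp add: power_abs mult_left_mono divide_right_mono)
      then show "norm ((s ^ k / fact k) *\<^sub>R b k) \<le> (\<bar>s\<bar> * h) ^ k / fact k * norm x"
        by (simp add: power_mult_distrib mult_ac)
    qed
    also have "\<dots> = (\<Sum>k<m. (\<bar>s\<bar> * h) ^ k /\<^sub>R fact k) * norm x"
      by (simp add: sum_distrib_left sum_distrib_right divide_inverse mult_ac)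
    also have "\<dots> \<le> exp (\<bar>s\<bar> * h) * norm x"
      unfolding exp_def
      by (intro mult_right_mono sum_le_suminf summable_exp_generic) (auto simp: h_def)
    finally show ?thesis .
  qed
  define K where "K m = 2 * (exp (\<bar>t\<bar> * h) * norm x) * ((\<bar>t\<bar> * h) ^ m / fact m * norm x) * h" for m
  have step: "\<bar>(norm (S (Suc m) t))\<^sup>2 - (norm x)\<^sup>2\<bar> \<le> K m * \<bar>t\<bar>" for m
  proof -
    have der: "((\<lambda>s. (norm (S (Suc m) s))\<^sup>2) has_real_derivative 2 * inner (B (S m s)) (S (Suc m) s)) (at s)" for s
    proof -
      have "((\<lambda>s. inner (S (Suc m) s) (S (Suc m) s)) has_vector_derivative
         inner (S (Suc m) s) (B (S m s)) + inner (B (S m s)) (S (Suc m) s)) (at s)"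
        by (rule bounded_bilinear.has_vector_derivative[OF bounded_bilinear_inner dS dS])
      then show ?thesis
        by (simp add: power2_norm_eq_inner inner_commute has_real_derivative_iff_has_vector_derivative)
    qed
    have bd: "\<bar>2 * inner (B (S m s)) (S (Suc m) s)\<bar> \<le> K m" if "\<bar>s\<bar> \<le> \<bar>t\<bar>" for s
    proof -
      have "S m s = S (Suc m) s - (s ^ m / fact m) *\<^sub>R b m" by (simp add: S_def)
      then have "inner (B (S m s)) (S (Suc m) s) = - inner (B ((s ^ m / fact m) *\<^sub>R b m)) (S (Suc m) s)"
        by (simp add: blinfun.diff_right inner_diff_left skew)
      also have "\<bar>\<dots>\<bar> \<le> norm (B ((s ^ m / fact m) *\<^sub>R b m)) * norm (S (Suc m) s)"
        using Cauchy_Schwarz_ineq2 by simp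
      also have "\<dots> \<le> (h * ((\<bar>t\<bar> * h) ^ m / fact m * norm x)) * (exp (\<bar>t\<bar> * h) * norm x)"
      proof (rule mult_mono)
        have "norm ((s ^ m / fact m) *\<^sub>R b m) \<le> \<bar>t\<bar> ^ m / fact m * (h ^ m * norm x)"
          unfolding norm_scaleR using that
          by (intro mult_mono bn) (auto simp: power_abs divide_right_mono power_mono)
        then have "norm ((s ^ m / fact m) *\<^sub>R b m) \<le> (\<bar>t\<bar> * h) ^ m / fact m * norm x"
          by (simp add: power_mult_distrib mult_ac)
        then have "h * norm ((s ^ m / fact m) *\<^sub>R b m) \<le> h * ((\<bar>t\<bar> * h) ^ m / fact m * norm x)"
          by (rule mult_left_mono) (simp add: h_def)
        then show "norm (B ((s ^ m / fact m) *\<^sub>R b m)) \<le> h * ((\<bar>t\<bar> * h) ^ m / fact m * norm x)"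
          unfolding h_def using norm_blinfun[of B "(s ^ m / fact m) *\<^sub>R b m"] by linarith
        have "exp (\<bar>s\<bar> * h) * norm x \<le> exp (\<bar>t\<bar> * h) * norm x"
          using that by (intro mult_right_mono) (auto simp: h_def mult_right_mono)
        then show "norm (S (Suc m) s) \<le> exp (\<bar>t\<bar> * h) * norm x" using Sn[of "Suc m" s] by linarith
      qed (auto simp: h_def)
      finally have le: "\<bar>inner (B (S m s)) (S (Suc m) s)\<bar> \<le> h * ((\<bar>t\<bar> * h) ^ m / fact m * norm x) * (exp (\<bar>t\<bar> * h) * norm x)" .
      have "K m = 2 * (h * ((\<bar>t\<bar> * h) ^ m / fact m * norm x) * (exp (\<bar>t\<bar> * h) * norm x))"
        by (simp add: K_def)
      then show ?thesis using le by (simp only: abs_mult)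
    qed
    have "norm ((norm (S (Suc m) t))\<^sup>2 - (norm (S (Suc m) 0))\<^sup>2) \<le> K m * norm (t - 0)"
    proof (rule field_differentiable_bound[where S = "{- \<bar>t\<bar>..\<bar>t\<bar>}"])
      show "((\<lambda>s. (norm (S (Suc m) s))\<^sup>2) has_field_derivative 2 * inner (B (S m s)) (S (Suc m) s))
          (at s within {- \<bar>t\<bar>..\<bar>t\<bar>})" for s
        by (rule DERIV_subset[OF der]) simp
    qed (use bd in \<open>auto simp: abs_le_iff\<close>)
    moreover have "S (Suc m) 0 = x"
    proof -
      have "S (Suc m) 0 = (\<Sum>k<Suc m. if k = 0 then x else 0)"
        unfolding S_def by (intro sum.cong) (auto simp: b_def)
      then show ?thesis by (simp add: sum.delta)
    qed
    ultimately show ?thesis by simp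
  qed
  have "(\<lambda>m. (norm (S (Suc m) t))\<^sup>2 - (norm x)\<^sup>2) \<longlonglongrightarrow> 0"
  proof (rule Lim_null_comparison)
    show "eventually (\<lambda>m. norm ((norm (S (Suc m) t))\<^sup>2 - (norm x)\<^sup>2) \<le> K m * \<bar>t\<bar>) sequentially"
      using step by simp
    have "(\<lambda>m. (\<bar>t\<bar> * h) ^ m / fact m) \<longlonglongrightarrow> 0"
      using summable_LIMSEQ_zero[OF summable_exp[of "\<bar>t\<bar> * h"]] by (simp add: field_simps)
    then have "(\<lambda>m. 2 * (exp (\<bar>t\<bar> * h) * norm x) * ((\<bar>t\<bar> * h) ^ m / fact m * norm x) * h * \<bar>t\<bar>)
      \<longlonglongrightarrow> 2 * (exp (\<bar>t\<bar> * h) * norm x) * (0 * norm x) * h * \<bar>t\<bar>"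
      by (intro tendsto_intros)
    then show "(\<lambda>m. K m * \<bar>t\<bar>) \<longlonglongrightarrow> 0" by (simp add: K_def)
  qed
  moreover have "(\<lambda>m. (norm (S (Suc m) t))\<^sup>2 - (norm x)\<^sup>2) \<longlonglongrightarrow> (norm (evolution H t x))\<^sup>2 - (norm x)\<^sup>2"
    by (intro tendsto_intros LIMSEQ_Suc[OF lim])
  ultimately have "(norm (evolution H t x))\<^sup>2 - (norm x)\<^sup>2 = 0" by (rule LIMSEQ_unique[rotated])
  then show ?thesis by simp
qed

end

section \<open>The evolution as a contour integral of the resolvent\<close>

definition ellipse :: "real \<Rightarrow> real \<Rightarrow> real \<Rightarrow> complex" where
  "ellipse R \<eta> s = of_real (R * cos (2 * pi * s)) + \<i> * of_real (\<eta> * sin (2 * pi * s))"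

lemma ellipse_simps [simp]:
  "Re (ellipse R \<eta> s) = R * cos (2 * pi * s)" "Im (ellipse R \<eta> s) = \<eta> * sin (2 * pi * s)"
  by (simp_all add: ellipse_def)

lemma circlepath_eq_ellipse: "circlepath 0 R = ellipse R R"
  by (rule ext, rule complex_eqI)
    (simp_all add: circlepath ellipse_def Re_exp Im_exp)

lemma ellipse_has_vector_derivative:
  "(ellipse R \<eta> has_vector_derivative
     of_real (- (2 * pi * R * sin (2 * pi * s))) + \<i> * of_real (2 * pi * \<eta> * cos (2 * pi * s))) (at s)"
proof -
  have "((\<lambda>s. R * cos (2 * pi * s)) has_real_derivative - (2 * pi * R * sin (2 * pi * s))) (at s)"
    "((\<lambda>s. \<eta> * sin (2 * pi * s)) has_real_derivative 2 * pi * \<eta> * cos (2 * pi * s)) (at s)"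
    by (auto intro!: derivative_eq_intros)
  note 1 = has_vector_derivative_of_real[OF this(1)] and 2 = has_vector_derivative_of_real[OF this(2)]
  have "((\<lambda>s. of_real (R * cos (2 * pi * s)) + \<i> * of_real (\<eta> * sin (2 * pi * s))) has_vector_derivative
     of_real (- (2 * pi * R * sin (2 * pi * s))) + \<i> * of_real (2 * pi * \<eta> * cos (2 * pi * s))) (at s)"
    by (intro has_vector_derivative_add has_vector_derivative_mult_right 1 2)
  then show ?thesis by (simp add: ellipse_def[abs_def])
qed

lemma valid_path_ellipse: "valid_path (ellipse R \<eta>)"
proof -
  have "ellipse R \<eta> C1_differentiable_on {0..1}"
    unfolding C1_differentiable_on_def
    by (intro exI conjI ballI, rule ellipse_has_vector_derivative) (intro continuous_intros)
  then show ?thesis by (simp add: valid_path_def C1_differentiable_imp_piecewise)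
qed

lemma norm_ellipse_derivative_le:
  assumes "0 \<le> \<eta>" "\<eta> \<le> R"
  shows "cmod (vector_derivative (ellipse R \<eta>) (at s)) \<le> 2 * pi * R"
proof (rule power2_le_imp_le)
  let ?c = "cos (2 * pi * s)" and ?s = "sin (2 * pi * s)"
  have "vector_derivative (ellipse R \<eta>) (at s) = Complex (- (2 * pi * R * ?s)) (2 * pi * \<eta> * ?c)"
    by (simp add: vector_derivative_at[OF ellipse_has_vector_derivative] complex_eq_iff)
  then have "(cmod (vector_derivative (ellipse R \<eta>) (at s)))\<^sup>2 = (2 * pi)\<^sup>2 * (R\<^sup>2 * ?s\<^sup>2 + \<eta>\<^sup>2 * ?c\<^sup>2)"
    by (simp add: cmod_power2 power_mult_distrib algebra_simps)
  also have "\<dots> \<le> (2 * pi)\<^sup>2 * (R\<^sup>2 * ?s\<^sup>2 + R\<^sup>2 * ?c\<^sup>2)"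
    using assms by (intro mult_left_mono add_left_mono mult_right_mono power_mono) auto
  also have "\<dots> = (2 * pi * R)\<^sup>2"
    by (simp add: power_mult_distrib distrib_left[symmetric])
  finally show "(cmod (vector_derivative (ellipse R \<eta>) (at s)))\<^sup>2 \<le> (2 * pi * R)\<^sup>2" .
qed (use assms in simp)

lemma contour_integral_ellipse_le:
  assumes "0 \<le> \<eta>" "\<eta> \<le> R" and F: "F contour_integrable_on ellipse R \<eta>"
    and B: "\<And>s. cmod (F (ellipse R \<eta> s)) \<le> B"
  shows "cmod (contour_integral (ellipse R \<eta>) F) \<le> B * (2 * pi * R)"
proof -
  have B0: "0 \<le> B" using B[of 0] norm_ge_zero order_trans by blast
  have "((\<lambda>s. F (ellipse R \<eta> s) * vector_derivative (ellipse R \<eta>) (at s)) has_integral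
      contour_integral (ellipse R \<eta>) F) (cbox 0 1)"
    using has_contour_integral_integral[OF F] unfolding has_contour_integral by simp
  then have "cmod (contour_integral (ellipse R \<eta>) F) \<le> B * (2 * pi * R) * measure lborel (cbox 0 (1::real))"
  proof (rule has_integral_bound[rotated])
    show "cmod (F (ellipse R \<eta> s) * vector_derivative (ellipse R \<eta>) (at s)) \<le> B * (2 * pi * R)" for s
      unfolding norm_mult using B0 assms by (intro mult_mono B norm_ellipse_derivative_le) auto
  qed (use B0 assms in auto)
  then show ?thesis by simp
qed

text \<open>The straight-line homotopy only rescales imaginary parts, so it meets the real axis at
  \<open>R\<close> and \<open>- R\<close> alone, outside the norm disc.\<close>

lemma homotopic_loops_ellipse:
  assumes R: "norm H < R" and \<eta>: "0 < \<eta>"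
  shows "homotopic_loops (resolvent_dom H) (ellipse R R) (ellipse R \<eta>)"
proof (rule homotopic_loops_linear)
  have R0: "R > 0" using R norm_ge_zero[of H] by linarith
  show "closed_segment (ellipse R R s) (ellipse R \<eta> s) \<subseteq> resolvent_dom H" for s
  proof
    fix w assume "w \<in> closed_segment (ellipse R R s) (ellipse R \<eta> s)"
    then obtain u where u: "0 \<le> u" "u \<le> 1" "w = (1 - u) *\<^sub>R ellipse R R s + u *\<^sub>R ellipse R \<eta> s"
      by (auto simp: in_segment)
    have re: "Re w = R * cos (2 * pi * s)" by (simp add: u algebra_simps)
    have im: "Im w = ((1 - u) * R + u * \<eta>) * sin (2 * pi * s)" by (simp add: u algebra_simps)
    have pos: "(1 - u) * R + u * \<eta> > 0"
    proof (cases "u = 0")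
      case False
      then have "u * \<eta> > 0" using u \<eta> by simp
      moreover have "(1 - u) * R \<ge> 0" using u R0 by simp
      ultimately show ?thesis by linarith
    qed (use R0 in simp)
    show "w \<in> resolvent_dom H"
    proof (cases "sin (2 * pi * s) = 0")
      case True
      then have "\<bar>cos (2 * pi * s)\<bar> = 1" using sin_zero_abs_cos_one by blast
      then have "\<bar>Re w\<bar> = R" using R0 by (simp add: re abs_mult)
      then show ?thesis using abs_Re_le_cmod[of w] R by (simp add: resolvent_dom_def)
    next
      case False
      then show ?thesis using pos by (simp add: resolvent_dom_def im)
    qed
  qed
qed (auto simp: valid_path_imp_path valid_path_ellipse pathfinish_def pathstart_def ellipse_def)

lemma higher_deriv_exp_linear:
  "(deriv ^^ k) (\<lambda>z. exp (a * z)) = (\<lambda>z. a ^ k * exp (a * z :: complex))"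
proof (induction k)
  case (Suc k)
  have "deriv (\<lambda>z. a ^ k * exp (a * z)) z = a ^ Suc k * exp (a * z)" for z
    by (rule DERIV_imp_deriv) (auto intro!: derivative_eq_intros)
  then show ?case by (simp add: Suc)
qed simp

context
  fixes H :: "ell2 \<Rightarrow>\<^sub>L ell2"
  assumes sym: "\<And>x y. ell2_cinner (H x) y = ell2_cinner x (H y)"
    and lin: "\<And>c x. H (ell2_scaleC c x) = ell2_scaleC c (H x)"
begin

text \<open>On the circle the Neumann series is integrated term by term: Cauchy's formula turns
  \<open>z^(-k-1)\<close> into the Taylor coefficient \<open>a^k / k!\<close>, which rebuilds the
  exponential series, while the remainder decays geometrically. Homotopy then moves the integral to
  the ellipse.\<close>

lemma evolution_coeff_contour_integral:
  fixes t :: real and x :: ell2 and n :: int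
  assumes R: "norm H < R" and \<eta>: "0 < \<eta>"
  defines "F \<equiv> \<lambda>z. exp (- \<i> * of_real t * z) * ell2_coeff (resolvent H z x) n"
  shows "F holomorphic_on resolvent_dom H"
    and "contour_integral (ellipse R \<eta>) F = - (2 * of_real pi * \<i>) * ell2_coeff (evolution H t x) n"
proof -
  define a c where "a = - \<i> * complex_of_real t" and "c = (\<lambda>k. ell2_coeff ((blinfun_apply H ^^ k) x) n)"
  have R0: "R > 0" using R norm_ge_zero[of H] by linarith
  show hol: "F holomorphic_on resolvent_dom H"
    unfolding F_def using resolvent_coeff_holomorphic[OF sym lin] by (intro holomorphic_intros) auto
  have sub: "path_image (circlepath 0 R) \<subseteq> resolvent_dom H"
    using R R0 by (auto simp: resolvent_dom_def path_image_circlepath)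
  define I where "I = contour_integral (circlepath 0 R) F"
  have FI: "(F has_contour_integral I) (circlepath 0 R)"
    unfolding I_def
    by (intro has_contour_integral_integral contour_integrable_holomorphic_simple[OF hol open_resolvent_dom _ sub]) simp
  have G: "((\<lambda>z. exp (a * z) * (\<Sum>k<K. c k / z ^ Suc k)) has_contour_integral
      (\<Sum>k<K. (2 * of_real pi * \<i>) * (a ^ k / fact k * c k))) (circlepath 0 R)" for K
  proof -
    have "((\<lambda>z. exp (a * z) / (z - 0) ^ Suc k) has_contour_integral
        (2 * of_real pi * \<i>) / fact k * (deriv ^^ k) (\<lambda>z. exp (a * z)) 0) (circlepath 0 R)" for k
    proof -
      have "continuous_on (cball 0 R) (\<lambda>z. exp (a * z))" "(\<lambda>z. exp (a * z)) holomorphic_on ball 0 R"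
        by (intro continuous_intros holomorphic_intros)+
      from Cauchy_has_contour_integral_higher_derivative_circlepath[OF this, of 0 k] R0
      show ?thesis by simp
    qed
    then have "((\<lambda>z. c k * (exp (a * z) / (z - 0) ^ Suc k)) has_contour_integral
        c k * ((2 * of_real pi * \<i>) / fact k * (deriv ^^ k) (\<lambda>z. exp (a * z)) 0)) (circlepath 0 R)" for k
      by (rule has_contour_integral_lmul)
    then have "((\<lambda>z. \<Sum>k<K. c k * (exp (a * z) / (z - 0) ^ Suc k)) has_contour_integral
        (\<Sum>k<K. c k * ((2 * of_real pi * \<i>) / fact k * (deriv ^^ k) (\<lambda>z. exp (a * z)) 0))) (circlepath 0 R)"
      by (intro has_contour_integral_sum) auto
    then show ?thesis unfolding higher_deriv_exp_linear by (simp add: sum_distrib_left mult_ac)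
  qed
  define q M where "q = norm H / R" and "M = exp (cmod a * R) * (norm x / (R - norm H))"
  have q: "0 \<le> q" "q < 1" using R R0 by (auto simp: q_def)
  have M: "0 \<le> M" using R by (simp add: M_def)
  have le: "cmod (I + (\<Sum>k<K. (2 * of_real pi * \<i>) * (a ^ k / fact k * c k))) \<le> M * q ^ K * (2 * pi * R)" for K
  proof (rule has_contour_integral_bound_circlepath[OF has_contour_integral_add[OF FI G]])
    fix z :: complex assume z: "cmod (z - 0) = R"
    have "F z + exp (a * z) * (\<Sum>k<K. c k / z ^ Suc k)
        = exp (a * z) * (ell2_coeff (resolvent H z x) n + (\<Sum>k<K. c k / z ^ Suc k))"
      by (simp add: F_def a_def distrib_left)
    also have "cmod \<dots> \<le> exp (cmod a * R) * (q ^ K * norm x / (R - norm H))"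
      unfolding norm_mult
    proof (rule mult_mono)
      show "cmod (exp (a * z)) \<le> exp (cmod a * R)"
        using norm_exp[of "a * z"] z by (simp add: norm_mult)
      show "cmod (ell2_coeff (resolvent H z x) n + (\<Sum>k<K. c k / z ^ Suc k)) \<le> q ^ K * norm x / (R - norm H)"
        using resolvent_neumann[OF sym lin, of z x n K] z R by (simp add: c_def q_def)
    qed auto
    finally show "cmod (F z + exp (a * z) * (\<Sum>k<K. c k / z ^ Suc k)) \<le> M * q ^ K"
      by (simp add: M_def mult_ac)
  qed (use R0 M q in auto)
  have "(\<lambda>K. M * q ^ K * (2 * pi * R)) \<longlonglongrightarrow> M * 0 * (2 * pi * R)"
    using q by (intro tendsto_intros LIMSEQ_realpow_zero)
  then have lim0: "(\<lambda>K. M * q ^ K * (2 * pi * R)) \<longlonglongrightarrow> 0" by simp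
  have "(\<lambda>K. I + (\<Sum>k<K. (2 * of_real pi * \<i>) * (a ^ k / fact k * c k))) \<longlonglongrightarrow> 0"
    by (rule Lim_null_comparison[OF _ lim0]) (simp only: le eventually_True)
  moreover have "(\<lambda>K. I + (\<Sum>k<K. (2 * of_real pi * \<i>) * (a ^ k / fact k * c k)))
      \<longlonglongrightarrow> I + (2 * of_real pi * \<i>) * ell2_coeff (evolution H t x) n"
    using evolution_coeff_sums[OF sym lin, of t x n]
    unfolding sums_def sum_distrib_left[symmetric] a_def c_def by (intro tendsto_intros) auto
  ultimately have "I + (2 * of_real pi * \<i>) * ell2_coeff (evolution H t x) n = 0"
    using LIMSEQ_unique by blast
  moreover have "contour_integral (ellipse R \<eta>) F = I"
    unfolding I_def circlepath_eq_ellipse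
    by (rule Cauchy_theorem_homotopic_loops[OF homotopic_loops_ellipse[OF R \<eta>] open_resolvent_dom hol
          valid_path_ellipse valid_path_ellipse, symmetric])
  ultimately show "contour_integral (ellipse R \<eta>) F = - (2 * of_real pi * \<i>) * ell2_coeff (evolution H t x) n"
    by (simp add: add_eq_0_iff2)
qed

text \<open>On the ellipse a point is either far from the spectrum, where the Neumann series applies, or
  at distance comparable to \<open>\<eta>\<close> from the real axis.\<close>

lemma evolution_coeff_le:
  fixes \<eta> B t :: real
  defines "h \<equiv> norm H + 1"
  assumes range: "\<And>k. k < m \<Longrightarrow> ell2_coeff ((blinfun_apply H ^^ k) x) n = 0" and x: "norm x = 1"
    and \<eta>: "0 < \<eta>" "\<eta> \<le> 1" and t: "0 \<le> t" and B: "0 \<le> B"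
    and green: "\<And>z. \<eta> / 2 \<le> \<bar>Im z\<bar> \<Longrightarrow> \<bar>Im z\<bar> \<le> \<eta> \<Longrightarrow> cmod (ell2_coeff (resolvent H z x) n) \<le> B"
  shows "cmod (ell2_coeff (evolution H t x) n) \<le> 4 * h * exp (\<eta> * t) * (B + (1 / 2) ^ m)"
proof -
  \<comment> \<open>With \<open>R = 4 * h\<close>, a point with \<open>|z| < 2 * h\<close> has
    \<open>|cos| < 1/2\<close>, hence \<open>|sin| >= 1/2\<close> and
    \<open>|Im z| >= \<eta> / 2\<close>.\<close>
  define R where "R = 4 * h"
  have h: "h \<ge> 1" "norm H = h - 1" by (auto simp: h_def)
  have R: "norm H < R" "\<eta> \<le> R" using h \<eta> by (auto simp: R_def)
  define F where "F = (\<lambda>z. exp (- \<i> * of_real t * z) * ell2_coeff (resolvent H z x) n)"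
  note ci = evolution_coeff_contour_integral[OF R(1) \<eta>(1), of t x n, folded F_def]
  have img: "path_image (ellipse R \<eta>) \<subseteq> resolvent_dom H"
    using homotopic_loops_imp_subset[OF homotopic_loops_ellipse[OF R(1) \<eta>(1)]] by simp
  have "cmod (contour_integral (ellipse R \<eta>) F) \<le> exp (\<eta> * t) * (B + (1 / 2) ^ m) * (2 * pi * R)"
  proof (rule contour_integral_ellipse_le)
    show "F contour_integrable_on ellipse R \<eta>"
      by (rule contour_integrable_holomorphic_simple[OF ci(1) open_resolvent_dom valid_path_ellipse img])
    fix s
    define z where "z = ellipse R \<eta> s"
    have imz: "\<bar>Im z\<bar> \<le> \<eta>"
      using \<eta> abs_sin_le_one[of "2 * pi * s"] by (simp add: z_def abs_mult mult_left_le)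
    have "cmod (ell2_coeff (resolvent H z x) n) \<le> B + (1 / 2) ^ m"
    proof (cases "cmod z \<ge> 2 * h")
      case True
      have "(\<Sum>k<m. ell2_coeff ((blinfun_apply H ^^ k) x) n / z ^ Suc k) = 0"
        using range by (intro sum.neutral) auto
      then have "cmod (ell2_coeff (resolvent H z x) n) \<le> (norm H / cmod z) ^ m * 1 / (cmod z - norm H)"
        using resolvent_neumann[OF sym lin, of z x n m] True h x by simp
      also have "\<dots> \<le> (1 / 2) ^ m / 1"
      proof (rule frac_le)
        have "cmod z > 0" using True h(1) by linarith
        then have "norm H / cmod z \<le> 1 / 2" using True h by (simp add: pos_divide_le_eq)
        then show "(norm H / cmod z) ^ m * 1 \<le> (1 / 2) ^ m" by (simp add: power_mono)
      qed (use True h in auto)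
      finally show ?thesis using B by simp
    next
      case False
      have "\<bar>R * cos (2 * pi * s)\<bar> < 2 * h" using False abs_Re_le_cmod[of z] by (simp add: z_def)
      then have "\<bar>cos (2 * pi * s)\<bar> < 1 / 2" using h by (simp add: R_def abs_mult)
      then have "\<bar>cos (2 * pi * s)\<bar>\<^sup>2 \<le> (1 / 2)\<^sup>2" by (intro power_mono) auto
      then have "(sin (2 * pi * s))\<^sup>2 \<ge> (1 / 2)\<^sup>2"
        using sin_cos_squared_add[of "2 * pi * s"] by (simp add: power2_eq_square)
      then have "\<bar>sin (2 * pi * s)\<bar> \<ge> 1 / 2" by (metis abs_le_square_iff abs_of_nonneg zero_le_divide_1_iff zero_le_numeral)
      then have "\<eta> * (1 / 2) \<le> \<eta> * \<bar>sin (2 * pi * s)\<bar>" using \<eta> by (intro mult_left_mono) auto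
      then have "\<eta> / 2 \<le> \<bar>Im z\<bar>" using \<eta> by (simp add: z_def abs_mult)
      then have "cmod (ell2_coeff (resolvent H z x) n) \<le> B" using green imz by blast
      then show ?thesis using zero_le_power[of "1/2 :: real" m] by linarith
    qed
    moreover have "cmod (exp (- \<i> * of_real t * z)) \<le> exp (\<eta> * t)"
    proof -
      have "t * Im z \<le> t * \<eta>" using imz t by (intro mult_left_mono) auto
      then show ?thesis by (simp add: norm_exp_eq_Re mult.commute)
    qed
    ultimately show "cmod (F (ellipse R \<eta> s)) \<le> exp (\<eta> * t) * (B + (1 / 2) ^ m)"
      unfolding F_def z_def[symmetric] norm_mult by (intro mult_mono) auto
  qed (use \<eta> R in auto)
  then have "2 * pi * cmod (ell2_coeff (evolution H t x) n) \<le> 2 * pi * (exp (\<eta> * t) * (B + (1 / 2) ^ m) * R)"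
    by (simp add: ci(2) norm_mult mult_ac)
  then have "cmod (ell2_coeff (evolution H t x) n) \<le> exp (\<eta> * t) * (B + (1 / 2) ^ m) * R"
    by simp
  then show ?thesis by (simp only: R_def mult_ac)
qed

end

section \<open>Time averages\<close>

lemma fib_hamiltonian_funpow_delta:
  "k < nat \<bar>n - 1\<bar> \<Longrightarrow> ell2_coeff ((blinfun_apply (fib_hamiltonian lam) ^^ k) (ell2_delta 1)) n = 0"
proof (induction k arbitrary: n)
  case 0
  then show ?case by (auto simp: ell2_delta.rep_eq)
next
  case (Suc k)
  have "k < nat \<bar>n + 1 - 1\<bar>" "k < nat \<bar>n - 1 - 1\<bar>" "k < nat \<bar>n - 1\<bar>" using Suc.prems by linarith+
  from this[THEN Suc.IH] show ?case by (simp add: fib_hamiltonian_coeff)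
qed

lemma nn_integral_exp_decay:
  assumes "0 < c"
  shows "(\<integral>\<^sup>+t\<in>{0..}. ennreal (exp (- (c * t))) \<partial>lborel) = ennreal (1 / c)"
proof -
  have c0: "c \<noteq> 0" using assms by simp
  have "(\<integral>\<^sup>+t. ennreal (exp (- (c * t))) * indicator {0..} t \<partial>lborel) = ennreal (0 - (- exp (- (c * 0)) / c))"
  proof (rule nn_integral_FTC_atLeast)
    show "((\<lambda>t. - exp (- (c * t)) / c) has_real_derivative exp (- (c * t))) (at t)" for t
      using c0 by (auto intro!: derivative_eq_intros)
    have "((\<lambda>t. exp (- (c * t))) \<longlongrightarrow> 0) at_top" using assms by real_asymp
    from tendsto_divide[OF tendsto_minus[OF this] tendsto_const c0] show "((\<lambda>t. - exp (- (c * t)) / c) \<longlongrightarrow> 0) at_top" by simp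
  qed auto
  then show ?thesis by simp
qed

lemma avg_prob_eq:
  "avg_prob H n T = ennreal (2 / T) *
     (\<integral>\<^sup>+t\<in>{0..}. ennreal (exp (- 2 * t / T) * (cmod (ell2_coeff (evolution H t (ell2_delta 1)) n))\<^sup>2) \<partial>lborel)"
  by (simp add: avg_prob_def ell2_cinner_delta)

text \<open>On an ellipse of height \<open>1 / (2 * T)\<close> the squared amplitude grows at most
  like \<open>exp (t / T)\<close>, against the weight \<open>exp (- 2 * t / T)\<close>; the
  remaining integral \<open>T\<close> cancels with \<open>2 / T\<close>. The constant 32 is
  \<open>2 * 4^2\<close>.\<close>

lemma avg_prob_le:
  assumes T: "T \<ge> 1" and B: "0 \<le> B"
    and green: "\<And>z. 1 / (4 * T) \<le> \<bar>Im z\<bar> \<Longrightarrow>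
      cmod (ell2_coeff (resolvent (fib_hamiltonian lam) z (ell2_delta 1)) n) \<le> B"
  shows "avg_prob (fib_hamiltonian lam) n T
    \<le> ennreal (32 * (norm (fib_hamiltonian lam) + 1)\<^sup>2 * (B + (1 / 2) ^ nat \<bar>n - 1\<bar>)\<^sup>2)"
proof -
  define H where "H = fib_hamiltonian lam"
  define M where "M = 4 * (norm H + 1) * (B + (1 / 2) ^ nat \<bar>n - 1\<bar>)"
  have M: "M \<ge> 0" using B by (simp add: M_def)
  have f: "cmod (ell2_coeff (evolution H t (ell2_delta 1)) n) \<le> M * exp (t / (2 * T))" if "t \<ge> 0" for t
  proof -
    have "cmod (ell2_coeff (evolution H t (ell2_delta 1)) n)
        \<le> 4 * (norm H + 1) * exp (1 / (2 * T) * t) * (B + (1 / 2) ^ nat \<bar>n - 1\<bar>)"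
    proof (rule evolution_coeff_le)
      show "cmod (ell2_coeff (resolvent H z (ell2_delta 1)) n) \<le> B" if "1 / (2 * T) / 2 \<le> \<bar>Im z\<bar>" for z
        using green[of z] that by (simp add: H_def)
    qed (use T B that in \<open>auto simp: H_def fib_hamiltonian_symmetric fib_hamiltonian_scaleC
        fib_hamiltonian_funpow_delta field_simps\<close>)
    then show ?thesis by (simp add: M_def mult_ac)
  qed
  have "(\<integral>\<^sup>+t\<in>{0..}. ennreal (exp (- 2 * t / T) * (cmod (ell2_coeff (evolution H t (ell2_delta 1)) n))\<^sup>2) \<partial>lborel)
     \<le> (\<integral>\<^sup>+t\<in>{0..}. ennreal (M\<^sup>2) * ennreal (exp (- (1 / T * t))) \<partial>lborel)"
  proof (rule nn_integral_mono)
    fix t :: real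
    show "ennreal (exp (- 2 * t / T) * (cmod (ell2_coeff (evolution H t (ell2_delta 1)) n))\<^sup>2) * indicator {0..} t
      \<le> ennreal (M\<^sup>2) * ennreal (exp (- (1 / T * t))) * indicator {0..} t"
    proof (cases "t \<ge> 0")
      case True
      have "exp (- 2 * t / T) * (cmod (ell2_coeff (evolution H t (ell2_delta 1)) n))\<^sup>2
          \<le> exp (- 2 * t / T) * (M * exp (t / (2 * T)))\<^sup>2"
        by (intro mult_left_mono power_mono f True) auto
      also have "\<dots> = M\<^sup>2 * (exp (- 2 * t / T) * (exp (t / (2 * T)) * exp (t / (2 * T))))"
        by (simp only: power2_eq_square mult_ac)
      also have "\<dots> = M\<^sup>2 * exp (- 2 * t / T + (t / (2 * T) + t / (2 * T)))"
        by (simp only: exp_add)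
      also have "- 2 * t / T + (t / (2 * T) + t / (2 * T)) = - (1 / T * t)"
        using T by (simp add: field_simps)
      finally show ?thesis using True M by (simp add: ennreal_leI flip: ennreal_mult)
    qed simp
  qed
  also have "\<dots> = ennreal (M\<^sup>2) * (\<integral>\<^sup>+t\<in>{0..}. ennreal (exp (- (1 / T * t))) \<partial>lborel)"
    unfolding mult.assoc by (intro nn_integral_cmult) auto
  also have "\<dots> = ennreal (M\<^sup>2 * T)"
    using T by (subst nn_integral_exp_decay) (auto simp flip: ennreal_mult)
  finally have "avg_prob H n T \<le> ennreal (2 / T) * ennreal (M\<^sup>2 * T)"
    unfolding avg_prob_eq by (intro mult_left_mono) auto
  also have "\<dots> = ennreal (2 * M\<^sup>2)" using T by (simp flip: ennreal_mult)
  also have "2 * M\<^sup>2 = 32 * (norm H + 1)\<^sup>2 * (B + (1 / 2) ^ nat \<bar>n - 1\<bar>)\<^sup>2"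
    by (simp only: M_def power_mult_distrib) simp
  finally show ?thesis by (simp only: H_def)
qed

lemma evolution_coeff_measurable:
  "(\<lambda>t. ell2_coeff (evolution (fib_hamiltonian lam) t x) n) \<in> borel_measurable lborel"
proof (rule borel_measurable_LIMSEQ_metric)
  show "(\<lambda>K. \<Sum>k<K. (- \<i> * of_real t) ^ k / fact k * ell2_coeff ((blinfun_apply (fib_hamiltonian lam) ^^ k) x) n)
    \<longlonglongrightarrow> ell2_coeff (evolution (fib_hamiltonian lam) t x) n" for t
    using evolution_coeff_sums[of "fib_hamiltonian lam" t x n]
    by (simp add: fib_hamiltonian_symmetric fib_hamiltonian_scaleC sums_def)
qed measurable

text \<open>The weight \<open>(2 / T) * exp (- 2 * t / T)\<close> is a probability density on the
  half-line, and the evolved state keeps norm 1.\<close>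

lemma sum_avg_prob_le_1:
  assumes "finite F" "T > 0"
  shows "(\<Sum>n\<in>F. avg_prob (fib_hamiltonian lam) n T) \<le> 1"
proof -
  define f where "f n t = ell2_coeff (evolution (fib_hamiltonian lam) t (ell2_delta 1)) n" for n t
  have [measurable]: "f n \<in> borel_measurable lborel" for n
    unfolding f_def[abs_def] by (rule evolution_coeff_measurable)
  have "(\<Sum>n\<in>F. avg_prob (fib_hamiltonian lam) n T)
      = ennreal (2 / T) * (\<Sum>n\<in>F. \<integral>\<^sup>+t\<in>{0..}. ennreal (exp (- 2 * t / T) * (cmod (f n t))\<^sup>2) \<partial>lborel)"
    by (simp add: avg_prob_eq f_def sum_distrib_left)
  also have "(\<Sum>n\<in>F. \<integral>\<^sup>+t\<in>{0..}. ennreal (exp (- 2 * t / T) * (cmod (f n t))\<^sup>2) \<partial>lborel)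
      = (\<integral>\<^sup>+t. (\<Sum>n\<in>F. ennreal (exp (- 2 * t / T) * (cmod (f n t))\<^sup>2) * indicator {0..} t) \<partial>lborel)"
    by (rule nn_integral_sum[symmetric]) measurable
  also have "\<dots> \<le> (\<integral>\<^sup>+t\<in>{0..}. ennreal (exp (- (2 / T * t))) \<partial>lborel)"
  proof (rule nn_integral_mono)
    fix t :: real
    have "(\<Sum>n\<in>F. (cmod (f n t))\<^sup>2) \<le> (norm (evolution (fib_hamiltonian lam) t (ell2_delta 1)))\<^sup>2"
      unfolding f_def by (rule ell2_sum_le_norm[OF assms(1)])
    also have "\<dots> = 1"
      by (simp add: norm_evolution fib_hamiltonian_symmetric fib_hamiltonian_scaleC)
    finally have "exp (- 2 * t / T) * (\<Sum>n\<in>F. (cmod (f n t))\<^sup>2) \<le> exp (- 2 * t / T) * 1"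
      by (rule mult_left_mono) simp
    then have "(\<Sum>n\<in>F. ennreal (exp (- 2 * t / T) * (cmod (f n t))\<^sup>2)) \<le> ennreal (exp (- (2 / T * t)))"
      by (simp add: sum_ennreal sum_distrib_left ennreal_leI)
    then show "(\<Sum>n\<in>F. ennreal (exp (- 2 * t / T) * (cmod (f n t))\<^sup>2) * indicator {0..} t)
        \<le> ennreal (exp (- (2 / T * t))) * indicator {0..} t"
      unfolding sum_distrib_right[symmetric] by (rule mult_right_mono) simp
  qed
  also have "\<dots> = ennreal (T / 2)"
    using assms by (subst nn_integral_exp_decay) auto
  finally have "(\<Sum>n\<in>F. avg_prob (fib_hamiltonian lam) n T) \<le> ennreal (2 / T) * ennreal (T / 2)"
    by (simp add: mult_left_mono)
  also have "\<dots> = 1" using assms by (simp flip: ennreal_mult)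
  finally show ?thesis .
qed

text \<open>With \<open>D = sqrt S ^ i / (2 * S)\<close> the off-axis condition reads
  \<open>|Im z| * sqrt S ^ i > 4 * S * (1 + a)\<close> and persists for all \<open>i >= j\<close>.
  So two consecutive half-traces exceed \<open>a\<close>, and escape starts.\<close>

lemma trace_seq_large:
  fixes lam S \<eta> y0 :: real
  defines "a \<equiv> sqrt (1 + \<eta>)"
  assumes lam: "lam \<ge> 8" and \<eta>: "0 < \<eta>" "\<eta> \<le> 1/1000"
    and S: "2 \<le> S" "S + 3 / S + 16 * \<eta> \<le> lam - 4"
    and j: "j \<ge> 2" and y: "y0 * sqrt S ^ j > 4 * S * (1 + a)" "y0 > 0" "\<bar>Im z\<bar> \<ge> y0"
  shows "a ^ fib l \<le> cmod (trace_seq (of_real lam) z (j + l))"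
proof (rule trace_seq_escape)
  have s: "sqrt S \<ge> 1" "S > 0" using S by auto
  have big: "a < cmod (trace_seq (of_real lam) z i)" if i: "i \<ge> j" for i
  proof -
    have "a < cmod (trace_seq (of_real lam) (Complex (Re z) (Im z)) i)"
    proof (rule trace_seq_large_off_real[where D = "sqrt S ^ i / (2 * S)"])
      show "Im w = 0" if "\<bar>c\<bar> \<le> 1" "trace_seq (of_real lam) w i = complex_of_real c" for w c
        using fib_trace_real_rooted[OF that] i j by simp
      show "sqrt S ^ i / (2 * S) \<le> \<bar>trace_deriv lam E i\<bar>" if "\<bar>trace_seq lam E i\<bar> \<le> a" for E
      proof -
        have "(trace_seq lam E i)\<^sup>2 \<le> 1 + \<eta>"
          using that \<eta> unfolding a_def by (simp flip: real_sqrt_abs)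
        then have "sqrt S ^ i \<le> 2 * S * \<bar>trace_deriv lam E i\<bar>"
          using trace_deriv_ge[OF lam \<eta> S] i j by auto
        then show ?thesis using s by (simp add: pos_divide_le_eq mult.commute)
      qed
      have "y0 * sqrt S ^ j \<le> \<bar>Im z\<bar> * sqrt S ^ i"
        using y s i by (intro mult_mono power_increasing) auto
      then have "4 * S * (1 + a) < \<bar>Im z\<bar> * sqrt S ^ i" using y by linarith
      then show "1 + a < \<bar>Im z\<bar> * (sqrt S ^ i / (2 * S) / 2)"
        using s by (simp add: field_simps)
    qed (use s in auto)
    then show ?thesis by simp
  qed
  show "1 < a" using \<eta> by (simp add: a_def)
  show "a < cmod (trace_seq (of_real lam) z j)" "a < cmod (trace_seq (of_real lam) z (Suc j))"
    using big by auto
qed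

lemma fib_Suc_le_power: "real (fib (Suc n)) \<le> ((sqrt 5 + 1) / 2) ^ n"
proof (induction n rule: fib.induct)
  case 2
  have "1 \<le> sqrt 5" by simp
  then show ?case by simp
next
  case (3 n)
  define p where "p = (sqrt 5 + 1) / 2"
  have "p * p = p + 1" by (simp add: p_def field_simps)
  then have "p ^ Suc (Suc n) = p ^ Suc n + p ^ n" by (simp add: algebra_simps flip: mult.assoc)
  then show ?case using 3 by (simp add: p_def)
qed simp

text \<open>Take the largest \<open>l\<close> whose block still fits. The next one does not, and the
  addition formula bounds it by \<open>3 * fib l * fib (j + 1)\<close>. So \<open>fib l\<close> is
  at least of order \<open>m / fib (j + 1)\<close>, which turns \<open>a ^ fib l\<close> into
  exponential decay in \<open>m\<close>. The 2 allows for the shifted block on the left.\<close>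

lemma fib_index_exists:
  assumes "m \<ge> fib (Suc j) + 2"
  obtains l where "fib (j + l) + 2 \<le> m" "m \<le> 4 * fib l * fib (Suc j)"
proof -
  have bounded: "l \<le> m + 2" if "fib (j + l) + 2 \<le> m" for l
  proof (rule ccontr)
    assume "\<not> l \<le> m + 2"
    then have "fib (Suc (Suc m)) \<le> fib (j + l)" by (intro fib_mono) auto
    then show False using le_fib_Suc_Suc[of m] that by linarith
  qed
  define l where "l = (GREATEST l. fib (j + l) + 2 \<le> m)"
  have l: "fib (j + l) + 2 \<le> m"
    unfolding l_def by (rule GreatestI_nat[of _ 1 "m + 2"]) (use assms bounded in auto)
  have l1: "l \<ge> 1"
    unfolding l_def by (rule Greatest_le_nat[of _ _ "m + 2"]) (use assms bounded in auto)
  have "\<not> fib (j + Suc l) + 2 \<le> m"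
  proof
    assume A: "fib (j + Suc l) + 2 \<le> m"
    have "Suc l \<le> (GREATEST l. fib (j + l) + 2 \<le> m)"
      by (rule Greatest_le_nat[of _ _ "m + 2"]) (use A bounded in blast)+
    then show False unfolding l_def[symmetric] by simp
  qed
  then have "m \<le> fib (Suc (l + j)) + 1" by (simp add: add.commute)
  also have "fib (Suc (l + j)) = fib (Suc j) * fib (Suc l) + fib j * fib l" by (rule fib_add)
  also have "\<dots> \<le> fib (Suc j) * (2 * fib l) + fib (Suc j) * fib l"
  proof (intro add_mono mult_le_mono)
    show "fib (Suc l) \<le> 2 * fib l"
      using l1 fib_mono[of "l - 1" l] by (cases l) auto
    show "fib j \<le> fib (Suc j)" by (rule fib_mono) simp
  qed auto
  also have "\<dots> + 1 \<le> 4 * fib l * fib (Suc j)"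
    using fib_neq_0_nat[of l] fib_neq_0_nat[of "Suc j"] l1 by (simp add: Suc_leI)
  finally show ?thesis using that l by simp
qed

section \<open>Localization at scale \<open>T\<^sup>\<alpha>\<close>\<close>

lemma xi_properties:
  assumes "lam \<ge> 8"
  shows "xi lam \<ge> 3" "xi lam + 3 / xi lam = lam - 4"
proof -
  define s where "s = sqrt ((lam - 4)\<^sup>2 - 12)"
  have "4\<^sup>2 \<le> (lam - 4)\<^sup>2" using assms by (intro power_mono) auto
  then have ge: "(lam - 4)\<^sup>2 - 12 \<ge> 2\<^sup>2" by simp
  then have s: "s \<ge> 2" "s * s = (lam - 4)\<^sup>2 - 12"
    unfolding s_def by (auto intro: real_le_rsqrt)
  have x: "xi lam = (lam - 4 + s) / 2" by (simp add: xi_def s_def)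
  show ge3: "xi lam \<ge> 3" using s assms by (simp add: x)
  have "xi lam * xi lam + 3 = (lam - 4) * xi lam"
    using s(2) by (simp add: x power2_eq_square field_simps)
  then show "xi lam + 3 / xi lam = lam - 4" using ge3 by (simp add: field_simps)
qed

lemma ln_golden_ratio_pos: "ln ((sqrt 5 + 1) / 2) > (0::real)"
proof -
  have "1 < sqrt (5::real)" by simp
  then show ?thesis by (intro ln_gt_zero) simp
qed

lemma alpha_bound_pos:
  assumes "lam \<ge> 8"
  shows "alpha_bound lam > 0"
proof -
  have "ln (xi lam) > 0" using xi_properties(1)[OF assms] by simp
  then show ?thesis unfolding alpha_bound_def using ln_golden_ratio_pos by (intro divide_pos_pos) auto
qed

text \<open>Any growth rate \<open>S\<close> below \<open>xi lam\<close> leaves room for the slack \<open>\<eta>\<close> in the trace estimates.\<close>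

lemma growth_rate_exists:
  assumes lam: "lam \<ge> 8" and \<alpha>: "\<alpha> > alpha_bound lam"
  obtains S \<eta> where "2 \<le> S" "0 < \<eta>" "\<eta> \<le> 1 / 1000" "S + 3 / S + 16 * \<eta> \<le> lam - 4"
    "2 * ln ((sqrt 5 + 1) / 2) / ln S \<le> \<alpha>"
proof -
  define L where "L = ln ((sqrt 5 + 1) / 2)"
  note xi = xi_properties[OF lam]
  have \<alpha>0: "\<alpha> > 0" using alpha_bound_pos[OF lam] \<alpha> by simp
  have "2 * L / ln (xi lam) < \<alpha>" using \<alpha> by (simp add: alpha_bound_def L_def)
  then have "2 * L / \<alpha> < ln (xi lam)" using \<alpha>0 xi by (simp add: field_simps)
  then have "exp (2 * L / \<alpha>) < exp (ln (xi lam))" by (simp only: exp_less_mono)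
  then have e: "exp (2 * L / \<alpha>) < xi lam" using xi by simp
  define S where "S = (max 2 (exp (2 * L / \<alpha>)) + xi lam) / 2"
  have S: "2 < S" "exp (2 * L / \<alpha>) < S" "S < xi lam" using e xi by (auto simp: S_def)
  \<comment> \<open>\<open>3 / xi lam\<close> is the other root of
    \<open>x^2 - (lam - 4) * x + 3\<close>, which is negative strictly between its roots.\<close>
  have "3 / xi lam \<le> 1" using xi by (simp add: field_simps)
  then have "3 / xi lam < S" using S by linarith
  then have "0 < S - 3 / xi lam" by (simp only: diff_gt_0_iff_gt)
  moreover have "S - xi lam < 0" using S(3) by (simp only: diff_less_0_iff_less)
  ultimately have neg: "(S - xi lam) * (S - 3 / xi lam) < 0" by (rule mult_neg_pos[rotated])
  have "xi lam \<noteq> 0" using xi(1) by linarith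
  then have prod: "xi lam * (3 / xi lam) = 3"
    by (simp only: times_divide_eq_right nonzero_mult_div_cancel_left not_False_eq_True)
  have eq: "(S - x) * (S - r) = S * S - (x + r) * S + x * r" for x r :: real
    by (simp add: algebra_simps)
  have "S * S + 3 < (lam - 4) * S"
    using neg unfolding eq prod xi(2) by linarith
  then have "3 < (lam - 4 - S) * S" by (simp add: algebra_simps)
  then have "3 / S < lam - 4 - S" using S(1) by (subst pos_divide_less_eq) auto
  then have S3: "S + 3 / S < lam - 4" by linarith
  have "ln (exp (2 * L / \<alpha>)) < ln S" using S by (subst ln_less_cancel_iff) auto
  then have lnS: "2 * L / \<alpha> < ln S" by simp
  define \<eta> where "\<eta> = min (1 / 1000) ((lam - 4 - S - 3 / S) / 16)"
  show ?thesis
  proof (rule that[of S \<eta>])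
    have "2 * L < \<alpha> * ln S" using lnS \<alpha>0 by (simp add: pos_divide_less_eq mult.commute)
    moreover have "ln S > 0" using S(1) by simp
    ultimately have "2 * L / ln S \<le> \<alpha>" by (simp add: pos_divide_le_eq)
    then show "2 * ln ((sqrt 5 + 1) / 2) / ln S \<le> \<alpha>" by (simp only: L_def)
    have "\<eta> \<le> (lam - 4 - S - 3 / S) / 16" unfolding \<eta>_def by (rule min.cobounded2)
    then have "\<eta> * 16 \<le> lam - 4 - S - 3 / S" by (simp only: pos_le_divide_eq zero_less_numeral)
    then show "S + 3 / S + 16 * \<eta> \<le> lam - 4" by linarith
  qed (use S S3 in \<open>auto simp: \<eta>_def\<close>)
qed

text \<open>Level \<open>j\<close> has \<open>sqrt S ^ j\<close> of order \<open>T\<close>, so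
  half-traces from there on are large at height \<open>1 / (4 * T)\<close>, and
  \<open>fib (j + 1)\<close> is at most of order \<open>T powr \<alpha>\<close>. Beyond that
  distance the escaping half-trace gives the decay, with \<open>T^4\<close> from squaring the Green
  function bound; closer sites need only the bound 1.\<close>

lemma avg_prob_localization:
  assumes lam: "lam \<ge> 8" and \<alpha>: "\<alpha> > alpha_bound lam"
  obtains C c where "C > 0" "c > 0"
    "\<And>T n. T \<ge> 1 \<Longrightarrow> avg_prob (fib_hamiltonian lam) n T
       \<le> ennreal (C * T ^ 4 * exp (- (c * real (nat \<bar>n\<bar>) / T powr \<alpha>)))"
proof -
  obtain S \<eta> where S: "2 \<le> S" "S + 3 / S + 16 * \<eta> \<le> lam - 4" and \<eta>: "0 < \<eta>" "\<eta> \<le> 1 / 1000"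
    and \<alpha>S: "2 * ln ((sqrt 5 + 1) / 2) / ln S \<le> \<alpha>"
    using growth_rate_exists[OF assms] by metis
  define h where "h = norm (fib_hamiltonian lam)"
  define L a s where "L = ln ((sqrt 5 + 1) / 2)" and "a = sqrt (1 + \<eta>)" and "s = sqrt S"
  define \<alpha>0 where "\<alpha>0 = L / ln s"
  have L: "L > 0" unfolding L_def by (rule ln_golden_ratio_pos)
  have lns: "ln s = ln S / 2" using S by (simp add: s_def ln_sqrt)
  have lns0: "ln s > 0" using S by (simp add: lns)
  have "\<alpha>0 = 2 * L / ln S" by (simp add: \<alpha>0_def lns)
  then have \<alpha>0: "0 < \<alpha>0" "\<alpha>0 \<le> \<alpha>" using \<alpha>S L lns0 by (simp_all add: L_def lns)
  have a: "a > 1" using \<eta> by (simp add: a_def)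
  \<comment> \<open>\<open>4 * S * (1 + a)\<close> is the threshold in
    \<open>trace_seq_large\<close>; the other factor 4 comes from the height
    \<open>1 / (4 * T)\<close>.\<close>
  define C1 where "C1 = 16 * S * (1 + a)"
  have "1 * 1 \<le> 16 * S * (1 + a)" using S a by (intro mult_mono) auto
  then have C1: "C1 \<ge> 1" by (simp add: C1_def)
  define C2 where "C2 = exp (5 * L + \<alpha>0 * ln C1)"
  have C2: "C2 > 0" by (simp add: C2_def)
  \<comment> \<open>The first entry turns \<open>m <= 4 * fib l * f\<close> and
    \<open>f <= C2 * P\<close> into \<open>c * m / P <= ln a * fib l\<close>; the second gives
    \<open>(1 / 2)^m <= E\<close>.\<close>
  define c where "c = min (ln a / (4 * C2)) (ln 2)"
  have c: "c > 0" "c \<le> ln 2" "4 * C2 * c \<le> ln a"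
  proof -
    show "c > 0" "c \<le> ln 2" using a C2 by (auto simp: c_def)
    have "c \<le> ln a / (4 * C2)" by (simp add: c_def)
    then show "4 * C2 * c \<le> ln a" using C2 by (simp add: pos_le_divide_eq mult.commute)
  qed
  \<comment> \<open>The first summand serves the far sites, with \<open>1764 = 42^2\<close>; the
    second keeps the bound at least 1 for \<open>m < f + 2\<close>.\<close>
  define C where "C = 32 * (h + 1)\<^sup>2 * 1764 + exp (3 * c * C2)"
  have h: "h \<ge> 0" by (simp add: h_def)
  have C: "C > 0" "32 * (h + 1)\<^sup>2 * 1764 \<le> C" "exp (3 * c * C2) \<le> C"
    by (auto simp: C_def add_nonneg_pos)
  have main: "avg_prob (fib_hamiltonian lam) n T \<le> ennreal (C * T ^ 4 * exp (- (c * real (nat \<bar>n\<bar>) / T powr \<alpha>)))"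
    if T: "T \<ge> 1" for n T
  proof -
    define m P E where "m = nat \<bar>n\<bar>" and "P = T powr \<alpha>" and "E = exp (- (c * real m / P))"
    have P: "P \<ge> 1" using T \<alpha>0 by (simp add: P_def ge_one_powr_ge_zero)
    define X where "X = ln (C1 * T) / ln s"
    have C1T: "C1 * T \<ge> 1" using C1 T by (metis mult_mono mult_1 zero_le_one order_trans)
    have X: "X \<ge> 0" using C1T lns0 by (simp add: X_def)
    \<comment> \<open>The surplus 4 provides \<open>j >= 4\<close> for Gordon's argument and makes
      \<open>j\<close> strictly larger than \<open>X\<close>.\<close>
    define j where "j = nat \<lceil>X\<rceil> + 4"
    have j: "X < real j" "real j \<le> X + 5" "j \<ge> 4"
      using X by (auto simp: j_def) linarith+
    have sj: "s ^ j > C1 * T"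
    proof -
      have s0: "s > 0" using S by (simp add: s_def)
      have "ln (C1 * T) = X * ln s" using lns0 by (simp add: X_def)
      also have "\<dots> < real j * ln s" using j lns0 by simp
      also have "\<dots> = ln (s ^ j)" using s0 by (simp add: ln_realpow)
      finally show ?thesis using C1T s0 by simp
    qed
    define f where "f = fib (Suc j)"
    have f: "real f \<le> C2 * P" "f \<ge> 1"
    proof -
      have "real f \<le> ((sqrt 5 + 1) / 2) ^ j" unfolding f_def by (rule fib_Suc_le_power)
      also have "\<dots> = exp (real j * L)"
        unfolding exp_of_nat_mult by (simp add: L_def add_pos_pos)
      also have "\<dots> \<le> exp ((X + 5) * L)" using j L by simp
      also have "(X + 5) * L = (5 * L + \<alpha>0 * ln C1) + \<alpha>0 * ln T"
        using C1 T by (simp add: X_def \<alpha>0_def ln_mult algebra_simps add_divide_distrib)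
      also have "exp \<dots> = C2 * T powr \<alpha>0"
        using T by (simp add: C2_def exp_add powr_def)
      also have "\<dots> \<le> C2 * P"
        unfolding P_def using C2 \<alpha>0 T by (intro mult_left_mono powr_mono) auto
      finally show "real f \<le> C2 * P" .
      show "f \<ge> 1" using fib_neq_0_nat[of "Suc j"] by (simp add: f_def)
    qed
    have T4: "1 \<le> T ^ 4" using T by simp
    have E: "0 < E" "E \<le> 1" using c P by (auto simp: E_def)
    have "avg_prob (fib_hamiltonian lam) n T \<le> ennreal (C * T ^ 4 * E)"
    proof (cases "m \<ge> f + 2")
      case False
      have "avg_prob (fib_hamiltonian lam) n T \<le> 1"
        using sum_avg_prob_le_1[of "{n}" T lam] T by simp
      also have "1 \<le> ennreal (C * T ^ 4 * E)"
      proof -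
        have "real m \<le> 3 * real f" using False f(2) by linarith
        also have "\<dots> \<le> 3 * (C2 * P)" using f by simp
        finally have "c * real m / P \<le> 3 * c * C2"
          using c P by (simp add: pos_divide_le_eq mult_left_mono)
        then have "exp (- (3 * c * C2)) \<le> E" by (simp add: E_def)
        then have "exp (3 * c * C2) * 1 * exp (- (3 * c * C2)) \<le> C * T ^ 4 * E"
          using C T4 by (intro mult_mono) auto
        then show ?thesis by (simp add: exp_minus)
      qed
      finally show ?thesis .
    next
      case True
      then obtain l where l: "fib (j + l) + 2 \<le> m" "m \<le> 4 * fib l * f"
        unfolding f_def using fib_index_exists by blast
      have large: "inverse E \<le> cmod (trace_seq (of_real lam) z (j + l))" if "1 / (4 * T) \<le> \<bar>Im z\<bar>" for z
      proof -
        have "c * real m / P \<le> ln a * real (fib l)"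
        proof -
          have "real m \<le> 4 * real (fib l) * real f"
            using l(2) by (metis of_nat_le_iff of_nat_mult of_nat_numeral)
          also have "\<dots> \<le> 4 * real (fib l) * (C2 * P)" using f by (intro mult_left_mono) auto
          finally have "c * real m \<le> c * (4 * real (fib l) * (C2 * P))"
            using c by (intro mult_left_mono) auto
          also have "\<dots> = (4 * C2 * c) * real (fib l) * P" by simp
          also have "\<dots> \<le> ln a * real (fib l) * P" using c P by (intro mult_right_mono) auto
          finally show ?thesis using P by (simp add: pos_divide_le_eq)
        qed
        then have "inverse E \<le> exp (real (fib l) * ln a)" by (simp add: E_def exp_minus mult.commute)
        also have "\<dots> = a ^ fib l" unfolding exp_of_nat_mult using a by simp
        also have "\<dots> \<le> cmod (trace_seq (of_real lam) z (j + l))"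
          unfolding a_def
        proof (rule trace_seq_large[OF lam \<eta> S])
          show "4 * S * (1 + sqrt (1 + \<eta>)) < 1 / (4 * T) * sqrt S ^ j"
            using sj T by (simp add: C1_def a_def s_def field_simps)
        qed (use j T that in auto)
        finally show ?thesis .
      qed
      \<comment> \<open>\<open>40 = 2 * 4 * 5\<close>, since \<tau> is at most \<open>4 * T\<close>
        and \<open>\<tau> + 1\<close> at most \<open>5 * T\<close>.\<close>
      define B where "B = 40 * T\<^sup>2 * E"
      have B: "B \<ge> 0" using E by (simp add: B_def)
      have green: "cmod (ell2_coeff (resolvent (fib_hamiltonian lam) z (ell2_delta 1)) n) \<le> B"
        if z: "1 / (4 * T) \<le> \<bar>Im z\<bar>" for z
      proof -
        define G x \<tau> where "G = cmod (ell2_coeff (resolvent (fib_hamiltonian lam) z (ell2_delta 1)) n)"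
          and "x = cmod (trace_seq (of_real lam) z (j + l))" and "\<tau> = 1 / \<bar>Im z\<bar>"
        have z0: "\<bar>Im z\<bar> > 0" using z T by (smt (verit) divide_pos_pos)
        have \<tau>: "0 < \<tau>" "\<tau> \<le> 4 * T" using z z0 T by (auto simp: \<tau>_def field_simps)
        have "x * G \<le> 2 * \<tau> * (\<tau> + 1)"
          unfolding x_def G_def \<tau>_def
        proof (rule green_function_le)
          show "int (fib (j + l)) < n \<or> n < - 1 - int (fib (j + l))" using l(1) by (auto simp: m_def)
        qed (use z0 j in auto)
        also have "\<dots> \<le> 2 * (4 * T) * (5 * T)" using \<tau> T by (intro mult_mono) auto
        finally have xG: "x * G \<le> 40 * T\<^sup>2" by (simp add: power2_eq_square)
        have "inverse E * G \<le> x * G" using large[OF z] by (intro mult_right_mono) (auto simp: x_def G_def)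
        then have "E * (inverse E * G) \<le> E * (40 * T\<^sup>2)" using xG E by (intro mult_left_mono) auto
        then show ?thesis using E by (simp add: B_def G_def mult_ac flip: mult.assoc)
      qed
      have half: "(1 / 2) ^ nat \<bar>n - 1\<bar> \<le> 2 * E"
      proof -
        have "m \<ge> 1" using l(1) by simp
        have "(1 / 2 :: real) ^ nat \<bar>n - 1\<bar> \<le> (1 / 2) ^ (m - 1)"
          by (intro power_decreasing) (auto simp: m_def)
        also have "\<dots> = 2 * (1 / 2) ^ m" using \<open>m \<ge> 1\<close> by (cases m) auto
        also have "(1 / 2 :: real) ^ m = exp (real m * (- ln 2))"
          unfolding exp_of_nat_mult by (simp add: exp_minus inverse_eq_divide)
        also have "\<dots> \<le> E"
        proof -
          have "c * real m / P \<le> c * real m / 1" using P c by (intro divide_left_mono) auto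
          also have "\<dots> \<le> real m * ln 2" using mult_right_mono[OF c(2), of "real m"] by (simp add: mult.commute)
          finally show ?thesis by (simp add: E_def)
        qed
        finally show ?thesis by simp
      qed
      have "B + (1 / 2) ^ nat \<bar>n - 1\<bar> \<le> 42 * T\<^sup>2 * E"
      proof -
        have "2 * E * 1 \<le> 2 * E * T\<^sup>2" using E T by (intro mult_left_mono) auto
        then show ?thesis using half by (simp add: B_def)
      qed
      then have "(B + (1 / 2) ^ nat \<bar>n - 1\<bar>)\<^sup>2 \<le> (42 * T\<^sup>2 * E)\<^sup>2"
        using B by (intro power_mono) auto
      also have "\<dots> = 1764 * T ^ 4 * (E * E)" by (simp add: power2_eq_square power4_eq_xxxx)
      also have "\<dots> \<le> 1764 * T ^ 4 * (E * 1)" using E T4 by (intro mult_left_mono) auto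
      finally have "32 * (h + 1)\<^sup>2 * (B + (1 / 2) ^ nat \<bar>n - 1\<bar>)\<^sup>2 \<le> 32 * (h + 1)\<^sup>2 * (1764 * T ^ 4 * E)"
        by (intro mult_left_mono) auto
      also have "\<dots> = (32 * (h + 1)\<^sup>2 * 1764) * (T ^ 4 * E)" by simp
      also have "\<dots> \<le> C * (T ^ 4 * E)" using C E T4 by (intro mult_right_mono) auto
      finally have le: "32 * (h + 1)\<^sup>2 * (B + (1 / 2) ^ nat \<bar>n - 1\<bar>)\<^sup>2 \<le> C * T ^ 4 * E" by (simp add: mult_ac)
      show ?thesis
        using avg_prob_le[OF T B green] ennreal_leI[OF le] unfolding h_def by (rule order_trans)
    qed
    then show ?thesis by (simp add: E_def m_def P_def)
  qed
  then show ?thesis using that C(1) c(1) by blast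
qed

lemma sum_inverse_squares_le:
  assumes "finite F" "0 \<notin> F"
  shows "(\<Sum>n\<in>F. inverse ((real_of_int n)\<^sup>2)) \<le> 2 * (\<Sum>k. inverse (real k ^ 2))"
proof -
  have summ: "summable (\<lambda>k. inverse (real k ^ 2))" by (rule inverse_power_summable) simp
  have part: "(\<Sum>n\<in>G. inverse ((real_of_int n)\<^sup>2)) \<le> (\<Sum>k. inverse (real k ^ 2))"
    if G: "finite G" "inj_on (\<lambda>n. nat \<bar>n\<bar>) G" for G
  proof -
    have "(\<Sum>n\<in>G. inverse ((real_of_int n)\<^sup>2)) = (\<Sum>n\<in>G. inverse (real (nat \<bar>n\<bar>) ^ 2))"
      by (intro sum.cong) auto
    also have "\<dots> = (\<Sum>k\<in>(\<lambda>n. nat \<bar>n\<bar>) ` G. inverse (real k ^ 2))"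
      by (simp add: sum.reindex[OF G(2)])
    also have "\<dots> \<le> (\<Sum>k. inverse (real k ^ 2))"
      using G by (intro sum_le_suminf summ) auto
    finally show ?thesis .
  qed
  define P N where "P = {n\<in>F. n > 0}" and "N = {n\<in>F. n < 0}"
  have "n > 0 \<or> n < 0" if "n \<in> F" for n using that assms(2) by (metis linorder_neqE)
  then have PN: "F = P \<union> N" "P \<inter> N = {}" "finite P" "finite N" using assms(1) by (auto simp: P_def N_def)
  have "(\<Sum>n\<in>F. inverse ((real_of_int n)\<^sup>2))
      = (\<Sum>n\<in>P. inverse ((real_of_int n)\<^sup>2)) + (\<Sum>n\<in>N. inverse ((real_of_int n)\<^sup>2))"
    unfolding PN(1) by (rule sum.union_disjoint[OF PN(3,4,2)])
  also have "\<dots> \<le> (\<Sum>k. inverse (real k ^ 2)) + (\<Sum>k. inverse (real k ^ 2))"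
    using PN(3,4) by (intro add_mono part) (auto simp: inj_on_def P_def N_def)
  finally show ?thesis by simp
qed

lemma exp_neg_le_power:
  fixes y :: real
  assumes "y > 0"
  shows "exp (- y) \<le> fact q / y ^ q"
proof -
  have "y ^ q / fact q \<le> exp y"
    using sum_le_suminf[OF summable_exp_generic[of y], of "{q}"] assms
    by (simp add: exp_def divide_inverse mult.commute)
  then show ?thesis using assms by (simp add: exp_minus field_simps)
qed

text \<open>Three scales \<open>\<alpha>1 < \<beta> < \<alpha>\<close>: localization holds at the
  first, and the gap between the last two absorbs the shift by 2 in the cutoff. Beyond
  \<open>T powr \<beta>\<close> the quotient \<open>|n| / T powr \<alpha>1\<close> exceeds a
  positive power of \<open>T\<close>, so a high power of it beats any fixed power of
  \<open>T\<close>. Finite sets suffice because sums in \<open>ennreal\<close> are suprema of finite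
  ones.\<close>

lemma tail_moment_le:
  assumes lam: "lam \<ge> 8" and \<alpha>: "\<alpha> > alpha_bound lam" and p: "p \<ge> 0"
  obtains K where "K > 0"
    "eventually (\<lambda>T. \<forall>F. finite F \<and> (\<forall>n\<in>F. T powr \<alpha> - 2 < \<bar>real_of_int n\<bar>) \<longrightarrow>
       (\<Sum>n\<in>F. ennreal (\<bar>real_of_int n\<bar> powr p) * avg_prob (fib_hamiltonian lam) n T)
         \<le> ennreal (K * T powr (- real M))) at_top"
proof -
  define \<beta> where "\<beta> = (2 * \<alpha> + alpha_bound lam) / 3"
  define \<alpha>1 where "\<alpha>1 = (\<alpha> + 2 * alpha_bound lam) / 3"
  have ord: "0 < alpha_bound lam" "alpha_bound lam < \<alpha>1" "\<alpha>1 < \<beta>" "\<beta> < \<alpha>"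
    using alpha_bound_pos[OF lam] \<alpha> by (auto simp: \<alpha>1_def \<beta>_def)
  obtain C c where C: "C > 0" "c > 0"
    and loc: "\<And>T n. T \<ge> 1 \<Longrightarrow> avg_prob (fib_hamiltonian lam) n T
       \<le> ennreal (C * T ^ 4 * exp (- (c * real (nat \<bar>n\<bar>) / T powr \<alpha>1)))"
    using avg_prob_localization[OF lam ord(2)] by blast
  \<comment> \<open>The first bound makes \<open>p + 2 - q\<close> nonpositive, so
    \<open>x powr (p + 2 - q)\<close> is largest at the cutoff; the second brings the exponent of
    \<open>T\<close> down to \<open>- M\<close>. The factor \<open>x powr (- 2)\<close> is held back
    for summability.\<close>
  obtain q :: nat where q: "real q \<ge> max (p + 2) ((4 + \<beta> * (p + 2) + real M) / (\<beta> - \<alpha>1))"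
    using real_arch_simple by blast
  have q1: "real q \<ge> p + 2" and q2: "4 + \<beta> * (p + 2) + real M \<le> real q * (\<beta> - \<alpha>1)"
    using q ord by (auto simp: pos_divide_le_eq)
  define D where "D = C * fact q / c ^ q"
  have D: "D > 0" using C by (simp add: D_def)
  define Z where "Z = (\<Sum>k. inverse (real k ^ 2))"
  have Z: "Z \<ge> 0" unfolding Z_def by (intro suminf_nonneg inverse_power_summable) auto
  define K where "K = D * (2 * Z + 1)"
  have K: "K > 0" using D Z by (simp add: K_def)
  have "eventually (\<lambda>T::real. T powr (\<alpha> - \<beta>) \<ge> 3) at_top"
  proof -
    have "filterlim (\<lambda>T::real. T powr (\<alpha> - \<beta>)) at_top at_top"
      using ord by real_asymp
    then show ?thesis by (simp add: filterlim_at_top)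
  qed
  then have "eventually (\<lambda>T. \<forall>F. finite F \<and> (\<forall>n\<in>F. T powr \<alpha> - 2 < \<bar>real_of_int n\<bar>) \<longrightarrow>
       (\<Sum>n\<in>F. ennreal (\<bar>real_of_int n\<bar> powr p) * avg_prob (fib_hamiltonian lam) n T)
         \<le> ennreal (K * T powr (- real M))) at_top"
    using eventually_ge_at_top[of "1::real"]
  proof eventually_elim
    case (elim T)
    then have T: "T \<ge> 1" by simp
    have T\<beta>: "T powr \<beta> \<ge> 1" using T ord by (simp add: ge_one_powr_ge_zero)
    have "T powr \<alpha> = T powr \<beta> * T powr (\<alpha> - \<beta>)" by (simp flip: powr_add)
    also have "\<dots> \<ge> T powr \<beta> * 3" using elim by (intro mult_left_mono) auto
    finally have thr: "T powr \<alpha> - 2 \<ge> T powr \<beta>" using T\<beta> by linarith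
    have point: "\<bar>real_of_int n\<bar> powr p * (C * T ^ 4 * exp (- (c * real (nat \<bar>n\<bar>) / T powr \<alpha>1)))
        \<le> D * T powr (- real M) * inverse ((real_of_int n)\<^sup>2)"
      if n: "T powr \<alpha> - 2 < \<bar>real_of_int n\<bar>" for n
    proof -
      define x where "x = \<bar>real_of_int n\<bar>"
      have x: "x \<ge> T powr \<beta>" "x \<ge> 1" using n thr T\<beta> by (auto simp: x_def)
      have nx: "real (nat \<bar>n\<bar>) = x" by (simp add: x_def)
      define y where "y = c * x / T powr \<alpha>1"
      have y: "y > 0" using C x T by (simp add: y_def)
      have "exp (- y) \<le> fact q / y ^ q" by (rule exp_neg_le_power[OF y])
      also have "y ^ q = c ^ q * x powr q / T powr (\<alpha>1 * q)"
        using x T by (simp add: y_def power_divide power_mult_distrib powr_realpow powr_powr flip: powr_realpow)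
      finally have "exp (- y) \<le> fact q / c ^ q * T powr (\<alpha>1 * q) * x powr (- real q)"
        using C by (simp add: powr_minus field_simps)
      then have "x powr p * (C * T ^ 4 * exp (- y))
          \<le> x powr p * (C * T ^ 4 * (fact q / c ^ q * T powr (\<alpha>1 * q) * x powr (- real q)))"
        using C T by (intro mult_left_mono) auto
      also have "\<dots> = D * (T powr 4 * T powr (\<alpha>1 * q)) * (x powr p * x powr (- real q))"
        using T by (simp add: D_def powr_numeral)
      also have "\<dots> = D * T powr (4 + \<alpha>1 * q) * (x powr (- 2) * x powr (p + 2 - q))"
        by (simp flip: powr_add)
      also have "\<dots> \<le> D * T powr (4 + \<alpha>1 * q) * (x powr (- 2) * T powr (\<beta> * (p + 2 - q)))"
      proof (intro mult_left_mono)
        have "x powr (p + 2 - q) \<le> (T powr \<beta>) powr (p + 2 - q)"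
          using x T\<beta> q1 T by (intro powr_mono2') auto
        then show "x powr (p + 2 - q) \<le> T powr (\<beta> * (p + 2 - q))" by (simp add: powr_powr)
      qed (use D in auto)
      also have "\<dots> = D * T powr (4 + \<alpha>1 * q + \<beta> * (p + 2 - q)) * x powr (- 2)"
        by (simp add: powr_add)
      also have "\<dots> \<le> D * T powr (- real M) * x powr (- 2)"
      proof (intro mult_right_mono mult_left_mono powr_mono)
        show "4 + \<alpha>1 * real q + \<beta> * (p + 2 - real q) \<le> - real M"
          using q2 by (simp add: algebra_simps)
      qed (use D T in auto)
      also have "x powr (- 2) = inverse ((real_of_int n)\<^sup>2)"
        using x by (simp add: powr_minus powr_numeral) (simp add: x_def)
      finally show ?thesis by (simp add: nx y_def x_def)
    qed
    show ?case
    proof (intro allI impI, elim conjE)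
      fix F :: "int set"
      assume F: "finite F" "\<forall>n\<in>F. T powr \<alpha> - 2 < \<bar>real_of_int n\<bar>"
      have "0 \<notin> F" using F(2) thr T\<beta> by fastforce
      have "(\<Sum>n\<in>F. ennreal (\<bar>real_of_int n\<bar> powr p) * avg_prob (fib_hamiltonian lam) n T)
          \<le> (\<Sum>n\<in>F. ennreal (D * T powr (- real M) * inverse ((real_of_int n)\<^sup>2)))"
      proof (rule sum_mono)
        fix n assume "n \<in> F"
        have "ennreal (\<bar>real_of_int n\<bar> powr p) * avg_prob (fib_hamiltonian lam) n T
            \<le> ennreal (\<bar>real_of_int n\<bar> powr p) * ennreal (C * T ^ 4 * exp (- (c * real (nat \<bar>n\<bar>) / T powr \<alpha>1)))"
          by (intro mult_left_mono loc T) auto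
        also have "\<dots> = ennreal (\<bar>real_of_int n\<bar> powr p * (C * T ^ 4 * exp (- (c * real (nat \<bar>n\<bar>) / T powr \<alpha>1))))"
          using C T by (intro ennreal_mult[symmetric]) auto
        also have "\<dots> \<le> ennreal (D * T powr (- real M) * inverse ((real_of_int n)\<^sup>2))"
          using F \<open>n \<in> F\<close> by (intro ennreal_leI point) auto
        finally show "ennreal (\<bar>real_of_int n\<bar> powr p) * avg_prob (fib_hamiltonian lam) n T
            \<le> ennreal (D * T powr (- real M) * inverse ((real_of_int n)\<^sup>2))" .
      qed
      also have "\<dots> = ennreal (D * T powr (- real M) * (\<Sum>n\<in>F. inverse ((real_of_int n)\<^sup>2)))"
        using D by (simp add: sum_ennreal sum_distrib_left)
      also have "\<dots> \<le> ennreal (D * T powr (- real M) * (2 * Z + 1))"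
        using sum_inverse_squares_le[OF F(1) \<open>0 \<notin> F\<close>] D
        by (intro ennreal_leI mult_left_mono) (auto simp: Z_def)
      also have "D * T powr (- real M) * (2 * Z + 1) = K * T powr (- real M)" by (simp add: K_def)
      finally show "(\<Sum>n\<in>F. ennreal (\<bar>real_of_int n\<bar> powr p) * avg_prob (fib_hamiltonian lam) n T)
         \<le> ennreal (K * T powr (- real M))" .
    qed
  qed
  then show ?thesis using that[OF K] by blast
qed

section \<open>From tail bounds to transport exponents\<close>

lemma log_ennreal_le:
  assumes "x \<le> ennreal r" "r > 0"
  shows "log_ennreal x \<le> ereal (ln r)"
proof (cases "x = 0")
  case False
  have fin: "x \<noteq> \<infinity>" using assms(1) by (auto simp: top_unique)
  then have pos: "enn2real x > 0" using False by (simp add: enn2real_positive_iff less_top zero_less_iff_neq_zero)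
  have "enn2real x \<le> r" using assms by (simp add: enn2real_leI)
  then show ?thesis using False fin pos by (simp add: log_ennreal_def)
qed (simp add: log_ennreal_def)

lemma infsum_ennreal_le:
  fixes f :: "'a \<Rightarrow> ennreal"
  assumes "\<And>F. finite F \<Longrightarrow> F \<subseteq> A \<Longrightarrow> sum f F \<le> B"
  shows "infsum f A \<le> B"
  by (subst nonneg_infsum_complete) (auto intro!: SUP_least assms)

text \<open>The tail is smaller than every power of \<open>T\<close>, so the quotient of logarithms
  tends to minus infinity. For infinite \<alpha> the tail is an empty sum with logarithm minus
  infinity.\<close>

lemma S_plus_eq_infinity:
  assumes lam: "lam \<ge> 8" and \<alpha>: "\<alpha> > ereal (alpha_bound lam)"
  shows "S_plus (fib_hamiltonian lam) \<alpha> = \<infinity>"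
proof -
  define g where "g T = log_ennreal (outside_prob (fib_hamiltonian lam) (powr_ereal T \<alpha> - 2) T) / ereal (ln T)" for T
  have "Limsup at_top g \<le> ereal (- real M)" for M
  proof (cases \<alpha>)
    case PInf
    have "eventually (\<lambda>T. g T \<le> ereal (- real M)) at_top"
      using eventually_gt_at_top[of 1]
    proof eventually_elim
      case (elim T)
      then show ?case
        by (simp add: g_def PInf powr_ereal_def outside_prob_def log_ennreal_def)
    qed
    then show ?thesis by (rule Limsup_bounded)
  next
    case (real r)
    obtain K where K: "K > 0" and ev: "eventually (\<lambda>T. \<forall>F. finite F \<and> (\<forall>n\<in>F. T powr r - 2 < \<bar>real_of_int n\<bar>) \<longrightarrow>
       (\<Sum>n\<in>F. ennreal (\<bar>real_of_int n\<bar> powr 0) * avg_prob (fib_hamiltonian lam) n T)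
         \<le> ennreal (K * T powr (- real (Suc M)))) at_top"
      using tail_moment_le[OF lam, of r 0 "Suc M"] \<alpha> real by auto
    \<comment> \<open>\<open>0 powr 0\<close> is 0, so the weight \<open>|n| powr 0\<close> equals 1
      only for nonzero \<open>n\<close>; a positive cutoff keeps \<open>n = 0\<close> out of the
      sum.\<close>
    have pos: "eventually (\<lambda>T. T powr r - 2 > 0) at_top"
    proof -
      have "r > 0" using \<alpha> real alpha_bound_pos[OF lam] by simp
      then have "filterlim (\<lambda>T::real. T powr r) at_top at_top"
        by real_asymp
      then have "eventually (\<lambda>T. T powr r > 2) at_top" by (simp add: filterlim_at_top_dense)
      then show ?thesis by eventually_elim simp
    qed
    have "eventually (\<lambda>T. g T \<le> ereal (- real M)) at_top"
      using ev pos eventually_gt_at_top[of 1] eventually_ge_at_top[of K]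
    proof eventually_elim
      case (elim T)
      have T: "T > 1" "ln T > 0" "K \<le> T" using elim by auto
      have thr: "powr_ereal T \<alpha> - 2 = ereal (T powr r - 2)"
        by (simp add: powr_ereal_def real)
      have "outside_prob (fib_hamiltonian lam) (powr_ereal T \<alpha> - 2) T \<le> ennreal (K * T powr (- real (Suc M)))"
        unfolding outside_prob_def thr
      proof (rule infsum_ennreal_le)
        fix F assume F: "finite F" "F \<subseteq> {n. ereal (T powr r - 2) < ereal \<bar>real_of_int n\<bar>}"
        have "sum (\<lambda>n. avg_prob (fib_hamiltonian lam) n T) F
            = (\<Sum>n\<in>F. ennreal (\<bar>real_of_int n\<bar> powr 0) * avg_prob (fib_hamiltonian lam) n T)"
          using F elim(2) by (intro sum.cong) auto
        also have "\<dots> \<le> ennreal (K * T powr (- real (Suc M)))" using elim(1) F by auto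
        finally show "sum (\<lambda>n. avg_prob (fib_hamiltonian lam) n T) F \<le> ennreal (K * T powr (- real (Suc M)))" .
      qed
      also have "K * T powr (- real (Suc M)) \<le> T * T powr (- real (Suc M))"
        using T by (intro mult_right_mono) auto
      also have "\<dots> = T powr (- real M)" using T by (simp add: powr_mult_base)
      finally have "outside_prob (fib_hamiltonian lam) (powr_ereal T \<alpha> - 2) T \<le> ennreal (T powr (- real M))"
        by (simp add: ennreal_leI)
      then have "log_ennreal (outside_prob (fib_hamiltonian lam) (powr_ereal T \<alpha> - 2) T) \<le> ereal (ln (T powr (- real M)))"
        using T by (intro log_ennreal_le) auto
      then have "g T \<le> ereal (ln (T powr (- real M))) / ereal (ln T)"
        unfolding g_def using T by (intro ereal_divide_right_mono) auto
      also have "\<dots> = ereal (- real M)" using T by (simp add: ln_powr)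
      finally show ?case .
    qed
    then show ?thesis by (rule Limsup_bounded)
  next
    case MInf
    then show ?thesis using \<alpha> by simp
  qed
  then have le: "Limsup at_top g \<le> ereal (- real M)" for M .
  have "Limsup at_top g \<le> ereal B" for B
  proof -
    obtain M :: nat where "- B \<le> real M" using real_arch_simple by blast
    then have "ereal (- real M) \<le> ereal B" by simp
    then show ?thesis using le[of M] by (rule order_trans[rotated])
  qed
  then have "Limsup at_top g = - \<infinity>" by (rule ereal_bot)
  then show ?thesis by (simp add: S_plus_def g_def[abs_def])
qed

text \<open>Within the cutoff the weight is at most \<open>T powr (\<alpha> * p)\<close> and the
  probabilities sum to at most 1; outside, the moment stays bounded. The estimate uses the tail
  bound directly and does not pass through \<open>alpha_u_plus\<close>.\<close>

lemma beta_plus_le: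
  assumes lam: "lam \<ge> 8" and \<alpha>: "\<alpha> > alpha_bound lam" and p: "p > 0"
  shows "beta_plus (fib_hamiltonian lam) p \<le> ereal \<alpha>"
proof -
  have \<alpha>0: "\<alpha> > 0" using alpha_bound_pos[OF lam] \<alpha> by simp
  obtain K where K: "K > 0" and ev: "eventually (\<lambda>T. \<forall>F. finite F \<and> (\<forall>n\<in>F. T powr \<alpha> - 2 < \<bar>real_of_int n\<bar>) \<longrightarrow>
       (\<Sum>n\<in>F. ennreal (\<bar>real_of_int n\<bar> powr p) * avg_prob (fib_hamiltonian lam) n T)
         \<le> ennreal (K * T powr (- real 0))) at_top"
    using tail_moment_le[OF lam \<alpha>, of p 0] p by auto
  define g where "g T = (\<alpha> * p * ln T + ln (1 + K)) / (p * ln T)" for T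
  have "eventually (\<lambda>T. log_ennreal (moment (fib_hamiltonian lam) p T) / ereal (p * ln T) \<le> ereal (g T)) at_top"
    using ev eventually_gt_at_top[of 1]
  proof eventually_elim
    case (elim T)
    then have T: "T > 1" "ln T > 0" by auto
    let ?a = "\<lambda>n. avg_prob (fib_hamiltonian lam) n T" and ?N = "T powr \<alpha> - 2"
    have "moment (fib_hamiltonian lam) p T \<le> ennreal ((T powr \<alpha>) powr p + K)"
      unfolding moment_def
    proof (rule infsum_ennreal_le)
      fix F :: "int set" assume F: "finite F"
      define A B where "A = {n\<in>F. \<bar>real_of_int n\<bar> \<le> ?N}" and "B = {n\<in>F. ?N < \<bar>real_of_int n\<bar>}"
      have AB: "F = A \<union> B" "A \<inter> B = {}" "finite A" "finite B" using F by (auto simp: A_def B_def)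
      have "(\<Sum>n\<in>A. ennreal (\<bar>real_of_int n\<bar> powr p) * ?a n) \<le> (\<Sum>n\<in>A. ennreal ((T powr \<alpha>) powr p) * ?a n)"
        by (intro sum_mono mult_right_mono ennreal_leI powr_mono2) (use p in \<open>auto simp: A_def\<close>)
      also have "\<dots> \<le> ennreal ((T powr \<alpha>) powr p) * 1"
        unfolding sum_distrib_left[symmetric] using T AB by (intro mult_left_mono sum_avg_prob_le_1) auto
      finally have 1: "(\<Sum>n\<in>A. ennreal (\<bar>real_of_int n\<bar> powr p) * ?a n) \<le> ennreal ((T powr \<alpha>) powr p)" by simp
      have "(\<Sum>n\<in>B. ennreal (\<bar>real_of_int n\<bar> powr p) * ?a n) \<le> ennreal (K * T powr (- real 0))"
        using elim(1) AB by (auto simp: B_def)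
      then have 2: "(\<Sum>n\<in>B. ennreal (\<bar>real_of_int n\<bar> powr p) * ?a n) \<le> ennreal K"
        using T by simp
      show "(\<Sum>n\<in>F. ennreal (\<bar>real_of_int n\<bar> powr p) * ?a n) \<le> ennreal ((T powr \<alpha>) powr p + K)"
        using add_mono[OF 1 2] K by (subst AB(1), subst sum.union_disjoint) (use AB in auto)
    qed
    also have "ennreal ((T powr \<alpha>) powr p + K) \<le> ennreal (T powr (\<alpha> * p) * (1 + K))"
    proof (rule ennreal_leI)
      have "1 \<le> T powr (\<alpha> * p)" using T \<alpha>0 p by (simp add: ge_one_powr_ge_zero)
      then have "1 * K \<le> T powr (\<alpha> * p) * K" using K by (intro mult_right_mono) auto
      then show "(T powr \<alpha>) powr p + K \<le> T powr (\<alpha> * p) * (1 + K)" by (simp add: powr_powr algebra_simps)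
    qed
    finally have "log_ennreal (moment (fib_hamiltonian lam) p T) \<le> ereal (ln (T powr (\<alpha> * p) * (1 + K)))"
      using T K by (intro log_ennreal_le) auto
    also have "ln (T powr (\<alpha> * p) * (1 + K)) = \<alpha> * p * ln T + ln (1 + K)"
      using T K by (simp add: ln_mult ln_powr)
    finally have "log_ennreal (moment (fib_hamiltonian lam) p T) / ereal (p * ln T)
        \<le> ereal (\<alpha> * p * ln T + ln (1 + K)) / ereal (p * ln T)"
      using T p by (intro ereal_divide_right_mono) auto
    then show ?case using T p by (simp add: g_def)
  qed
  then have "beta_plus (fib_hamiltonian lam) p \<le> Limsup at_top (\<lambda>T. ereal (g T))"
    unfolding beta_plus_def by (rule Limsup_mono)
  also have "\<dots> = ereal \<alpha>"
  proof (intro lim_imp_Limsup)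
    have "(g \<longlongrightarrow> \<alpha>) at_top" unfolding g_def using p by real_asymp
    then show "((\<lambda>T. ereal (g T)) \<longlongrightarrow> ereal \<alpha>) at_top" by simp
  qed simp
  finally show ?thesis .
qed

theorem theorem3:
  fixes lam :: real
  assumes "lam \<ge> 8"
  shows "alpha_u_plus (fib_hamiltonian lam) \<le> ereal (alpha_bound lam) \<and>
    (\<forall>p::real. p > 0 \<longrightarrow> beta_plus (fib_hamiltonian lam) p \<le> ereal (alpha_bound lam))"
proof (intro conjI allI impI)
  show "alpha_u_plus (fib_hamiltonian lam) \<le> ereal (alpha_bound lam)"
    unfolding alpha_u_plus_def
  proof (rule Sup_least)
    fix \<alpha> assume "\<alpha> \<in> {\<alpha>. 0 \<le> \<alpha> \<and> S_plus (fib_hamiltonian lam) \<alpha> < \<infinity>}"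
    then show "\<alpha> \<le> ereal (alpha_bound lam)"
      using S_plus_eq_infinity[OF assms, of \<alpha>] by (cases "\<alpha> \<le> ereal (alpha_bound lam)") auto
  qed
next
  fix p :: real assume p: "p > 0"
  show "beta_plus (fib_hamiltonian lam) p \<le> ereal (alpha_bound lam)"
  proof (rule ereal_le_epsilon2)
    fix e :: real assume "0 < e"
    then show "beta_plus (fib_hamiltonian lam) p \<le> ereal (alpha_bound lam) + ereal e"
      using beta_plus_le[OF assms _ p, of "alpha_bound lam + e"] by simp
  qed
qed

end
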